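(* Let $\varepsilon_j>0$ with $\varepsilon_j\to0$. For every $(\mathbf n,g)\in L^1(\mathbb T^2,\mathbb S^2)\times L^2(\mathbb T^2)$ and every sequence $(\mathbf n_j,g_j)\in\mathcal Y$ such that $(\mathbf n_j,g_j)$ converges to $(\mathbf n,g)$ in $L^1(\mathbb T^2)\times L^2(\mathbb T^2)$, there holds $$\liminf_{j\to\infty}G_{\varepsilon_j}(\mathbf n_j,g_j)\ \ge\ G_0(\mathbf n,g),$$ and $(\mathbf n,g)\in\mathcal A$.
   Context: Fix constants $\sigma>0$ and $l>0$. Put $A=(1+\sigma)^{-1}\in(0,1)$, $\bar n_1=\sqrt{1-A^2}$, and $\mathbf n^{\pm}=(\pm\bar n_1,0,A)\in\mathbb S^2$. Let $\mathbb T^2=\mathbb R^2/(2l\mathbb Z)^2$ be the flat torus, i.e. the square $[-l,l)^2$ with periodic boundary conditions. For $\mathbf n=(n_1,n_2,n_3)\in\mathbb S^2$ let $$W(\mathbf n)=\sigma n_2^2+\frac1A(n_3-A)^2\ \ge 0,$$ whose zero set on $\mathbb S^2$ is $\{\mathbf n^+,\mathbf n^-\}$. For $\varepsilon>0$ let $$F_\varepsilon(\mathbf n,g)=\int_{\mathbb T^2}\Big[\varepsilon|\nabla\mathbf n|^2+\frac1\varepsilon W(\mathbf n)+\frac1\varepsilon(g_x+n_1)^2+\frac1\varepsilon(g_y+n_2)^2\Big]\,dx\,dy .$$ Let $\mathcal Y=W^{1,2}(\mathbb T^2,\mathbb S^2)\times W^{1,2}(\mathbb T^2)$ and $$\mathcal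 A=\Big\{(\mathbf n,g)\in BV(\mathbb T^2,\{\mathbf n^{\pm}\})\times W^{1,2}(\mathbb T^2):\ g_x\in BV(\mathbb T^2,\{\pm\bar n_1\}),\ g=g(x),\ \mathbf n=\mathbf n(x),\ g_x+n_1=0\text{ a.e.},\ n_2=0\text{ a.e.},\ \int_{\mathbb T^2}n_1=0\Big\}$$ (here $g=g(x)$, $\mathbf n=\mathbf n(x)$ mean dependence on $x$ only). On $L^1(\mathbb T^2,\mathbb S^2)\times L^2(\mathbb T^2)$ define $G_\varepsilon(\mathbf n,g)=F_\varepsilon(\mathbf n,g)$ if $(\mathbf n,g)\in\mathcal Y$ and $+\infty$ otherwise; and $G_0(\mathbf n,g)=2c_0P_{\mathbb T^2}(A_{\mathbf n^-})$ if $(\mathbf n,g)\in\mathcal A$ and $+\infty$ otherwise, where $A_{\mathbf n^-}=\{(x,y)\in\mathbb T^2:\mathbf n(x)=\mathbf n^-\}$, $P_{\mathbb T^2}$ is the perimeter in the torus, and $$c_0=\inf\Big\{\int_0^1\sqrt{W(\gamma(t))}\,|\gamma'(t)|\,dt:\ \gamma\in C^1([0,1],\mathbb S^2),\ \gamma(0)=\mathbf n^-,\ \gamma(1)=\mathbf n^+\Big\}.$$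
   Formalization: The clause "(n,g) in A" is proved only when liminf G_{ε_j}(n_j,g_j) is finite; without this it fails, e.g. for n_j=n=(0,1,0), g_j=g=0. The liminf inequality itself is unconditional. *)

theory Defs
  imports "HOL-Analysis.Analysis"
begin

text \<open>
  The flat torus is the fundamental square carrying Lebesgue measure. A function on the torus is a
  function on the plane of which only the values on the square matter. The periodic boundary
  conditions enter through the test functions, which are periodic on the whole plane: jumps across
  opposite sides of the square are therefore seen by weak derivatives and by the total variation.
\<close>

definition torus :: "real \<Rightarrow> (real \<times> real) set" where
  "torus l = {-l..<l} \<times> {-l..<l}"

definition torus_measure :: "real \<Rightarrow> (real \<times> real) measure" where
  "torus_measure l = lebesgue_on (torus l)"

primrec C_k :: "nat \<Rightarrow> ('a::euclidean_space \<Rightarrow> 'b::real_normed_vector) \<Rightarrow> bool" where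
  "C_k 0 f \<longleftrightarrow> continuous_on UNIV f"
| "C_k (Suc k) f \<longleftrightarrow> f differentiable_on UNIV \<and>
     (\<forall>b\<in>Basis. C_k k (\<lambda>p. frechet_derivative f (at p) b))"

definition C_infinity :: "('a::euclidean_space \<Rightarrow> 'b::real_normed_vector) \<Rightarrow> bool" where
  "C_infinity f \<longleftrightarrow> (\<forall>k. C_k k f)"

definition periodic :: "real \<Rightarrow> (real \<times> real \<Rightarrow> 'b) \<Rightarrow> bool" where
  "periodic l f \<longleftrightarrow> (\<forall>x y. f (x + 2 * l, y) = f (x, y) \<and> f (x, y + 2 * l) = f (x, y))"

definition test_fun :: "real \<Rightarrow> (real \<times> real \<Rightarrow> 'b::real_normed_vector) \<Rightarrow> bool" where
  "test_fun l \<phi> \<longleftrightarrow> C_infinity \<phi> \<and> periodic l \<phi>"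

definition L2_torus :: "real \<Rightarrow> (real \<times> real \<Rightarrow> 'b::euclidean_space) \<Rightarrow> bool" where
  "L2_torus l u \<longleftrightarrow> u \<in> borel_measurable (torus_measure l) \<and>
     integrable (torus_measure l) (\<lambda>p. (norm (u p))\<^sup>2)"

definition has_weak_deriv ::
  "real \<Rightarrow> real \<times> real \<Rightarrow> (real \<times> real \<Rightarrow> 'b::euclidean_space) \<Rightarrow> (real \<times> real \<Rightarrow> 'b) \<Rightarrow> bool" where
  "has_weak_deriv l b u v \<longleftrightarrow>
     integrable (torus_measure l) u \<and> integrable (torus_measure l) v \<and>
     (\<forall>\<phi> :: real \<times> real \<Rightarrow> real. test_fun l \<phi> \<longrightarrow>
        (LINT p|torus_measure l. frechet_derivative \<phi> (at p) b *\<^sub>R u p) =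
        - (LINT p|torus_measure l. \<phi> p *\<^sub>R v p))"

text \<open>A representative: weak derivatives are unique only up to null sets.\<close>

definition weak_deriv ::
  "real \<Rightarrow> real \<times> real \<Rightarrow> (real \<times> real \<Rightarrow> 'b::euclidean_space) \<Rightarrow> real \<times> real \<Rightarrow> 'b" where
  "weak_deriv l b u = (SOME v. has_weak_deriv l b u v)"

abbreviation weak_dx :: "real \<Rightarrow> (real \<times> real \<Rightarrow> 'b::euclidean_space) \<Rightarrow> real \<times> real \<Rightarrow> 'b" where
  "weak_dx l \<equiv> weak_deriv l (1, 0)"

abbreviation weak_dy :: "real \<Rightarrow> (real \<times> real \<Rightarrow> 'b::euclidean_space) \<Rightarrow> real \<times> real \<Rightarrow> 'b" where
  "weak_dy l \<equiv> weak_deriv l (0, 1)"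

definition W12_torus :: "real \<Rightarrow> (real \<times> real \<Rightarrow> 'b::euclidean_space) \<Rightarrow> bool" where
  "W12_torus l u \<longleftrightarrow> L2_torus l u \<and>
     (\<forall>b\<in>{(1, 0), (0, 1)}. \<exists>v. has_weak_deriv l b u v \<and> L2_torus l v)"

text \<open>
  The supremum runs over pairs of test functions with values in the target space, that is, over
  matrix-valued test fields bounded by 1 in the Frobenius norm.
\<close>

definition total_variation :: "real \<Rightarrow> (real \<times> real \<Rightarrow> 'b::euclidean_space) \<Rightarrow> ennreal" where
  "total_variation l u =
     (SUP (\<phi>, \<psi>) \<in> {(\<phi>, \<psi>). test_fun l \<phi> \<and> test_fun l \<psi> \<and>
                            (\<forall>p. (norm (\<phi> p))\<^sup>2 + (norm (\<psi> p))\<^sup>2 \<le> 1)}.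
        ennreal (LINT p|torus_measure l.
          u p \<bullet> (frechet_derivative \<phi> (at p) (1, 0) + frechet_derivative \<psi> (at p) (0, 1))))"

definition BV_torus :: "real \<Rightarrow> (real \<times> real \<Rightarrow> 'b::euclidean_space) \<Rightarrow> bool" where
  "BV_torus l u \<longleftrightarrow> integrable (torus_measure l) u \<and> total_variation l u < \<infinity>"

definition perimeter_torus :: "real \<Rightarrow> (real \<times> real) set \<Rightarrow> ennreal" where
  "perimeter_torus l E = total_variation l (indicator E :: real \<times> real \<Rightarrow> real)"

definition depends_on_x_only :: "real \<Rightarrow> (real \<times> real \<Rightarrow> 'b) \<Rightarrow> bool" where
  "depends_on_x_only l u \<longleftrightarrow> (\<exists>h. AE p in torus_measure l. u p = h (fst p))"

definition A_const :: "real \<Rightarrow> real" where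
  "A_const \<sigma> = 1 / (1 + \<sigma>)"

definition n1_bar :: "real \<Rightarrow> real" where
  "n1_bar \<sigma> = sqrt (1 - (A_const \<sigma>)\<^sup>2)"

definition n_plus :: "real \<Rightarrow> real^3" where
  "n_plus \<sigma> = vector [n1_bar \<sigma>, 0, A_const \<sigma>]"

definition n_minus :: "real \<Rightarrow> real^3" where
  "n_minus \<sigma> = vector [- n1_bar \<sigma>, 0, A_const \<sigma>]"

definition W_pot :: "real \<Rightarrow> real^3 \<Rightarrow> real" where
  "W_pot \<sigma> n = \<sigma> * (n $ 2)\<^sup>2 + 1 / A_const \<sigma> * (n $ 3 - A_const \<sigma>)\<^sup>2"

definition L1_sphere :: "real \<Rightarrow> (real \<times> real \<Rightarrow> real^3) \<Rightarrow> bool" where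
  "L1_sphere l n \<longleftrightarrow> integrable (torus_measure l) n \<and> (AE p in torus_measure l. n p \<in> sphere 0 1)"

definition Y_space :: "real \<Rightarrow> ((real \<times> real \<Rightarrow> real^3) \<times> (real \<times> real \<Rightarrow> real)) set" where
  "Y_space l = {(n, g). W12_torus l n \<and> (AE p in torus_measure l. n p \<in> sphere 0 1) \<and> W12_torus l g}"

definition F_energy ::
  "real \<Rightarrow> real \<Rightarrow> real \<Rightarrow> (real \<times> real \<Rightarrow> real^3) \<Rightarrow> (real \<times> real \<Rightarrow> real) \<Rightarrow> ennreal" where
  "F_energy \<sigma> l \<epsilon> n g =
     (\<integral>\<^sup>+p. ennreal (\<epsilon> * ((norm (weak_dx l n p))\<^sup>2 + (norm (weak_dy l n p))\<^sup>2)
                   + 1 / \<epsilon> * W_pot \<sigma> (n p)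
                   + 1 / \<epsilon> * (weak_dx l g p + n p $ 1)\<^sup>2
                   + 1 / \<epsilon> * (weak_dy l g p + n p $ 2)\<^sup>2) \<partial>torus_measure l)"

definition A_space ::
  "real \<Rightarrow> real \<Rightarrow> ((real \<times> real \<Rightarrow> real^3) \<times> (real \<times> real \<Rightarrow> real)) set" where
  "A_space \<sigma> l = {(n, g).
     BV_torus l n \<and> (AE p in torus_measure l. n p \<in> {n_plus \<sigma>, n_minus \<sigma>}) \<and>
     W12_torus l g \<and>
     BV_torus l (weak_dx l g) \<and>
     (AE p in torus_measure l. weak_dx l g p \<in> {n1_bar \<sigma>, - n1_bar \<sigma>}) \<and>
     depends_on_x_only l g \<and> depends_on_x_only l n \<and>
     (AE p in torus_measure l. weak_dx l g p + n p $ 1 = 0) \<and>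
     (AE p in torus_measure l. n p $ 2 = 0) \<and>
     (LINT p|torus_measure l. n p $ 1) = 0}"

definition C1_curve :: "(real \<Rightarrow> 'a::real_normed_vector) \<Rightarrow> bool" where
  "C1_curve \<gamma> \<longleftrightarrow> \<gamma> differentiable_on {0..1} \<and>
     continuous_on {0..1} (\<lambda>t. vector_derivative \<gamma> (at t within {0..1}))"

definition c0_const :: "real \<Rightarrow> real" where
  "c0_const \<sigma> =
     (INF \<gamma> \<in> {\<gamma>. C1_curve \<gamma> \<and> \<gamma> ` {0..1} \<subseteq> sphere 0 1 \<and> \<gamma> 0 = n_minus \<sigma> \<and> \<gamma> 1 = n_plus \<sigma>}.
        integral {0..1}
          (\<lambda>t. sqrt (W_pot \<sigma> (\<gamma> t)) * norm (vector_derivative \<gamma> (at t within {0..1}))))"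

definition G_energy ::
  "real \<Rightarrow> real \<Rightarrow> real \<Rightarrow> (real \<times> real \<Rightarrow> real^3) \<Rightarrow> (real \<times> real \<Rightarrow> real) \<Rightarrow> ennreal" where
  "G_energy \<sigma> l \<epsilon> n g = (if (n, g) \<in> Y_space l then F_energy \<sigma> l \<epsilon> n g else \<infinity>)"

definition G_limit ::
  "real \<Rightarrow> real \<Rightarrow> (real \<times> real \<Rightarrow> real^3) \<Rightarrow> (real \<times> real \<Rightarrow> real) \<Rightarrow> ennreal" where
  "G_limit \<sigma> l n g =
     (if (n, g) \<in> A_space \<sigma> l
      then ennreal (2 * c0_const \<sigma>) * perimeter_torus l {p \<in> torus l. n p = n_minus \<sigma>}
      else \<infinity>)"

end

theory Submission
  imports Defs
begin

text \<open>
  Bounded energy forces \<open>W(n) = 0\<close>, \<open>g\<^sub>x = -n\<^sub>1\<close> and \<open>g\<^sub>y = -n\<^sub>2 = 0\<close> in the limit. Hence \<open>g\<close> depends on \<open>x\<close>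
  only, and so does \<open>n\<close>, which takes the two values \<open>n\<^sup>+\<close> and \<open>n\<^sup>-\<close>. The lower bound can therefore be read off on
  horizontal lines. On almost every line \<open>n\<^sub>j\<close> is absolutely continuous, and between a point where the limit is
  \<open>n\<^sup>-\<close> and a point where it is \<open>n\<^sup>+\<close> the weighted length of \<open>n\<^sub>j\<close>, which half the energy
  dominates, is at least \<open>c\<^sub>0\<close> up to an error tending to \<open>0\<close>. By Fatou's lemma
  the set where \<open>n(x + h, y) \<noteq> n(x, y)\<close> has measure at most \<open>h / (2 c\<^sub>0)\<close> times the limit energy.
  Replacing \<open>\<partial>\<^sub>x\<close> in the definition of the total variation by difference quotients turns this into the perimeter
  bound. Since \<open>c\<^sub>0 > 0\<close>, it also shows that \<open>n\<close> has bounded variation.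
\<close>

section \<open>The torus as a product of Borel measure spaces\<close>

text \<open>Two obstacles shape the proof. Weak derivatives are only tested against smooth periodic
  functions, yet genuine curves on lines are needed. Every such passage uses the test functions
  cos(a pi x / l + b pi y / l + c), which are closed under differentiation and whose integrals
  determine an integrable function: uniqueness of weak derivatives, absolute continuity on lines and
  dependence on x only become statements about these coefficients. In particular n_1 = -g_x inherits
  from g the vanishing of all coefficients with b nonzero, and on the wells the sign of n_1
  determines n. Moreover, \<open>c0_const\<close> is an infimum over C1 curves on the sphere that
  join the wells exactly, whereas a slice is merely absolutely continuous and only comes close to
  them. Smoothing it and joining its ends to the wells leaves the sphere; radial projection brings
  it back with control of the weighted length. The factor 2 in the limit comes from 2 sqrt(W) |n_x|
  <= \<epsilon> |n_x|^2 + W / \<epsilon>. Translations in x suffice for the perimeter, since for a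
  function of x the y part of a test field integrates to 0.\<close>

text \<open>A density rather than a restricted space: the measurable sets are then all Borel sets of the line,
  at the price that membership in the square holds only almost everywhere.\<close>

definition side :: "real \<Rightarrow> real measure" where
  "side l = density lborel (indicator {-l..<l})"

abbreviation torus_prod :: "real \<Rightarrow> (real \<times> real) measure" where
  "torus_prod l \<equiv> side l \<Otimes>\<^sub>M side l"

lemma space_side [simp]: "space (side l) = UNIV"
  by (simp add: side_def)

lemma sets_side [measurable_cong, simp]: "sets (side l) = sets borel"
  by (simp add: side_def)

lemma space_torus_prod [simp]: "space (torus_prod l) = UNIV"
  by (simp add: space_pair_measure)

lemma sets_torus_prod: "sets (torus_prod l) = sets borel"
  by (simp only: sets_pair_measure_cong[OF sets_side sets_side] borel_prod)

lemma borel_measurable_torus_prod: "borel_measurable (torus_prod l) = borel_measurable borel"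
  by (rule measurable_cong_sets[OF sets_torus_prod refl])

lemma emeasure_side: "l > 0 \<Longrightarrow> emeasure (side l) UNIV = ennreal (2 * l)"
  by (simp add: side_def emeasure_density)

lemma finite_measure_side: "finite_measure (side l)"
  by (rule finite_measureI) (cases "l > 0"; simp add: side_def emeasure_density)

lemma pair_sigma_finite_side: "pair_sigma_finite (side l) (side l)"
  using finite_measure_side[of l] by (intro pair_sigma_finite.intro) (auto intro: finite_measure.axioms(1))

lemma finite_measure_torus_prod: "finite_measure (torus_prod l)"
proof -
  interpret s: finite_measure "side l" by (rule finite_measure_side)
  have "emeasure (torus_prod l) (UNIV \<times> UNIV) \<noteq> \<infinity>"
    using s.emeasure_finite[of UNIV]
    by (subst s.emeasure_pair_measure_Times) (simp_all add: ennreal_mult_eq_top_iff)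
  then show ?thesis by (intro finite_measureI) simp
qed

lemma torus_borel: "torus l \<in> sets (borel :: (real \<times> real) measure)"
proof -
  have "torus l \<in> sets (borel \<Otimes>\<^sub>M borel)" unfolding torus_def by (intro pair_measureI) auto
  then show ?thesis by (simp only: borel_prod)
qed

text \<open>Sigma-finite measures that agree on rectangles coincide. This identity is the bridge
  between Lebesgue measure on the square, in which the problem is stated, and the product measure,
  on which Fubini and slicing operate.\<close>

lemma torus_prod_eq_density: "torus_prod l = density lborel (indicator (torus l))"
proof (rule pair_measure_eqI)
  show "sigma_finite_measure (side l)" "sigma_finite_measure (side l)"
    using finite_measure_side[of l] by (auto intro: finite_measure.axioms(1))
  show "sets (torus_prod l) = sets (density lborel (indicator (torus l)))"
    by (simp only: sets_torus_prod sets_density sets_lborel)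
  fix A B assume "A \<in> sets (side l)" "B \<in> sets (side l)"
  then have AB: "A \<in> sets borel" "B \<in> sets borel" by auto
  have *: "A \<times> B \<in> sets (borel \<Otimes>\<^sub>M borel)" using AB by (intro pair_measureI)
  then have *: "A \<times> B \<in> sets lborel" by (simp only: borel_prod sets_lborel)
  have "emeasure (density lborel (indicator (torus l))) (A \<times> B) = emeasure lborel (torus l \<inter> (A \<times> B))"
    using * torus_borel by (intro emeasure_restricted) auto
  also have "torus l \<inter> (A \<times> B) = ({-l..<l} \<inter> A) \<times> ({-l..<l} \<inter> B)" by (auto simp: torus_def)
  also have "emeasure lborel \<dots> = emeasure (lborel \<Otimes>\<^sub>M lborel) (({-l..<l} \<inter> A) \<times> ({-l..<l} \<inter> B))"
    by (simp only: lborel_prod)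
  also have "\<dots> = emeasure lborel ({-l..<l} \<inter> A) * emeasure lborel ({-l..<l} \<inter> B)"
    using AB by (intro lborel.emeasure_pair_measure_Times) auto
  also have "\<dots> = emeasure (side l) A * emeasure (side l) B"
    using AB unfolding side_def by (intro arg_cong2[where f = "(*)"] emeasure_restricted[symmetric]) auto
  finally show "emeasure (side l) A * emeasure (side l) B = emeasure (density lborel (indicator (torus l))) (A \<times> B)"
    by (rule sym)
qed

lemma AE_torus_iff: "(AE p in torus_prod l. P p) \<longleftrightarrow> (AE p in lborel. p \<in> torus l \<longrightarrow> P p)"
  unfolding torus_prod_eq_density using torus_borel
  by (subst AE_density) (auto simp: indicator_def)

lemma AE_torus: "(AE p in torus_measure l. P p) \<longleftrightarrow> (AE p in torus_prod l. P p)"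
  unfolding AE_torus_iff torus_measure_def using torus_borel
  by (subst AE_restrict_space_iff) (simp_all add: AE_completion_iff)

lemma AE_in_torus: "AE p in torus_prod l. p \<in> torus l"
  unfolding AE_torus_iff by simp

lemma AE_in_side: "AE x in side l. x \<in> {-l..<l}"
  unfolding side_def by (subst AE_density) (auto simp: indicator_def)

text \<open>Functions on the torus are measurable only for the completed measure, whereas slices and
  Fubini call for Borel functions. Each coordinate of \<open>u\<close>, cut off outside the square,
  has a Borel version; the versions are reassembled over the finite basis.\<close>

lemma borel_rep_torus:
  fixes u :: "real \<times> real \<Rightarrow> 'b::euclidean_space"
  assumes "u \<in> borel_measurable (torus_measure l)"
  shows "\<exists>U \<in> borel_measurable (torus_prod l). AE p in torus_prod l. u p = U p"
proof -
  have "\<exists>g\<in>borel_measurable (torus_prod l). AE p in torus_prod l. u p \<bullet> b = g p" for b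
  proof -
    have "(\<lambda>p. indicator (torus l) p *\<^sub>R u p) \<in> borel_measurable lebesgue"
      using assms unfolding torus_measure_def
      by (subst (asm) borel_measurable_restrict_space_iff) (simp_all add: torus_borel)
    then have "(\<lambda>p. (indicator (torus l) p *\<^sub>R u p) \<bullet> b) \<in> borel_measurable lebesgue"
      by (rule borel_measurable_inner[OF _ borel_measurable_const])
    then obtain g where "g \<in> borel_measurable lborel" "AE p in lborel. (indicator (torus l) p *\<^sub>R u p) \<bullet> b = g p"
      using completion_ex_borel_measurable_real by blast
    then show ?thesis unfolding borel_measurable_torus_prod AE_torus_iff
      by (intro bexI[of _ g]) (auto elim!: eventually_mono)
  qed
  then obtain g where g: "\<And>b. g b \<in> borel_measurable (torus_prod l)"
      "\<And>b. AE p in torus_prod l. u p \<bullet> b = g b p"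
    by metis
  have "AE p in torus_prod l. \<forall>b\<in>Basis. u p \<bullet> b = g b p"
    by (subst AE_finite_all) (auto intro: g)
  then have rep: "AE p in torus_prod l. u p = (\<Sum>b\<in>Basis. g b p *\<^sub>R b)"
  proof eventually_elim
    case (elim p)
    then show ?case by (metis (no_types, lifting) euclidean_representation sum.cong)
  qed
  show ?thesis
  proof (rule bexI[of _ "\<lambda>p. \<Sum>b\<in>Basis. g b p *\<^sub>R b"])
    show "AE p in torus_prod l. u p = (\<Sum>b\<in>Basis. g b p *\<^sub>R b)" by (rule rep)
    show "(\<lambda>p. \<Sum>b\<in>Basis. g b p *\<^sub>R b) \<in> borel_measurable (torus_prod l)"
    by (intro borel_measurable_sum borel_measurable_scaleR borel_measurable_const g)
  qed
qed

text \<open>The preimage of an open set under \<open>u\<close> differs from that under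
  \<open>U\<close> only inside the null set where the two disagree, and every subset of a null set
  is measurable in the completion.\<close>

lemma borel_measurable_completionI:
  fixes u :: "'a \<Rightarrow> 'b::topological_space"
  assumes "U \<in> borel_measurable M" "AE p in M. u p = U p"
  shows "u \<in> borel_measurable (completion M)"
proof (rule borel_measurableI)
  fix S :: "'b set" assume "open S"
  then have [measurable]: "S \<in> sets borel" by simp
  have [measurable]: "U \<in> borel_measurable (completion M)"
    by (rule measurable_completion[OF assms(1)])
  have [measurable]: "Measurable.pred (completion M) (\<lambda>p. u p \<noteq> U p)"
      "Measurable.pred (completion M) (\<lambda>p. u p \<in> S \<and> u p \<noteq> U p)"
    using assms(2) by (auto intro!: sets_completion_AE elim: eventually_mono)
  have "Measurable.pred (completion M) (\<lambda>p. (U p \<in> S \<and> \<not> u p \<noteq> U p) \<or> (u p \<in> S \<and> u p \<noteq> U p))"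
    by measurable
  also have "(\<lambda>p. (U p \<in> S \<and> \<not> u p \<noteq> U p) \<or> (u p \<in> S \<and> u p \<noteq> U p)) = (\<lambda>p. u p \<in> S)" by force
  finally show "u -` S \<inter> space (completion M) \<in> sets (completion M)"
    by (simp add: pred_def vimage_def Int_def conj_commute)
qed

context
  fixes u U :: "real \<times> real \<Rightarrow> 'b::euclidean_space" and l :: real
  assumes U: "U \<in> borel_measurable (torus_prod l)" and AE: "AE p in torus_prod l. u p = U p"
begin

lemma restricted_torus_meas:
  "(\<lambda>p. indicator (torus l) p *\<^sub>R U p) \<in> borel_measurable lborel"
  "AE p in lborel. indicator (torus l) p *\<^sub>R u p = indicator (torus l) p *\<^sub>R U p"
  "(\<lambda>p. indicator (torus l) p *\<^sub>R u p) \<in> borel_measurable lebesgue"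
proof -
  show 1: "(\<lambda>p. indicator (torus l) p *\<^sub>R U p) \<in> borel_measurable lborel"
    using U torus_borel unfolding borel_measurable_torus_prod by auto
  show 2: "AE p in lborel. indicator (torus l) p *\<^sub>R u p = indicator (torus l) p *\<^sub>R U p"
    using AE unfolding AE_torus_iff by eventually_elim (auto split: split_indicator)
  show "(\<lambda>p. indicator (torus l) p *\<^sub>R u p) \<in> borel_measurable lebesgue"
    by (rule borel_measurable_completionI[OF 1 2])
qed

lemma measurable_torus_measureI: "u \<in> borel_measurable (torus_measure l)"
  using restricted_torus_meas(3) unfolding torus_measure_def
  by (subst borel_measurable_restrict_space_iff) (simp_all add: torus_borel)

lemma integrable_torus: "integrable (torus_measure l) u \<longleftrightarrow> integrable (torus_prod l) U"
proof -
  have "integrable (torus_measure l) u \<longleftrightarrow> integrable lebesgue (\<lambda>p. indicator (torus l) p *\<^sub>R u p)"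
    unfolding torus_measure_def by (rule integrable_restrict_space) (simp add: torus_borel)
  also have "\<dots> \<longleftrightarrow> integrable lebesgue (\<lambda>p. indicator (torus l) p *\<^sub>R U p)"
    using restricted_torus_meas
    by (intro integrable_cong_AE) (auto intro: AE_completion measurable_completion)
  also have "\<dots> \<longleftrightarrow> integrable lborel (\<lambda>p. indicator (torus l) p *\<^sub>R U p)"
    using restricted_torus_meas by (intro integrable_completion)
  also have "\<dots> \<longleftrightarrow> integrable (density lborel (\<lambda>p. ennreal (indicator (torus l) p))) U"
    using U torus_borel unfolding borel_measurable_torus_prod
    by (intro integrable_density[symmetric]) auto
  finally show ?thesis by (simp add: torus_prod_eq_density ennreal_indicator)
qed

lemma integral_torus: "(LINT p|torus_measure l. u p) = (LINT p|torus_prod l. U p)"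
proof -
  have "(LINT p|torus_measure l. u p) = (LINT p|lebesgue. indicator (torus l) p *\<^sub>R u p)"
    unfolding torus_measure_def by (rule integral_restrict_space) (simp add: torus_borel)
  also have "\<dots> = (LINT p|lebesgue. indicator (torus l) p *\<^sub>R U p)"
    using restricted_torus_meas
    by (intro integral_cong_AE) (auto intro: AE_completion measurable_completion)
  also have "\<dots> = (LINT p|lborel. indicator (torus l) p *\<^sub>R U p)"
    using restricted_torus_meas by (intro integral_completion)
  also have "\<dots> = (LINT p|density lborel (\<lambda>p. ennreal (indicator (torus l) p)). U p)"
    using U torus_borel unfolding borel_measurable_torus_prod
    by (intro integral_density[symmetric]) auto
  finally show ?thesis by (simp add: torus_prod_eq_density ennreal_indicator)
qed

end

lemma nn_integral_torus:
  assumes "U \<in> borel_measurable (torus_prod l)" "AE p in torus_prod l. u p = U p"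
  shows "(\<integral>\<^sup>+p. u p \<partial>torus_measure l) = (\<integral>\<^sup>+p. U p \<partial>torus_prod l)"
proof -
  have "(\<integral>\<^sup>+p. u p \<partial>torus_measure l) = (\<integral>\<^sup>+p. U p \<partial>torus_measure l)"
    using assms(2) by (intro nn_integral_cong_AE) (simp add: AE_torus)
  also have "\<dots> = (\<integral>\<^sup>+p. U p * indicator (torus l) p \<partial>lborel)"
    unfolding torus_measure_def
    by (subst nn_integral_restrict_space) (simp_all add: torus_borel nn_integral_completion)
  also have "\<dots> = (\<integral>\<^sup>+p. U p \<partial>torus_prod l)"
    using assms(1) torus_borel unfolding borel_measurable_torus_prod torus_prod_eq_density
    by (subst nn_integral_density) (auto simp: mult.commute)
  finally show ?thesis .
qed

section \<open>Completeness of the trigonometric system\<close>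

text \<open>The sine is written as a cosine with phase lowered by pi / 2, so that for fixed
  \<open>a\<close> and \<open>b\<close> the functions
  \<open>r * cos (a * fst p + b * snd p + c)\<close> are stable under partial derivatives. Induction
  on the order of smoothness then only has to generalise \<open>r\<close> and
  \<open>c\<close>.\<close>

lemma has_derivative_cos_linear:
  "((\<lambda>p::real \<times> real. r * cos (a * fst p + b * snd p + c)) has_derivative
    (\<lambda>h. (- r * (a * fst h + b * snd h)) * cos (a * fst p + b * snd p + (c - pi / 2)))) (at p)"
proof -
  have "cos (a * fst p + b * snd p + (c - pi / 2)) = sin (a * fst p + b * snd p + c)"
    unfolding add_diff_eq by (simp add: cos_diff)
  then show ?thesis by (auto intro!: derivative_eq_intros simp: algebra_simps)
qed

lemma C_k_cos:
  "C_k k (\<lambda>p::real \<times> real. r * cos (a * fst p + b * snd p + c))"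
proof (induction k arbitrary: r c)
  case 0
  show ?case by (auto intro!: continuous_intros)
next
  case (Suc k)
  let ?f = "\<lambda>p::real \<times> real. r * cos (a * fst p + b * snd p + c)"
  note d = has_derivative_cos_linear[of r a b c]
  have "(\<lambda>p. frechet_derivative ?f (at p) h) = (\<lambda>p. (- r * (a * fst h + b * snd h)) * cos (a * fst p + b * snd p + (c - pi / 2)))" for h
    by (rule ext) (simp only: frechet_derivative_at[OF d, symmetric])
  moreover have "?f differentiable_on UNIV"
    unfolding differentiable_on_def using d by (auto simp: differentiable_def)
  ultimately show ?case by (simp only: C_k.simps Suc) simp
qed

text \<open>The phase \<open>c\<close> lets a single real family contain sines, cosines and, up to
  factors, all their derivatives. Integer frequencies in units of pi / l give period 2 l in each
  variable.\<close>

definition trig :: "real \<Rightarrow> int \<Rightarrow> int \<Rightarrow> real \<Rightarrow> real \<times> real \<Rightarrow> real" where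
  "trig l a b c = (\<lambda>p. cos ((a * pi / l) * fst p + (b * pi / l) * snd p + c))"

lemma cos_add_int_2pi: "cos (x + of_int k * (2 * pi)) = cos x"
  by (subst mult.commute) (simp add: cos_add cos_int_2pin sin_int_2pin)

lemma trig_shift_x: "l > 0 \<Longrightarrow> trig l a b c (x + 2 * l, y) = trig l a b c (x, y)"
proof -
  assume "l > 0"
  then have "(a * pi / l) * (x + 2 * l) + (b * pi / l) * y + c = ((a * pi / l) * x + (b * pi / l) * y + c) + of_int a * (2 * pi)"
    by (simp add: field_simps)
  then show ?thesis unfolding trig_def fst_conv snd_conv by (simp only: cos_add_int_2pi)
qed

lemma trig_swap: "trig l a b c (y, x) = trig l b a c (x, y)"
  by (simp add: trig_def algebra_simps)

lemma test_fun_trig: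
  assumes "l > 0"
  shows "test_fun l (trig l a b c)"
  unfolding test_fun_def C_infinity_def periodic_def
proof (intro conjI allI)
  show "C_k k (trig l a b c)" for k
    using C_k_cos[of k 1 "a * pi / l" "b * pi / l" c] by (simp add: trig_def)
  show "trig l a b c (x + 2 * l, y) = trig l a b c (x, y)" for x y
    using assms by (rule trig_shift_x)
  show "trig l a b c (x, y + 2 * l) = trig l a b c (x, y)" for x y
    using trig_shift_x[OF assms, of b a c y x] by (simp only: trig_swap[of l b a])
qed

lemma frechet_trig:
  "frechet_derivative (trig l a b c) (at p) h = - (a * pi / l * fst h + b * pi / l * snd h) * trig l a b (c - pi / 2) p"
  using frechet_derivative_at[OF has_derivative_cos_linear[of 1 "a * pi / l" "b * pi / l" c p], symmetric]
  by (simp add: trig_def)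

lemma trig_bound: "\<bar>trig l a b c p\<bar> \<le> 1"
  by (simp add: trig_def)

lemma trig_measurable [measurable]: "trig l a b c \<in> borel_measurable (torus_prod l)"
  unfolding trig_def by measurable

lemma trig_mult: "trig l a b c p * trig l a' b' c' p
    = trig l (a - a') (b - b') (c - c') p / 2 + trig l (a + a') (b + b') (c + c') p / 2"
proof -
  have "(a * pi / l) * fst p + (b * pi / l) * snd p + c - ((a' * pi / l) * fst p + (b' * pi / l) * snd p + c')
      = ((a - a') * pi / l) * fst p + ((b - b') * pi / l) * snd p + (c - c')"
    "(a * pi / l) * fst p + (b * pi / l) * snd p + c + ((a' * pi / l) * fst p + (b' * pi / l) * snd p + c')
      = ((a + a') * pi / l) * fst p + ((b + b') * pi / l) * snd p + (c + c')"
    by (simp_all add: algebra_simps add_divide_distrib diff_divide_distrib)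
  then show ?thesis by (simp only: trig_def cos_times_cos add_divide_distrib of_int_add of_int_diff)
qed

inductive trig_poly :: "real \<Rightarrow> (real \<times> real \<Rightarrow> real) \<Rightarrow> bool" for l where
  gen: "trig_poly l (\<lambda>p. r * trig l a b c p)"
| add: "trig_poly l f \<Longrightarrow> trig_poly l g \<Longrightarrow> trig_poly l (\<lambda>p. f p + g p)"

lemma trig_poly_const: "trig_poly l (\<lambda>p. r)"
  using gen[of l r 0 0 0] by (simp add: trig_def)

text \<open>The product-to-sum formula for cosines keeps the frequencies integer and only changes
  the phases. Closure under products makes the trigonometric polynomials an algebra, as
  Stone-Weierstrass requires.\<close>

lemma trig_poly_mult:
  assumes "trig_poly l f" "trig_poly l g"
  shows "trig_poly l (\<lambda>p. f p * g p)"
  using assms(1)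
proof induction
  case (gen r a b c)
  show ?case using assms(2)
  proof induction
    case (gen r' a' b' c')
    have "trig_poly l (\<lambda>p. (r * r' / 2) * trig l (a - a') (b - b') (c - c') p + (r * r' / 2) * trig l (a + a') (b + b') (c + c') p)"
      by (intro trig_poly.intros)
    also have "(\<lambda>p. (r * r' / 2) * trig l (a - a') (b - b') (c - c') p + (r * r' / 2) * trig l (a + a') (b + b') (c + c') p)
       = (\<lambda>p. r * r' * (trig l a b c p * trig l a' b' c' p))"
      unfolding trig_mult by (rule ext) (simp add: algebra_simps)
    finally show ?case by (simp add: mult.assoc mult.left_commute)
  next
    case (add f g)
    then show ?case by (simp add: distrib_left trig_poly.add)
  qed
next
  case (add f g)
  then show ?case by (simp add: distrib_right trig_poly.add)
qed

section \<open>The torus as a product of two circles, and uniqueness for Fourier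
  coefficients\<close>

definition wrap2 :: "real \<Rightarrow> real \<times> real \<Rightarrow> complex \<times> complex" where
  "wrap2 l p = (cis (pi / l * fst p), cis (pi / l * snd p))"

lemma continuous_wrap2: "continuous_on UNIV (wrap2 l)"
  unfolding wrap2_def by (intro continuous_intros)

lemma wrap2_borel [measurable]: "wrap2 l \<in> borel_measurable (torus_prod l)"
  unfolding borel_measurable_torus_prod
  by (rule borel_measurable_continuous_onI[OF continuous_wrap2])

lemma unwrap_cis:
  assumes "-pi \<le> t" "t < pi"
  shows "(if Im (cis t) > 0 then arccos (Re (cis t)) else - arccos (Re (cis t))) = t"
proof (cases "t \<le> 0")
  case True
  then have "sin t \<le> 0" using assms by (metis minus_le_iff neg_0_le_iff_le sin_ge_zero sin_minus)
  moreover have "arccos (cos t) = - t" using True assms by (metis arccos_cos2)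
  ultimately show ?thesis by simp
next
  case False
  then have "sin t > 0" using assms by (intro sin_gt_zero) auto
  then show ?thesis using False assms by (simp add: arccos_cos)
qed

text \<open>The inequality \<open>Im z > 0\<close> is strict so that \<open>-1\<close> is sent to \<open>-l\<close>, the endpoint that belongs to the
  half-open square.\<close>

definition unwrap1 :: "real \<Rightarrow> complex \<Rightarrow> real" where
  "unwrap1 l z = l / pi * (if Im z > 0 then arccos (max (-1) (min 1 (Re z))) else - arccos (max (-1) (min 1 (Re z))))"

text \<open>Clamping \<open>Re z\<close> to [-1, 1] makes the arccosine continuous on the whole
  complex plane, so that only the test on \<open>Im z\<close> is left to be Borel.\<close>

lemma unwrap1_borel [measurable]: "unwrap1 l \<in> borel_measurable borel"
proof -
  have "continuous_on UNIV (\<lambda>z. arccos (max (-1) (min 1 (Re z))))"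
    by (intro continuous_intros) auto
  then have *: "(\<lambda>z. arccos (max (-1) (min 1 (Re z)))) \<in> borel_measurable borel"
    by (rule borel_measurable_continuous_onI)
  have "(\<lambda>z. Im z) \<in> borel_measurable borel"
    by (intro borel_measurable_continuous_onI continuous_intros)
  then have "{z \<in> space borel. 0 < Im z} \<in> sets borel"
    by (intro borel_measurable_less) auto
  then show ?thesis unfolding unwrap1_def
    by (intro borel_measurable_times borel_measurable_const measurable_If borel_measurable_uminus *)
qed

lemma unwrap1_cis: "l > 0 \<Longrightarrow> -l \<le> x \<Longrightarrow> x < l \<Longrightarrow> unwrap1 l (cis (pi / l * x)) = x"
proof -
  assume *: "l > 0" "-l \<le> x" "x < l"
  have "- pi \<le> pi / l * x" "pi / l * x < pi"
    using * mult_left_mono[of "-l" x "pi / l"] mult_strict_left_mono[of x l "pi / l"] by auto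
  from unwrap_cis[OF this] have "l / pi * (if Im (cis (pi / l * x)) > 0 then arccos (Re (cis (pi / l * x))) else - arccos (Re (cis (pi / l * x)))) = x"
    using * by simp
  moreover have "max (-1) (min 1 (Re (cis t))) = Re (cis t)" for t by simp
  ultimately show ?thesis unfolding unwrap1_def by (simp only:)
qed

lemma integrable_bounded_scaleR:
  fixes f :: "'a \<Rightarrow> 'b::{banach, second_countable_topology}"
  assumes "integrable M f" "h \<in> borel_measurable M" "\<And>p. p \<in> space M \<Longrightarrow> \<bar>h p\<bar> \<le> B"
  shows "integrable M (\<lambda>p. h p *\<^sub>R f p)"
proof (rule Bochner_Integration.integrable_bound)
  show "integrable M (\<lambda>p. B * norm (f p))" using assms(1) by auto
  show "AE p in M. norm (h p *\<^sub>R f p) \<le> norm (B * norm (f p))"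
  proof (rule AE_I2)
    fix p assume "p \<in> space M"
    then have "\<bar>h p\<bar> \<le> \<bar>B\<bar>" using assms(3)[of p] by linarith
    then show "norm (h p *\<^sub>R f p) \<le> norm (B * norm (f p))"
      by (simp add: abs_mult mult_right_mono)
  qed
qed (intro borel_measurable_scaleR assms borel_measurable_integrable[OF assms(1)])

lemmas integrable_bounded_mult = integrable_bounded_scaleR[where 'b = real, unfolded real_scaleR_def]

lemma integral_trig_poly_zero:
  assumes f: "integrable (torus_prod l) f"
    and zero: "\<And>a b c. (LINT p|torus_prod l. trig l a b c p * f p) = 0"
    and "trig_poly l h"
  shows "integrable (torus_prod l) (\<lambda>p. h p * f p) \<and> (LINT p|torus_prod l. h p * f p) = 0"
  using assms(3)
proof induction
  case (gen r a b c)
  have "integrable (torus_prod l) (\<lambda>p. trig l a b c p * f p)"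
    by (rule integrable_bounded_mult[OF f trig_measurable trig_bound])
  then have "integrable (torus_prod l) (\<lambda>p. r * (trig l a b c p * f p))" "(LINT p|torus_prod l. r * (trig l a b c p * f p)) = 0"
    using zero by auto
  then show ?case by (simp add: mult.assoc)
next
  case (add f g)
  then show ?case by (simp add: distrib_right)
qed

text \<open>\<open>wrap2\<close> maps the torus into the compact product \<open>K\<close> of two
  circles, where periodicity is built in and Stone-Weierstrass applies. A uniform approximation on
  \<open>K\<close> with error \<open>e\<close> changes the integral against \<open>f\<close> by at
  most \<open>e\<close> times the L1 norm of \<open>f\<close>.\<close>

lemma integral_continuous_wrap2_zero:
  assumes l: "l > 0" and f: "integrable (torus_prod l) f"
    and zero: "\<And>a b c. (LINT p|torus_prod l. trig l a b c p * f p) = 0"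
    and h: "continuous_on UNIV h"
  shows "(LINT p|torus_prod l. h (wrap2 l p) * f p) = 0"
proof -
  define K :: "(complex \<times> complex) set" where "K = sphere 0 1 \<times> sphere 0 1"
  have K: "compact K" unfolding K_def by (intro compact_Times compact_sphere)
  have inK: "wrap2 l p \<in> K" for p unfolding K_def wrap2_def by simp
  define P where "P = (\<lambda>g :: complex \<times> complex \<Rightarrow> real. continuous_on UNIV g \<and> trig_poly l (g \<circ> wrap2 l))"
  \<comment> \<open>The four real coordinates separate the points of \<open>K\<close>; the imaginary
    parts are sines, obtained from the phase -pi / 2.\<close>
  have gen: "P (\<lambda>z. Re (fst z))" "P (\<lambda>z. Im (fst z))" "P (\<lambda>z. Re (snd z))" "P (\<lambda>z. Im (snd z))"
    using trig_poly.gen[of l 1 1 0 0] trig_poly.gen[of l 1 1 0 "-pi/2"]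
      trig_poly.gen[of l 1 0 1 0] trig_poly.gen[of l 1 0 1 "-pi/2"]
    by (auto simp: P_def wrap2_def o_def trig_def cos_diff intro!: continuous_intros)
  have approx: "\<exists>g. P g \<and> (\<forall>z\<in>K. \<bar>h z - g z\<bar> < e)" if "e > 0" for e
  proof (rule Stone_Weierstrass_HOL[where P = P])
    show "compact K" "continuous_on K h" "0 < e"
      using K h that by (auto intro: continuous_on_subset)
    show "P (\<lambda>z. c)" for c by (simp add: P_def o_def trig_poly_const)
    show "P f \<Longrightarrow> continuous_on K f" for f by (auto simp: P_def intro: continuous_on_subset)
    show "P f \<and> P g \<Longrightarrow> P (\<lambda>z. f z + g z)" for f g
      by (auto simp: P_def o_def intro: trig_poly.add continuous_intros)
    show "P f \<and> P g \<Longrightarrow> P (\<lambda>z. f z * g z)" for f g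
      by (auto simp: P_def o_def intro: trig_poly_mult continuous_intros)
    show "\<exists>f. P f \<and> f x \<noteq> f y" if "x \<in> K \<and> y \<in> K \<and> x \<noteq> y" for x y
    proof -
      have "Re (fst x) \<noteq> Re (fst y) \<or> Im (fst x) \<noteq> Im (fst y) \<or> Re (snd x) \<noteq> Re (snd y) \<or> Im (snd x) \<noteq> Im (snd y)"
        using that by (metis complex_eqI prod.expand)
      then show ?thesis using gen by (elim disjE; blast)
    qed
  qed
  have [measurable]: "h \<in> borel_measurable borel" using h by (rule borel_measurable_continuous_onI)
  have "bounded (h ` K)"
    using K h by (intro compact_imp_bounded compact_continuous_image) (auto intro: continuous_on_subset)
  then obtain B where B: "\<And>z. z \<in> K \<Longrightarrow> \<bar>h z\<bar> \<le> B" unfolding bounded_iff by auto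
  have inth: "integrable (torus_prod l) (\<lambda>p. h (wrap2 l p) * f p)"
    using inK B by (intro integrable_bounded_mult[OF f, of _ B]) auto
  let ?I = "LINT p|torus_prod l. h (wrap2 l p) * f p"
  let ?N = "LINT p|torus_prod l. \<bar>f p\<bar>"
  have "\<bar>?I\<bar> \<le> e * ?N" if "e > 0" for e
  proof -
    obtain g where g: "P g" "\<And>z. z \<in> K \<Longrightarrow> \<bar>h z - g z\<bar> < e" using approx[OF \<open>e > 0\<close>] by auto
    have gz: "integrable (torus_prod l) (\<lambda>p. g (wrap2 l p) * f p)" "(LINT p|torus_prod l. g (wrap2 l p) * f p) = 0"
      using integral_trig_poly_zero[OF f zero, of "g \<circ> wrap2 l"] g by (auto simp: P_def)
    have "?I = (LINT p|torus_prod l. h (wrap2 l p) * f p - g (wrap2 l p) * f p)"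
      using inth gz by simp
    also have "\<bar>\<dots>\<bar> \<le> (LINT p|torus_prod l. e * \<bar>f p\<bar>)"
    proof (rule integral_abs_bound[THEN order_trans], rule integral_mono)
      show "integrable (torus_prod l) (\<lambda>p. \<bar>h (wrap2 l p) * f p - g (wrap2 l p) * f p\<bar>)"
        using inth gz by auto
      show "\<bar>h (wrap2 l p) * f p - g (wrap2 l p) * f p\<bar> \<le> e * \<bar>f p\<bar>" for p
        using g(2)[OF inK[of p]] unfolding left_diff_distrib[symmetric] abs_mult
        by (intro mult_right_mono) auto
    qed (use f in auto)
    finally show ?thesis by simp
  qed
  then have *: "\<bar>?I\<bar> \<le> d" if "d > 0" for d
  proof -
    have N: "?N \<ge> 0" by simp
    then have "d / (?N + 1) > 0" using N that by (intro divide_pos_pos add_nonneg_pos) simp_all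
    then have "\<bar>?I\<bar> \<le> d / (?N + 1) * ?N" by (rule \<open>\<And>e. e > 0 \<Longrightarrow> \<bar>?I\<bar> \<le> e * ?N\<close>)
    also have "\<dots> \<le> d / (?N + 1) * (?N + 1)" using N that by (intro mult_left_mono) auto
    finally show ?thesis using N by simp
  qed
  have "\<bar>?I\<bar> \<le> 0" by (rule field_le_epsilon) (simp add: *)
  then show ?thesis by simp
qed

text \<open>The continuous functions \<open>max 0 (1 - real k * infdist z C)\<close> take values in
  [0, 1] and converge pointwise to the indicator of \<open>C\<close>, since a point outside the
  closed set has positive distance from it. Dominated convergence carries the vanishing integrals
  over.\<close>

lemma integral_indicator_closed_zero:
  assumes l: "l > 0" and f: "integrable (torus_prod l) f"
    and zero: "\<And>a b c. (LINT p|torus_prod l. trig l a b c p * f p) = 0"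
    and C: "closed C"
  shows "(LINT p|torus_prod l. indicator C (wrap2 l p) * f p) = 0"
\<comment> \<open>The empty set is split off because \<open>infdist\<close> to it is 0 by
  convention, so that the cut-off functions would be constantly 1.\<close>
proof (cases "C = {}")
  case False
  define h where "h = (\<lambda>k::nat. \<lambda>z. max 0 (1 - real k * infdist z C))"
  have "(\<lambda>k. LINT p|torus_prod l. h k (wrap2 l p) * f p) \<longlonglongrightarrow> (LINT p|torus_prod l. indicator C (wrap2 l p) * f p)"
  proof (rule integral_dominated_convergence[where w = "\<lambda>p. \<bar>f p\<bar>"])
    show "(\<lambda>p. indicator C (wrap2 l p) * f p) \<in> borel_measurable (torus_prod l)"
      by (intro borel_measurable_times borel_measurable_integrable[OF f] measurable_compose[OF wrap2_borel])
        (use C in simp)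
    have [measurable]: "h k \<in> borel_measurable borel" for k
      unfolding h_def by (intro borel_measurable_continuous_onI continuous_intros)
    show "(\<lambda>p. h k (wrap2 l p) * f p) \<in> borel_measurable (torus_prod l)" for k
      by (intro borel_measurable_times borel_measurable_integrable[OF f] measurable_compose[OF wrap2_borel]) simp
    show "AE p in torus_prod l. norm (h k (wrap2 l p) * f p) \<le> \<bar>f p\<bar>" for k
    proof (rule AE_I2)
      fix p
      have "\<bar>h k (wrap2 l p)\<bar> \<le> 1" using infdist_nonneg[of "wrap2 l p" C] by (simp add: h_def)
      from mult_right_mono[OF this abs_ge_zero, of "f p"]
      show "norm (h k (wrap2 l p) * f p) \<le> \<bar>f p\<bar>" by (simp add: abs_mult)
    qed
    show "AE p in torus_prod l. (\<lambda>k. h k (wrap2 l p) * f p) \<longlonglongrightarrow> indicator C (wrap2 l p) * f p"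
    proof (intro AE_I2 tendsto_mult_right)
      fix p
      show "(\<lambda>k. h k (wrap2 l p)) \<longlonglongrightarrow> indicator C (wrap2 l p)"
      proof (cases "wrap2 l p \<in> C")
        case True
        then show ?thesis by (simp add: h_def)
      next
        case F: False
        then have d: "infdist (wrap2 l p) C > 0"
          using C False by (metis in_closed_iff_infdist_zero infdist_nonneg less_eq_real_def)
        then obtain N where N: "1 < real N * infdist (wrap2 l p) C"
          by (metis reals_Archimedean3)
        have "h k (wrap2 l p) = 0" if "k \<ge> N" for k
        proof -
          have "real N * infdist (wrap2 l p) C \<le> real k * infdist (wrap2 l p) C"
            using that d by (intro mult_right_mono) auto
          then show ?thesis using N unfolding h_def by linarith
        qed
        then show ?thesis using F
          by (intro tendsto_eventually) (auto simp: eventually_sequentially)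
      qed
    qed
  qed (use f in auto)
  moreover have "(LINT p|torus_prod l. h k (wrap2 l p) * f p) = 0" for k
    by (rule integral_continuous_wrap2_zero[OF l f zero]) (auto simp: h_def intro!: continuous_intros)
  ultimately show ?thesis by (simp add: LIMSEQ_const_iff)
qed simp

text \<open>A Dynkin argument: closed sets are stable under intersection and generate the Borel
  sets, while vanishing of the integral passes to complements and disjoint countable unions. For
  complements the whole space, itself closed, contributes 0.\<close>

lemma integral_indicator_borel_zero:
  assumes l: "l > 0" and f: "integrable (torus_prod l) f"
    and zero: "\<And>a b c. (LINT p|torus_prod l. trig l a b c p * f p) = 0"
    and B: "B \<in> sets borel"
  shows "(LINT p|torus_prod l. indicator B (wrap2 l p) * f p) = 0"
proof -
  have sb: "sets borel = sigma_sets UNIV (Collect closed :: (complex \<times> complex) set set)"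
    by (subst borel_eq_closed) (simp add: sets_measure_of)
  have int: "integrable (torus_prod l) (\<lambda>p. indicator A (wrap2 l p) * f p)" if "A \<in> sets borel" for A
    using that by (intro integrable_bounded_mult[OF f, of _ 1]) (auto split: split_indicator)
  have "Int_stable (Collect closed :: (complex \<times> complex) set set)"
    by (auto simp: Int_stable_def)
  moreover have "Collect closed \<subseteq> Pow (UNIV :: (complex \<times> complex) set)" by auto
  ultimately show ?thesis using B unfolding sb
  proof (induct rule: sigma_sets_induct_disjoint)
    case (basic A)
    then show ?case using integral_indicator_closed_zero[OF l f zero] by auto
  next
    case empty
    then show ?case by simp
  next
    case (compl A)
    have "(LINT p|torus_prod l. indicator (UNIV - A) (wrap2 l p) * f p)
        = (LINT p|torus_prod l. indicator UNIV (wrap2 l p) * f p - indicator A (wrap2 l p) * f p)"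
      by (intro Bochner_Integration.integral_cong) (auto split: split_indicator)
    also have "\<dots> = 0 - 0"
      using compl int[of UNIV] int[of A] integral_indicator_closed_zero[OF l f zero, of UNIV]
      by (subst Bochner_Integration.integral_diff) (auto simp: sb)
    finally show ?case by simp
  next
    case (union A)
    have "(\<lambda>n. \<Sum>i<n. (LINT p|torus_prod l. indicator (A i) (wrap2 l p) * f p)) \<longlonglongrightarrow>
        (LINT p|torus_prod l. indicator (\<Union>i. A i) (wrap2 l p) * f p)"
    proof -
      have A: "A i \<in> sets borel" for i using union by (auto simp: sb)
      have eq: "(\<Sum>i<n. indicator (A i) z) = (indicator (\<Union>i<n. A i) z :: real)" for n z
        using union(1) by (intro indicator_UN_disjoint[symmetric]) (auto simp: disjoint_family_on_def)
      have "(\<lambda>n. LINT p|torus_prod l. indicator (\<Union>i<n. A i) (wrap2 l p) * f p) \<longlonglongrightarrow>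
        (LINT p|torus_prod l. indicator (\<Union>i. A i) (wrap2 l p) * f p)"
      proof (rule integral_dominated_convergence[where w = "\<lambda>p. \<bar>f p\<bar>"])
        show "AE p in torus_prod l. (\<lambda>n. indicator (\<Union>i<n. A i) (wrap2 l p) * f p) \<longlonglongrightarrow> indicator (\<Union>i. A i) (wrap2 l p) * f p"
          by (intro AE_I2 tendsto_mult_right LIMSEQ_indicator_UN)
        show "AE p in torus_prod l. norm (indicator (\<Union>i<n. A i) (wrap2 l p) * f p) \<le> \<bar>f p\<bar>" for n
          by (intro AE_I2) (auto split: split_indicator)
      qed (use f A int in \<open>auto intro: borel_measurable_integrable\<close>)
      moreover have "(LINT p|torus_prod l. indicator (\<Union>i<n. A i) (wrap2 l p) * f p)
        = (\<Sum>i<n. (LINT p|torus_prod l. indicator (A i) (wrap2 l p) * f p))" for n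
        unfolding eq[symmetric] sum_distrib_right using int A by (subst Bochner_Integration.integral_sum) auto
      ultimately show ?thesis by simp
    qed
    then show ?case using union by (simp add: LIMSEQ_const_iff)
  qed
qed

text \<open>The Borel sets of the product of circles pull back to all Borel subsets of the square up
  to null sets, so \<open>f\<close> has integral 0 over every Borel set, in particular over the sets
  where it has a fixed sign. Applied to differences, this replaces the fundamental lemma of the
  calculus of variations.\<close>

theorem trig_complete:
  assumes l: "l > 0" and f: "integrable (torus_prod l) f"
    and zero: "\<And>a b c. (LINT p|torus_prod l. trig l a b c p * f p) = 0"
  shows "AE p in torus_prod l. f p = 0"
proof -
  have D: "(LINT p|torus_prod l. indicator D p * f p) = 0" if D: "D \<in> sets (torus_prod l)" for D
  proof -
    \<comment> \<open>\<open>G\<close> inverts \<open>wrap2\<close> on the square, so that up to a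
      null set \<open>D\<close> is the preimage under \<open>wrap2\<close> of the Borel set
      \<open>B\<close> defined below.\<close>
    define G where "G = (\<lambda>z. (unwrap1 l (fst z), unwrap1 l (snd z)))"
    have mG: "G \<in> borel_measurable borel"
      unfolding G_def by (intro borel_measurable_Pair measurable_compose[OF _ unwrap1_borel] borel_measurable_continuous_onI continuous_intros)
    have G: "G (wrap2 l p) = p" if "p \<in> torus l" for p
      using that unwrap1_cis[OF l] unfolding G_def wrap2_def torus_def by auto
    have Db: "D \<in> sets borel" using D by (simp only: sets_torus_prod)
    define B where "B = G -` D"
    have "B \<in> sets borel" using measurable_sets[OF mG Db] by (simp add: B_def)
    then have "0 = (LINT p|torus_prod l. indicator B (wrap2 l p) * f p)"
      using integral_indicator_borel_zero[OF l f zero] by simp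
    also have "\<dots> = (LINT p|torus_prod l. indicator D p * f p)"
    proof (rule integral_cong_AE)
      show "AE p in torus_prod l. indicator B (wrap2 l p) * f p = indicator D p * f p"
        using AE_in_torus by eventually_elim (auto simp: B_def G split: split_indicator)
    qed (use f D \<open>B \<in> sets borel\<close> in measurable)
    finally show ?thesis by simp
  qed
  have [measurable]: "f \<in> borel_measurable (torus_prod l)" using f by auto
  \<comment> \<open>The factor \<open>r\<close> will be 1 on the set where \<open>f\<close> is
    nonnegative and -1 where it is nonpositive.\<close>
  have AE: "AE p in torus_prod l. indicator D p * (r * f p) = 0"
    if D': "D \<in> sets (torus_prod l)" "\<And>p. p \<in> D \<Longrightarrow> r * f p \<ge> 0" for D r
  proof (subst integral_nonneg_eq_0_iff_AE[symmetric])
    show "integrable (torus_prod l) (\<lambda>p. indicator D p * (r * f p))"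
      using integrable_mult_indicator[OF D'(1) integrable_mult_right[OF f, of r]] by simp
    have "(LINT p|torus_prod l. indicator D p * (r * f p)) = r * (LINT p|torus_prod l. indicator D p * f p)"
      by (subst integral_mult_right_zero[symmetric]) (simp add: mult.left_commute)
    then show "(LINT p|torus_prod l. indicator D p * (r * f p)) = 0" using D[OF D'(1)] by simp
  qed (use D' in \<open>auto split: split_indicator\<close>)
  have "{p \<in> space (torus_prod l). f p \<ge> 0} \<in> sets (torus_prod l)" "{p \<in> space (torus_prod l). f p \<le> 0} \<in> sets (torus_prod l)"
    by measurable
  from AE[OF this(1), of 1] AE[OF this(2), of "-1"]
  have "AE p in torus_prod l. indicator {p. f p \<ge> 0} p * (1 * f p) = 0"
    "AE p in torus_prod l. indicator {p. f p \<le> 0} p * (-1 * f p) = 0"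
    by simp_all
  then show ?thesis
    by eventually_elim (auto split: split_indicator_asm)
qed

section \<open>Absolute continuity on lines\<close>

lemma integral_side_FTC:
  assumes "\<And>x. (F has_real_derivative F' x) (at x)" "continuous_on UNIV F'" "-l \<le> s" "s \<le> l"
  shows "(LINT x|side l. indicator {s..} x * F' x) = F l - F s"
proof -
  have [measurable]: "F' \<in> borel_measurable borel" using assms(2) by (rule borel_measurable_continuous_onI)
  have "(LINT x|side l. indicator {s..} x * F' x) = (LINT x|density lborel (\<lambda>x. ennreal (indicator {-l..<l} x)). indicator {s..} x * F' x)"
    by (simp add: side_def ennreal_indicator)
  also have "\<dots> = (LINT x|lborel. indicator {-l..<l} x *\<^sub>R (indicator {s..} x * F' x))"
    by (rule integral_density) auto
  also have "\<dots> = (LINT x|lborel. F' x * indicator {s..l} x)"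
    using AE_lborel_singleton[of l] assms(3)
    by (intro integral_cong_AE) (auto elim!: eventually_mono split: split_indicator)
  also have "\<dots> = F l - F s"
    using assms by (intro integral_FTC_Icc_real) (auto simp: continuous_on_eq_continuous_at)
  finally show ?thesis .
qed

lemma trig_primitive_x:
  assumes "l > 0" "a \<noteq> 0"
  shows "((\<lambda>x. l / (a * pi) * trig l a b (c - pi / 2) (x, y)) has_real_derivative trig l a b c (x, y)) (at x)"
proof -
  have "l / (a * pi) * trig l a b (c - pi / 2) (x, y) = l / (a * pi) * sin (a * pi / l * x + b * pi / l * y + c)" for x
    unfolding trig_def fst_conv snd_conv add_diff_eq by (simp add: cos_diff)
  then show ?thesis using assms unfolding trig_def fst_conv snd_conv
    by (auto intro!: derivative_eq_intros)
qed

lemma trig_half_period: "trig l a b (c + pi / 2) p = - trig l a b (c - pi / 2) p"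
  unfolding trig_def add.assoc[symmetric] add_diff_eq by (simp add: cos_diff cos_add)

text \<open>The tail over x >= s is the inner integral that remains when a double integral over s <=
  x is taken in the other order. The value at the end point \<open>l\<close> is kept, since it
  cancels only against the mean of a weak derivative.\<close>

lemma integral_trig_x_tail:
  assumes "l > 0" "a \<noteq> 0" "-l \<le> s" "s \<le> l"
  shows "(LINT x|side l. indicator {s..} x * trig l a b c (x, y))
    = l / (a * pi) * trig l a b (c - pi / 2) (l, y) - l / (a * pi) * trig l a b (c - pi / 2) (s, y)"
proof -
  have "continuous_on UNIV (\<lambda>x. trig l a b c (x, y))"
    unfolding trig_def fst_conv snd_conv by (intro continuous_intros)
  from integral_side_FTC[OF trig_primitive_x[OF assms(1,2)] this assms(3,4)] show ?thesis .
qed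

lemma integral_trig_x:
  assumes "l > 0" "a \<noteq> 0"
  shows "(LINT x|side l. trig l a b c (x, y)) = 0"
proof -
  have "(LINT x|side l. trig l a b c (x, y)) = (LINT x|side l. indicator {-l..} x * trig l a b c (x, y))"
  proof (rule integral_cong_AE)
    show "AE x in side l. trig l a b c (x, y) = indicator {-l..} x * trig l a b c (x, y)"
      using AE_in_side[of l] by eventually_elim auto
  qed (auto simp: trig_def)
  also have "\<dots> = 0"
    using integral_trig_x_tail[OF assms, of "-l" b c y] trig_shift_x[OF assms(1), of a b "c - pi / 2" "-l" y] assms(1)
    by simp
  finally show ?thesis .
qed

lemma AE_side_const: "l > 0 \<Longrightarrow> (AE x in side l. P) \<longleftrightarrow> P"
  using emeasure_side[of l] by (cases P) (auto simp: AE_iff_null)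

lemma AE_torus_sndI:
  assumes "AE y in side l. P y"
  shows "AE p in torus_prod l. P (snd p)"
proof -
  interpret finite_measure "side l" by (rule finite_measure_side)
  obtain N where N: "N \<in> null_sets (side l)" "{y \<in> space (side l). \<not> P y} \<subseteq> N"
    using assms by (auto simp: eventually_ae_filter)
  have "emeasure (torus_prod l) (UNIV \<times> N) = 0"
    using N by (subst emeasure_pair_measure_Times) auto
  moreover have "UNIV \<times> N \<in> sets (torus_prod l)"
    using N by (intro pair_measureI) auto
  ultimately have "UNIV \<times> N \<in> null_sets (torus_prod l)" by auto
  then show ?thesis by (rule AE_I') (use N(2) in auto)
qed

lemma AE_torus_swap:
  assumes "AE p in torus_prod l. P p"
  shows "AE p in torus_prod l. P (snd p, fst p)"
proof -
  interpret pair_sigma_finite "side l" "side l" by (rule pair_sigma_finite_side)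
  have "AE p in distr (torus_prod l) (torus_prod l) (\<lambda>(x, y). (y, x)). P p"
    by (rule ssubst[OF distr_pair_swap[symmetric]]) (rule assms)
  then have "AE p in torus_prod l. P (case p of (x, y) \<Rightarrow> (y, x))"
    by (rule AE_distrD[rotated]) (rule measurable_pair_swap')
  then show ?thesis by (simp add: case_prod_unfold)
qed

lemma AE_torus_slices:
  assumes "AE p in torus_prod l. P p"
  shows "AE y in side l. AE x in side l. P (x, y)"
proof -
  interpret pair_sigma_finite "side l" "side l" by (rule pair_sigma_finite_side)
  show ?thesis using AE_pair[OF AE_torus_swap[OF assms]] by simp
qed

lemma integrable_torus_snd:
  fixes V :: "real \<Rightarrow> real"
  assumes "integrable (side l) V"
  shows "integrable (torus_prod l) (\<lambda>p. V (snd p))"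
proof -
  interpret pair_sigma_finite "side l" "side l" by (rule pair_sigma_finite_side)
  interpret finite_measure "side l" by (rule finite_measure_side)
  have [measurable]: "V \<in> borel_measurable borel" using borel_measurable_integrable[OF assms] by simp
  show ?thesis
    by (rule Fubini_integrable) (use assms in auto)
qed

lemma trig_borel_pair [measurable]: "trig l a b c \<in> borel_measurable (borel \<Otimes>\<^sub>M borel)"
  using trig_measurable[of l a b c] by simp

section \<open>Weak x-derivatives and primitives along horizontal lines\<close>

context
  fixes l :: real and u v :: "real \<times> real \<Rightarrow> real"
  assumes l: "l > 0"
    and u: "integrable (torus_prod l) u" and v: "integrable (torus_prod l) v"
    and weak: "\<And>a b c. (a * pi / l) * (LINT p|torus_prod l. trig l a b c p * u p) = (LINT p|torus_prod l. trig l a b (c + pi / 2) p * v p)"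
begin

interpretation pair_sigma_finite "side l" "side l" by (rule pair_sigma_finite_side)
interpretation side: finite_measure "side l" by (rule finite_measure_side)

lemma measure_side: "measure (side l) UNIV = 2 * l"
  using emeasure_side[OF l] l by (simp add: measure_def)

lemma u_meas: "u \<in> borel_measurable (borel \<Otimes>\<^sub>M borel)"
  using borel_measurable_integrable[OF u] by simp

lemma v_meas: "v \<in> borel_measurable (borel \<Otimes>\<^sub>M borel)"
  using borel_measurable_integrable[OF v] by simp

lemma integral_trig_snd:
  assumes V: "integrable (side l) V" and "a \<noteq> 0"
  shows "(LINT p|torus_prod l. trig l a b c p * V (snd p)) = 0"
proof -
  have "integrable (torus_prod l) (\<lambda>p. trig l a b c p * V (snd p))"
    by (rule integrable_bounded_mult[OF integrable_torus_snd[OF V] trig_measurable trig_bound])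
  then have "(LINT p|torus_prod l. trig l a b c p * V (snd p)) = (LINT y|side l. LINT x|side l. trig l a b c (x, y) * V y)"
    by (subst integral_snd[where f = "\<lambda>x y. trig l a b c (x, y) * V y"]) (simp_all add: case_prod_unfold)
  also have "\<dots> = 0" using integral_trig_x[OF l \<open>a \<noteq> 0\<close>] by simp
  finally show ?thesis .
qed

text \<open>This is periodicity in weak form. The line mean \<open>V\<close> is a function of y
  alone: its coefficients with \<open>a \<noteq> 0\<close> vanish because the cosine integrates to 0
  in x, those with \<open>a = 0\<close> because the test function is then independent of x.\<close>

lemma weak_deriv_x_mean_zero: "AE y in side l. (LINT s|side l. v (s, y)) = 0"
proof -
  note [measurable] = u_meas v_meas
  define V where "V y = (LINT s|side l. v (s, y))" for y
  have V: "integrable (side l) V"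
    unfolding V_def using integrable_snd[of "\<lambda>x y. v (x, y)"] v by simp
  have "AE p in torus_prod l. V (snd p) = 0"
  proof (rule trig_complete[OF l integrable_torus_snd[OF V]])
    fix a b :: int and c :: real
    show "(LINT p|torus_prod l. trig l a b c p * V (snd p)) = 0"
    proof (cases "a = 0")
      case False
      then show ?thesis using integral_trig_snd[OF V] by simp
    next
      case True
      define T where "T y = trig l 0 b c (0, y)" for y
      have T: "trig l a b c p = T (snd p)" for p using True by (simp add: T_def trig_def)
      have "integrable (torus_prod l) (\<lambda>p. trig l a b c p * V (snd p))" "integrable (torus_prod l) (\<lambda>p. trig l a b c p * v p)"
        by (intro integrable_bounded_mult[OF integrable_torus_snd[OF V] trig_measurable trig_bound]
            integrable_bounded_mult[OF v trig_measurable trig_bound])+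
      note i = this[unfolded T]
      have "(LINT p|torus_prod l. trig l a b c p * V (snd p)) = (LINT y|side l. LINT x|side l. T y * V y)"
        unfolding T using i(1) by (subst integral_snd[where f = "\<lambda>x y. T y * V y"]) (simp_all add: case_prod_unfold)
      also have "\<dots> = 2 * l * (LINT y|side l. T y * V y)"
      proof -
        have "(LINT x|side l. T y * V y) = 2 * l * (T y * V y)" for y using l by (simp add: measure_side)
        then show ?thesis by (simp only: integral_mult_right_zero)
      qed
      also have "(LINT y|side l. T y * V y) = (LINT y|side l. LINT x|side l. T y * v (x, y))"
        by (simp add: V_def)
      also have "\<dots> = (LINT p|torus_prod l. trig l a b c p * v p)"
        unfolding T using i(2) by (subst integral_snd[where f = "\<lambda>x y. T y * v (x, y)"]) (simp_all add: case_prod_unfold)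
      \<comment> \<open>With \<open>a = 0\<close> the left side of \<open>weak\<close> carries the
        factor 0; the phase is chosen so that adding pi / 2 returns \<open>c\<close>.\<close>
      also have "\<dots> = 0" using weak[of 0 b "c - pi / 2"] True by simp
      finally show ?thesis by simp
    qed
  qed
  from AE_torus_slices[OF this] show ?thesis
    by (simp add: AE_side_const[OF l] V_def)
qed

text \<open>The primitive \<open>w\<close> of \<open>v\<close> along lines and \<open>u\<close> have
  the same coefficients for \<open>a \<noteq> 0\<close>, by integration by parts on each line;
  subtracting the line mean \<open>C\<close> of \<open>u - w\<close> removes the coefficients with
  \<open>a = 0\<close>. Completeness of the cosines then identifies \<open>u\<close> with
  \<open>w + C\<close>, so that almost every slice of \<open>u\<close> is absolutely continuous
  after a change on a null set.\<close>

lemma weak_deriv_x_primitive: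
  "\<exists>c \<in> borel_measurable borel. integrable (side l) c \<and>
    (AE p in torus_prod l. u p = c (snd p) + (LINT s|side l. indicator {..fst p} s * v (s, snd p)))"
proof -
  note [measurable] = u_meas v_meas
  define w where "w p = (LINT s|side l. indicator {..fst p} s * v (s, snd p))" for p
  have wm [measurable]: "w \<in> borel_measurable (borel \<Otimes>\<^sub>M borel)"
  proof -
    have "(\<lambda>p. (LINT s|side l. indicator {..fst p} s * v (s, snd p))) \<in> borel_measurable (borel \<Otimes>\<^sub>M borel)"
      unfolding indicator_def atMost_def mem_Collect_eq by measurable
    then show ?thesis by (simp add: w_def[abs_def])
  qed
  define N where "N y = (LINT s|side l. \<bar>v (s, y)\<bar>)" for y
  have N: "integrable (side l) N"
    unfolding N_def using integrable_snd[of "\<lambda>x y. \<bar>v (x, y)\<bar>"] v by (simp add: case_prod_unfold)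
  have vs: "AE y in side l. integrable (side l) (\<lambda>s. v (s, y))"
    using AE_integrable_snd[of "\<lambda>x y. v (x, y)"] v by simp
  have us: "AE y in side l. integrable (side l) (\<lambda>s. u (s, y))"
    using AE_integrable_snd[of "\<lambda>x y. u (x, y)"] u by simp
  have wN: "\<bar>w p\<bar> \<le> N (snd p)" if "integrable (side l) (\<lambda>s. v (s, snd p))" for p
  proof -
    have "\<bar>w p\<bar> \<le> (LINT s|side l. \<bar>indicator {..fst p} s * v (s, snd p)\<bar>)"
      unfolding w_def by (rule integral_abs_bound)
    also have "\<dots> \<le> N (snd p)"
      unfolding N_def using that
      by (intro integral_mono integrable_abs integrable_bounded_mult[OF that, of _ 1]) (auto split: split_indicator)
    finally show ?thesis .
  qed
  have vs2: "AE p in torus_prod l. integrable (side l) (\<lambda>s. v (s, snd p))"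
    using vs by (rule AE_torus_sndI)
  have w: "integrable (torus_prod l) w"
    by (rule Bochner_Integration.integrable_bound[OF integrable_torus_snd[OF N]])
      (use vs2 wN in \<open>auto elim!: eventually_mono intro: order_trans[OF _ abs_ge_self]\<close>)
  have ws: "AE y in side l. integrable (side l) (\<lambda>s. w (s, y))"
    using AE_integrable_snd[of "\<lambda>x y. w (x, y)"] w by simp
  \<comment> \<open>The constant of integration on a line is the mean of \<open>u - w\<close> there,
    over the length 2 l. As a function of y alone it has no coefficients with
    \<open>a \<noteq> 0\<close>.\<close>
  define C where "C y = (LINT x|side l. u (x, y) - w (x, y)) / (2 * l)" for y
  have C: "integrable (side l) C"
    unfolding C_def using integrable_snd[of "\<lambda>x y. u (x, y) - w (x, y)"] u w by (simp add: case_prod_unfold)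
  have Cm [measurable]: "C \<in> borel_measurable borel" using borel_measurable_integrable[OF C] by simp
  have f: "integrable (torus_prod l) (\<lambda>p. u p - w p - C (snd p))"
    using u w integrable_torus_snd[OF C] by auto
  have "AE p in torus_prod l. u p - w p - C (snd p) = 0"
  proof (rule trig_complete[OF l f])
    fix a b :: int and c :: real
    have int: "integrable (torus_prod l) (\<lambda>p. trig l a b c p * u p)" "integrable (torus_prod l) (\<lambda>p. trig l a b c p * w p)"
        "integrable (torus_prod l) (\<lambda>p. trig l a b c p * C (snd p))"
        "integrable (torus_prod l) (\<lambda>p. trig l a b c p * (u p - w p - C (snd p)))"
      by (intro integrable_bounded_mult[OF _ trig_measurable trig_bound] u w f integrable_torus_snd[OF C])+
    show "(LINT p|torus_prod l. trig l a b c p * (u p - w p - C (snd p))) = 0"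
    proof (cases "a = 0")
      case True
      define T where "T y = trig l 0 b c (0, y)" for y
      have T: "trig l a b c p = T (snd p)" for p using True by (simp add: T_def trig_def)
      have "(LINT p|torus_prod l. trig l a b c p * (u p - w p - C (snd p)))
          = (LINT y|side l. LINT x|side l. T y * (u (x, y) - w (x, y) - C y))"
        using int(4) unfolding T
        by (subst integral_snd[where f = "\<lambda>x y. T y * (u (x, y) - w (x, y) - C y)"]) (simp_all add: case_prod_unfold)
      also have "\<dots> = (LINT y|side l. 0)"
      proof (rule integral_cong_AE)
        show "AE y in side l. (LINT x|side l. T y * (u (x, y) - w (x, y) - C y)) = 0"
          using us ws
        proof eventually_elim
          case (elim y)
          have "(LINT x|side l. u (x, y) - w (x, y) - C y) = (LINT x|side l. u (x, y) - w (x, y)) - 2 * l * C y"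
            using elim by (subst Bochner_Integration.integral_diff) (auto simp: measure_side)
          also have "\<dots> = 0" using l by (simp add: C_def)
          finally show ?case by simp
        qed
        have [measurable]: "T \<in> borel_measurable borel" unfolding T_def trig_def by simp
        show "(\<lambda>y. LINT x|side l. T y * (u (x, y) - w (x, y) - C y)) \<in> borel_measurable (side l)"
          by measurable
      qed simp
      finally show ?thesis by simp
    next
      case a: False
      have "(LINT p|torus_prod l. trig l a b c p * (u p - w p - C (snd p)))
         = (LINT p|torus_prod l. trig l a b c p * u p) - (LINT p|torus_prod l. trig l a b c p * w p)
          - (LINT p|torus_prod l. trig l a b c p * C (snd p))"
        using int by (simp add: right_diff_distrib)
      also have "(LINT p|torus_prod l. trig l a b c p * C (snd p)) = 0"
        by (rule integral_trig_snd[OF C a])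
      also have "(LINT p|torus_prod l. trig l a b c p * u p) = l / (a * pi) * (LINT p|torus_prod l. trig l a b (c + pi / 2) p * v p)"
        using weak[of a b c] l a by (simp add: field_simps)
      also have "(LINT p|torus_prod l. trig l a b c p * w p) = (LINT y|side l. LINT x|side l. trig l a b c (x, y) * w (x, y))"
        using int(2)
        by (subst integral_snd[where f = "\<lambda>x y. trig l a b c (x, y) * w (x, y)"]) (simp_all add: case_prod_unfold)
      also have "\<dots> = (LINT y|side l. LINT s|side l. l / (a * pi) * (trig l a b (c + pi / 2) (s, y) * v (s, y)))"
      proof (rule integral_cong_AE)
        show "AE y in side l. (LINT x|side l. trig l a b c (x, y) * w (x, y))
            = (LINT s|side l. l / (a * pi) * (trig l a b (c + pi / 2) (s, y) * v (s, y)))"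
          using vs weak_deriv_x_mean_zero
        proof eventually_elim
          case (elim y)
          let ?P = "\<lambda>s. l / (a * pi) * trig l a b (c - pi / 2) (s, y)"
          \<comment> \<open>Fubini is used at fixed \<open>y\<close>: the two coordinates of
            \<open>p\<close> are the variables x and s, and the indicator encodes s <= x.\<close>
          have i1: "integrable (torus_prod l) (\<lambda>p. indicator {snd p..} (fst p) * trig l a b c (fst p, y) * v (snd p, y))"
          proof (rule integrable_bounded_mult[OF integrable_torus_snd[OF elim(1)], of _ 1])
            show "(\<lambda>p. indicator {snd p..} (fst p) * trig l a b c (fst p, y)) \<in> borel_measurable (torus_prod l)"
              unfolding indicator_def atLeast_def mem_Collect_eq by measurable
          qed (auto simp: trig_bound split: split_indicator)
          have "(LINT x|side l. trig l a b c (x, y) * w (x, y))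
            = (LINT x|side l. LINT s|side l. indicator {s..} x * trig l a b c (x, y) * v (s, y))"
            unfolding w_def by (subst integral_mult_right_zero[symmetric])
              (intro Bochner_Integration.integral_cong refl; auto split: split_indicator)
          also have "\<dots> = (LINT s|side l. LINT x|side l. indicator {s..} x * trig l a b c (x, y) * v (s, y))"
            using i1 by (subst Fubini_integral[symmetric]) (simp_all add: case_prod_unfold)
          also have "\<dots> = (LINT s|side l. (?P l - ?P s) * v (s, y))"
          proof (rule integral_cong_AE)
            show "AE s in side l. (LINT x|side l. indicator {s..} x * trig l a b c (x, y) * v (s, y)) = (?P l - ?P s) * v (s, y)"
              using AE_in_side
            proof eventually_elim
              case (elim s)
              then show ?case using integral_trig_x_tail[OF l a, of s b c y] by simp
            qed
            show "(\<lambda>s. LINT x|side l. indicator {s..} x * trig l a b c (x, y) * v (s, y)) \<in> borel_measurable (side l)"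
              unfolding indicator_def atLeast_def mem_Collect_eq by measurable
          qed measurable
          also have "\<dots> = ?P l * (LINT s|side l. v (s, y)) - (LINT s|side l. ?P s * v (s, y))"
          proof -
            have "\<bar>trig l a b (c - pi / 2) (s, y)\<bar> \<le> 1" for s by (rule trig_bound)
            then have "integrable (side l) (\<lambda>s. trig l a b (c - pi / 2) (s, y) * v (s, y))"
              by (intro integrable_bounded_mult[OF elim(1), of _ 1]) auto
            then have "integrable (side l) (\<lambda>s. l / (a * pi) * (trig l a b (c - pi / 2) (s, y) * v (s, y)))"
              by (rule integrable_mult_right)
            then have "integrable (side l) (\<lambda>s. ?P s * v (s, y))"
              by (simp only: mult.assoc)
            moreover have "integrable (side l) (\<lambda>s. ?P l * v (s, y))" using elim(1) by (rule integrable_mult_right)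
            ultimately show ?thesis by (simp only: left_diff_distrib Bochner_Integration.integral_diff integral_mult_right_zero)
          qed
          \<comment> \<open>The boundary term \<open>?P l\<close> multiplies the mean of
            \<open>v\<close> on the line, which is 0. The remaining minus sign is absorbed by moving
            the phase by pi.\<close>
          also have "\<dots> = (LINT s|side l. l / (a * pi) * (trig l a b (c + pi / 2) (s, y) * v (s, y)))"
            using elim(2) unfolding trig_half_period by (simp add: mult.assoc)
          finally show ?case .
        qed
      qed measurable
      also have "\<dots> = l / (a * pi) * (LINT p|torus_prod l. trig l a b (c + pi / 2) p * v p)"
      proof -
        have "integrable (torus_prod l) (\<lambda>p. trig l a b (c + pi / 2) p * v p)"
          by (rule integrable_bounded_mult[OF v trig_measurable trig_bound])
        then show ?thesis
          by (simp, subst integral_snd[where f = "\<lambda>x y. trig l a b (c + pi / 2) (x, y) * v (x, y)"])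
            (simp_all add: case_prod_unfold)
      qed
      finally show ?thesis by simp
    qed
  qed
  then show ?thesis
    using C Cm by (intro bexI[of _ C]) (auto elim!: eventually_mono simp: w_def)
qed

end

section \<open>Weighted length of curves on the sphere\<close>

text \<open>Density of continuous functions in L1, by induction over integrable functions. For an
  indicator, inner and outer regularity enclose the set between a closed and an open one, and a
  Urysohn function interpolates between them.\<close>

lemma integrable_approx_continuous:
  fixes f :: "real \<Rightarrow> 'b::euclidean_space"
  assumes "integrable lborel f" "e > 0"
  shows "\<exists>g. continuous_on UNIV g \<and> integrable lborel g \<and> (LINT x|lborel. norm (f x - g x)) < e"
  using assms
proof (induction arbitrary: e rule: integrable_induct)
  case (base A c)
  \<comment> \<open>The two regularity errors add up to \<open>2 * d\<close>, and
    \<open>2 * d * norm c < e\<close>; the added 1 covers the case \<open>c = 0\<close>.\<close>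
  define d where "d = e / (2 * (norm c + 1))"
  have d: "d > 0" unfolding d_def using base by (intro divide_pos_pos mult_pos_pos add_nonneg_pos) auto
  have A: "A \<in> sets lebesgue" using base by auto
  obtain U where U: "open U" "A \<subseteq> U" "U - A \<in> lmeasurable" "emeasure lebesgue (U - A) < ennreal d"
    using sets_lebesgue_outer_open[OF A d] by blast
  obtain C where C: "closed C" "C \<subseteq> A" "A - C \<in> lmeasurable" "emeasure lebesgue (A - C) < ennreal d"
    using sets_lebesgue_inner_closed[OF A d] by blast
  have UC: "emeasure lborel (U - C) < ennreal (2 * d)"
  proof -
    have "emeasure lborel (U - C) = emeasure lborel ((U - A) \<union> (A - C))"
      using U(2) C(2) by (intro arg_cong2[where f = emeasure]) auto
    also have "\<dots> \<le> emeasure lborel (U - A) + emeasure lborel (A - C)"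
      using base U C by (intro emeasure_subadditive) auto
    also have "\<dots> < ennreal d + ennreal d"
      using U C base by (intro add_strict_mono) auto
    finally show ?thesis using d by (simp flip: ennreal_plus)
  qed
  have UCm: "U - C \<in> sets lborel" "U \<in> sets lborel" using U C by auto
  have Ufin: "emeasure lborel U < \<infinity>"
  proof -
    have "emeasure lborel U = emeasure lborel ((U - A) \<union> A)" using U by (intro arg_cong2[where f = emeasure]) auto
    also have "\<dots> \<le> emeasure lborel (U - A) + emeasure lborel A"
      using base U by (intro emeasure_subadditive) auto
    also have "\<dots> < \<infinity>"
    proof -
      have "emeasure lborel (U - A) = emeasure lebesgue (U - A)" using U base by simp
      also have "\<dots> < \<infinity>" using U(4) by (rule less_le_trans) simp
      finally show ?thesis using base by (auto simp: less_top[symmetric] ennreal_add_eq_top)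
    qed
    finally show ?thesis .
  qed
  \<comment> \<open>\<open>h\<close> can differ from the indicator of \<open>A\<close> only on
    \<open>U - C\<close>, by at most 1.\<close>
  obtain h :: "real \<Rightarrow> real" where h: "continuous_on UNIV h" "\<And>x. h x \<in> closed_segment 1 0"
      "\<And>x. x \<in> C \<Longrightarrow> h x = 1" "\<And>x. x \<in> - U \<Longrightarrow> h x = 0"
    using Urysohn[of C "- U" "1::real" 0] U C by (auto simp: closed_def)
  have h01: "0 \<le> h x" "h x \<le> 1" for x using h(2)[of x] by (auto simp: closed_segment_eq_real_ivl)
  have [measurable]: "h \<in> borel_measurable borel" using h(1) by (rule borel_measurable_continuous_onI)
  have iU: "integrable lborel (\<lambda>x. indicator U x *\<^sub>R c)"
    using Ufin UCm by (auto simp: integrable_indicator_iff less_top)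
  have iUC: "integrable lborel (\<lambda>x. indicator (U - C) x * norm c)"
    using UC UCm by (intro integrable_mult_left integrable_real_indicator) (auto simp: less_top[symmetric] top_unique)
  have ih: "integrable lborel (\<lambda>x. h x *\<^sub>R c)"
    by (rule Bochner_Integration.integrable_bound[OF iU])
      (use h01 h(4) in \<open>auto simp: indicator_def intro!: mult_left_le_one_le\<close>)
  have iA: "integrable lborel (\<lambda>x. indicator A x *\<^sub>R c)"
    using base by auto
  have "(LINT x|lborel. norm (indicator A x *\<^sub>R c - h x *\<^sub>R c)) \<le> (LINT x|lborel. indicator (U - C) x * norm c)"
  proof (rule integral_mono)
    show "integrable lborel (\<lambda>x. norm (indicator A x *\<^sub>R c - h x *\<^sub>R c))" using iA ih by auto
    show "norm (indicator A x *\<^sub>R c - h x *\<^sub>R c) \<le> indicator (U - C) x * norm c" for x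
    proof -
      have "\<bar>indicator A x - h x\<bar> \<le> indicator (U - C) x"
        using h01[of x] h(3,4)[of x] U(2) C(2) by (auto split: split_indicator)
      then show ?thesis unfolding scaleR_left_diff_distrib[symmetric] norm_scaleR by (rule mult_right_mono) simp
    qed
  qed (rule iUC)
  also have "\<dots> = measure lborel (U - C) * norm c" using UCm by simp
  also have "\<dots> \<le> 2 * d * norm c"
    using UC d by (intro mult_right_mono) (auto simp: measure_def enn2real_leI less_imp_le)
  also have "\<dots> < 2 * d * (norm c + 1)" using d by simp
  also have "\<dots> = e"
  proof -
    have "2 * (e / (2 * m)) * m = e" if "m > 0" for m using that by simp
    from this[of "norm c + 1"] show ?thesis unfolding d_def by (simp add: add_nonneg_pos)
  qed
  finally show ?case
    using ih h(1) by (intro exI[of _ "\<lambda>x. h x *\<^sub>R c"]) (auto intro!: continuous_intros)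
next
  case (add f1 f2)
  from add.IH(1)[of "e / 2"] add.IH(2)[of "e / 2"] add.prems
  obtain g1 g2 where g: "continuous_on UNIV g1" "integrable lborel g1" "(LINT x|lborel. norm (f1 x - g1 x)) < e / 2"
    "continuous_on UNIV g2" "integrable lborel g2" "(LINT x|lborel. norm (f2 x - g2 x)) < e / 2" by auto
  have "(LINT x|lborel. norm (f1 x + f2 x - (g1 x + g2 x))) \<le> (LINT x|lborel. norm (f1 x - g1 x) + norm (f2 x - g2 x))"
    using add.hyps g by (intro integral_mono) (auto simp: add_diff_add norm_triangle_ineq)
  also have "\<dots> < e" using add.hyps g by (subst Bochner_Integration.integral_add) auto
  finally show ?case using g by (intro exI[of _ "\<lambda>x. g1 x + g2 x"]) (auto intro!: continuous_intros)
next
  case (lim f s)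
  have "(\<lambda>i. LINT x|lborel. norm (f x - s i x)) \<longlonglongrightarrow> (LINT x|(lborel :: real measure). 0)"
  proof (rule integral_dominated_convergence[where w = "\<lambda>x. 3 * norm (f x)"])
    show "AE x in lborel. (\<lambda>i. norm (f x - s i x)) \<longlonglongrightarrow> 0"
    proof (rule AE_I2)
      fix x :: real
      have "(\<lambda>i. s i x) \<longlonglongrightarrow> f x" by (rule lim.hyps) simp
      from tendsto_norm[OF tendsto_diff[OF tendsto_const[of "f x"] this]]
      show "(\<lambda>i. norm (f x - s i x)) \<longlonglongrightarrow> 0" by simp
    qed
    show "AE x in lborel. norm (norm (f x - s i x)) \<le> 3 * norm (f x)" for i
    proof (rule AE_I2)
      fix x :: real
      have "norm (s i x) \<le> 2 * norm (f x)" by (rule lim.hyps) simp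
      then show "norm (norm (f x - s i x)) \<le> 3 * norm (f x)"
        using norm_triangle_ineq4[of "f x" "s i x"] by simp
    qed
  qed (use lim in auto)
  then have "eventually (\<lambda>i. (LINT x|lborel. norm (f x - s i x)) < e / 2) sequentially"
    using lim.prems by (intro order_tendstoD(2)) auto
  then obtain i where i: "(LINT x|lborel. norm (f x - s i x)) < e / 2"
    by (auto dest: eventually_happens)
  obtain g where g: "continuous_on UNIV g" "integrable lborel g" "(LINT x|lborel. norm (s i x - g x)) < e / 2"
    using lim.IH[of "e / 2" i] lim.prems by auto
  have "(LINT x|lborel. norm (f x - g x)) \<le> (LINT x|lborel. norm (f x - s i x) + norm (s i x - g x))"
    using lim.hyps g by (intro integral_mono) (auto intro: norm_diff_triangle_ineq order_trans[OF _ norm_triangle_ineq])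
  also have "\<dots> < e" using lim.hyps g i by (subst Bochner_Integration.integral_add) auto
  finally show ?case using g by auto
qed

definition wt :: "real \<Rightarrow> real^3 \<Rightarrow> real" where
  "wt \<sigma> p = sqrt (W_pot \<sigma> p)"

text \<open>The degree \<open>-1\<close> homogeneous extension of \<open>wt\<close> from the sphere: with it the weighted length
  of a curve avoiding the origin bounds that of its radial projection.\<close>

definition wt_hom :: "real \<Rightarrow> real^3 \<Rightarrow> real" where
  "wt_hom \<sigma> p = wt \<sigma> (p /\<^sub>R norm p) / norm p"

context
  fixes \<sigma> :: real
  assumes \<sigma>: "\<sigma> > 0"
begin

lemma A_const_bounds: "0 < A_const \<sigma>" "A_const \<sigma> < 1"
  using \<sigma> by (auto simp: A_const_def)

lemma n1_bar_sq: "(n1_bar \<sigma>)\<^sup>2 = 1 - (A_const \<sigma>)\<^sup>2"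
proof -
  have "(A_const \<sigma>)\<^sup>2 \<le> 1" using A_const_bounds by (intro power_le_one) auto
  then show ?thesis by (simp add: n1_bar_def)
qed

lemma n1_bar_pos: "n1_bar \<sigma> > 0"
proof -
  have "(A_const \<sigma>)\<^sup>2 < 1" using A_const_bounds by (simp add: power_less_one_iff)
  then show ?thesis by (simp add: n1_bar_def)
qed

lemma norm_vec3: "norm (x :: real^3) = sqrt ((x $ 1)\<^sup>2 + (x $ 2)\<^sup>2 + (x $ 3)\<^sup>2)"
  by (simp add: norm_eq_sqrt_inner inner_vec_def sum_3 power2_eq_square)

lemma norm_n_minus: "norm (n_minus \<sigma>) = 1" and norm_n_plus: "norm (n_plus \<sigma>) = 1"
  by (simp_all add: norm_vec3 n_minus_def n_plus_def vector_3 n1_bar_sq)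

lemma W_pot_nonneg: "W_pot \<sigma> p \<ge> 0"
  using \<sigma> A_const_bounds by (simp add: W_pot_def)

lemma wt_nonneg: "wt \<sigma> p \<ge> 0"
  by (simp add: wt_def W_pot_nonneg)

lemma continuous_W_pot: "continuous_on S (W_pot \<sigma>)"
  unfolding W_pot_def by (intro continuous_intros)

lemma continuous_wt: "continuous_on S (wt \<sigma>)"
  unfolding wt_def by (intro continuous_on_real_sqrt continuous_W_pot)

lemma wt_hom_nonneg: "wt_hom \<sigma> p \<ge> 0"
  by (simp add: wt_hom_def wt_nonneg)

lemma continuous_wt_hom: "0 \<notin> S \<Longrightarrow> continuous_on S (wt_hom \<sigma>)"
  unfolding wt_hom_def
  by (intro continuous_on_divide continuous_on_compose2[OF continuous_wt[of UNIV]] continuous_intros) auto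

lemma borel_wt [measurable]: "wt \<sigma> \<in> borel_measurable borel"
  by (rule borel_measurable_continuous_onI[OF continuous_wt])

lemma borel_wt_hom [measurable]: "wt_hom \<sigma> \<in> borel_measurable borel"
  unfolding wt_hom_def by measurable

lemma wt_hom_sphere: "norm p = 1 \<Longrightarrow> wt_hom \<sigma> p = wt \<sigma> p"
  by (simp add: wt_hom_def)

lemma wt_bounded: "\<exists>M>0. \<forall>p. norm p = 1 \<longrightarrow> wt \<sigma> p \<le> M"
proof -
  have "bounded (wt \<sigma> ` sphere 0 1)"
    by (intro compact_imp_bounded compact_continuous_image continuous_wt) auto
  then obtain M where "M > 0" "\<And>p. p \<in> sphere 0 1 \<Longrightarrow> norm (wt \<sigma> p) \<le> M" unfolding bounded_pos by auto
  then show ?thesis by (intro exI[of _ M]) (auto dest: abs_le_D1)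
qed

text \<open>Removing the radial component does not increase the norm. For a curve \<open>V\<close>
  this bounds the speed of its radial projection by the speed of \<open>V\<close> divided by
  \<open>norm (V t)\<close>.\<close>

lemma norm_diff_proj_le:
  fixes v s :: "'a::real_inner"
  assumes "norm s = 1"
  shows "norm (v - (s \<bullet> v) *\<^sub>R s) \<le> norm v"
proof (rule power2_le_imp_le)
  have "s \<bullet> s = 1" using assms by (simp add: norm_eq_1)
  then have "(norm (v - (s \<bullet> v) *\<^sub>R s))\<^sup>2 = (norm v)\<^sup>2 - (s \<bullet> v)\<^sup>2"
    unfolding power2_norm_eq_inner
    by (simp add: inner_diff_left inner_diff_right inner_commute[of v s] power2_eq_square)
  then show "(norm (v - (s \<bullet> v) *\<^sub>R s))\<^sup>2 \<le> (norm v)\<^sup>2" by simp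
qed simp

text \<open>The radial projection of \<open>V\<close> is a competitor in the definition of
  \<open>c0_const\<close>. Its speed is at most \<open>norm (V' t) / norm (V t)\<close>, and the
  factor \<open>1 / norm (V t)\<close> is exactly the one contained in
  \<open>wt_hom\<close>.\<close>

lemma c0_le_C1_01:
  fixes V V' :: "real \<Rightarrow> real^3"
  assumes V: "\<And>t. t \<in> {0..1} \<Longrightarrow> (V has_vector_derivative V' t) (at t within {0..1})"
    and V': "continuous_on {0..1} V'"
    and nz: "\<And>t. t \<in> {0..1} \<Longrightarrow> V t \<noteq> 0"
    and ends: "V 0 = n_minus \<sigma>" "V 1 = n_plus \<sigma>"
  shows "c0_const \<sigma> \<le> integral {0..1} (\<lambda>t. wt_hom \<sigma> (V t) * norm (V' t))"
proof -
  define \<gamma> where "\<gamma> t = V t /\<^sub>R norm (V t)" for t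
  \<comment> \<open>The derivative of \<open>V / |V|\<close>: the part of \<open>V'\<close>
    orthogonal to \<open>V\<close>, divided by the norm of \<open>V\<close>.\<close>
  define \<gamma>' where "\<gamma>' t = (V' t - (sgn (V t) \<bullet> V' t) *\<^sub>R sgn (V t)) /\<^sub>R norm (V t)" for t
  have contV: "continuous_on {0..1} V"
    using V by (intro continuous_on_vector_derivative)
  have d: "(\<gamma> has_vector_derivative \<gamma>' t) (at t within {0..1})" if "t \<in> {0..1}" for t
  proof -
    have "((\<lambda>t. norm (V t)) has_vector_derivative (sgn (V t) \<bullet> V' t)) (at t within {0..1})"
    proof -
      have "((norm \<circ> V) has_derivative ((\<lambda>h. sgn (V t) \<bullet> h) \<circ> (\<lambda>h. h *\<^sub>R V' t))) (at t within {0..1})"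
        using V[OF that] nz[OF that] has_derivative_at_withinI[OF has_derivative_norm[of "V t"]]
        by (intro diff_chain_within) (auto simp: has_vector_derivative_def inner_commute)
      then show ?thesis by (simp add: has_vector_derivative_def o_def mult.commute)
    qed
    then have "((\<lambda>t. norm (V t)) has_real_derivative (sgn (V t) \<bullet> V' t)) (at t within {0..1})"
      by (simp add: has_real_derivative_iff_has_vector_derivative)
    then have "((\<lambda>t. inverse (norm (V t))) has_real_derivative - (sgn (V t) \<bullet> V' t) / (norm (V t))\<^sup>2) (at t within {0..1})"
      using nz[OF that] by (auto intro!: derivative_eq_intros simp: power2_eq_square divide_simps)
    from has_vector_derivative_scaleR[OF this V[OF that]]
    show ?thesis unfolding \<gamma>_def[abs_def] \<gamma>'_def
      by (rule has_vector_derivative_eq_rhs)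
        (simp add: sgn_div_norm scaleR_diff_right power2_eq_square divide_inverse algebra_simps)
  qed
  have c\<gamma>': "continuous_on {0..1} \<gamma>'"
    unfolding \<gamma>'_def sgn_div_norm using nz contV V' by (intro continuous_intros) auto
  have vd: "vector_derivative \<gamma> (at t within {0..1}) = \<gamma>' t" if "t \<in> {0..1}" for t
    using vector_derivative_within_cbox[of 0 1 t \<gamma> "\<gamma>' t"] d that by auto
  have cur: "\<gamma> \<in> {\<gamma>. C1_curve \<gamma> \<and> \<gamma> ` {0..1} \<subseteq> sphere 0 1 \<and> \<gamma> 0 = n_minus \<sigma> \<and> \<gamma> 1 = n_plus \<sigma>}"
  proof -
    have "\<gamma> differentiable_on {0..1}"
      unfolding differentiable_on_def differentiable_def using d[unfolded has_vector_derivative_def] by blast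
    moreover have "continuous_on {0..1} (\<lambda>t. vector_derivative \<gamma> (at t within {0..1}))"
      using c\<gamma>' by (subst continuous_on_cong[OF refl vd]) auto
    ultimately show ?thesis
      using nz ends norm_n_minus norm_n_plus by (auto simp: C1_curve_def \<gamma>_def)
  qed
  have "c0_const \<sigma> \<le> integral {0..1} (\<lambda>t. sqrt (W_pot \<sigma> (\<gamma> t)) * norm (vector_derivative \<gamma> (at t within {0..1})))"
    unfolding c0_const_def
  proof (rule cINF_lower[OF _ cur])
    show "bdd_below ((\<lambda>\<gamma>. integral {0..1} (\<lambda>t. sqrt (W_pot \<sigma> (\<gamma> t)) * norm (vector_derivative \<gamma> (at t within {0..1})))) `
       {\<gamma>. C1_curve \<gamma> \<and> \<gamma> ` {0..1} \<subseteq> sphere 0 1 \<and> \<gamma> 0 = n_minus \<sigma> \<and> \<gamma> 1 = n_plus \<sigma>})"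
    proof (rule bdd_belowI2[of _ 0])
      \<comment> \<open>The infimum of real numbers calls for a lower bound. An integrand without an
        integral gives the value 0, so 0 is a bound in every case.\<close>
      show "0 \<le> integral {0..1} (\<lambda>t. sqrt (W_pot \<sigma> (\<gamma> t)) * norm (vector_derivative \<gamma> (at t within {0..1})))" for \<gamma>
        by (cases "(\<lambda>t. sqrt (W_pot \<sigma> (\<gamma> t)) * norm (vector_derivative \<gamma> (at t within {0..1}))) integrable_on {0..1}")
          (auto intro!: Henstock_Kurzweil_Integration.integral_nonneg simp: W_pot_nonneg not_integrable_integral)
    qed
  qed
  also have "\<dots> = integral {0..1} (\<lambda>t. wt \<sigma> (\<gamma> t) * norm (\<gamma>' t))"
    by (intro Henstock_Kurzweil_Integration.integral_cong) (simp add: vd wt_def)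
  also have "\<dots> \<le> integral {0..1} (\<lambda>t. wt_hom \<sigma> (V t) * norm (V' t))"
  proof (rule integral_le)
    have "continuous_on {0..1} \<gamma>" unfolding \<gamma>_def using nz contV by (intro continuous_intros) auto
    then show "(\<lambda>t. wt \<sigma> (\<gamma> t) * norm (\<gamma>' t)) integrable_on {0..1}"
      using c\<gamma>' by (intro integrable_continuous_real continuous_intros continuous_on_compose2[OF continuous_wt[of UNIV]]) auto
    have "0 \<notin> V ` {0..1}" using nz by force
    then show "(\<lambda>t. wt_hom \<sigma> (V t) * norm (V' t)) integrable_on {0..1}"
      using contV V'
      by (intro integrable_continuous_real continuous_intros continuous_on_compose2[OF continuous_wt_hom[of "V ` {0..1}"]]) auto
    show "wt \<sigma> (\<gamma> t) * norm (\<gamma>' t) \<le> wt_hom \<sigma> (V t) * norm (V' t)" if "t \<in> {0..1}" for t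
    proof -
      have "norm (\<gamma>' t) \<le> norm (V' t) / norm (V t)"
        using norm_diff_proj_le[of "sgn (V t)" "V' t"] nz[OF that]
        unfolding \<gamma>'_def by (simp add: norm_sgn divide_inverse mult.commute mult_right_mono)
      from mult_left_mono[OF this wt_nonneg, of "\<gamma> t"] show ?thesis
        by (simp add: wt_hom_def \<gamma>_def)
    qed
  qed
  finally show ?thesis .
qed

text \<open>Weighted length is invariant under the affine map of [0, 1] onto [a, b]: the factor b -
  a in the derivative compensates the change of variables.\<close>

lemma c0_le_C1:
  fixes V V' :: "real \<Rightarrow> real^3"
  assumes ab: "a < b"
    and V: "\<And>t. t \<in> {a..b} \<Longrightarrow> (V has_vector_derivative V' t) (at t within {a..b})"
    and V': "continuous_on {a..b} V'"
    and nz: "\<And>t. t \<in> {a..b} \<Longrightarrow> V t \<noteq> 0"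
    and ends: "V a = n_minus \<sigma>" "V b = n_plus \<sigma>"
  shows "c0_const \<sigma> \<le> integral {a..b} (\<lambda>t. wt_hom \<sigma> (V t) * norm (V' t))"
proof -
  define r where "r t = (b - a) * t + a" for t
  have r: "r t \<in> {a..b}" if "t \<in> {0..1}" for t
  proof -
    have "(b - a) * t \<le> b - a" "0 \<le> (b - a) * t" using that ab by (auto intro: mult_left_le)
    then show ?thesis by (simp add: r_def)
  qed
  have contr: "continuous_on {0..1} r" unfolding r_def by (intro continuous_intros)
  have contV: "continuous_on {a..b} V" using V by (intro continuous_on_vector_derivative)
  have "c0_const \<sigma> \<le> integral {0..1} (\<lambda>t. wt_hom \<sigma> (V (r t)) * norm ((b - a) *\<^sub>R V' (r t)))"
  proof (rule c0_le_C1_01)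
    fix t :: real assume t: "t \<in> {0..1}"
    have "(r has_vector_derivative (b - a)) (at t within {0..1})"
      unfolding r_def by (auto intro!: derivative_eq_intros)
    moreover have "(V has_vector_derivative V' (r t)) (at (r t) within r ` {0..1})"
      using V[OF r[OF t]] by (rule has_vector_derivative_within_subset) (use r in auto)
    ultimately show "((\<lambda>t. V (r t)) has_vector_derivative (b - a) *\<^sub>R V' (r t)) (at t within {0..1})"
      using vector_diff_chain_within[of r "b - a" t "{0..1}" V] by (simp add: o_def)
    show "V (r t) \<noteq> 0" using nz[OF r[OF t]] .
  next
    show "continuous_on {0..1} (\<lambda>t. (b - a) *\<^sub>R V' (r t))"
      using r by (intro continuous_intros continuous_on_compose2[OF V' contr]) auto
  qed (use ends in \<open>auto simp: r_def\<close>)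
  also have "\<dots> = integral {a..b} (\<lambda>t. wt_hom \<sigma> (V t) * norm (V' t))"
  proof -
    have "0 \<notin> V ` {a..b}" using nz by force
    then have "(\<lambda>t. wt_hom \<sigma> (V t) * norm (V' t)) integrable_on {a..b}"
      using contV V'
      by (intro integrable_continuous_real continuous_intros continuous_on_compose2[OF continuous_wt_hom[of "V ` {a..b}"]]) auto
    then have "((\<lambda>t. wt_hom \<sigma> (V t) * norm (V' t)) has_integral integral {a..b} (\<lambda>t. wt_hom \<sigma> (V t) * norm (V' t))) (cbox a b)"
      by (simp add: has_integral_integral)
    from has_integral_affinity'[OF this, of "b - a" a] ab
    have "((\<lambda>t. wt_hom \<sigma> (V (r t)) * norm (V' (r t))) has_integral integral {a..b} (\<lambda>t. wt_hom \<sigma> (V t) * norm (V' t)) / (b - a)) {0..1}"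
      by (simp add: r_def divide_inverse mult.commute)
    from has_integral_mult_right[OF this, of "b - a"] ab
    have "((\<lambda>t. wt_hom \<sigma> (V (r t)) * norm ((b - a) *\<^sub>R V' (r t))) has_integral integral {a..b} (\<lambda>t. wt_hom \<sigma> (V t) * norm (V' t))) {0..1}"
      by (simp add: mult.left_commute)
    then show ?thesis by (rule integral_unique)
  qed
  finally show ?thesis .
qed

end

section \<open>From C1 curves to absolutely continuous curves and approximate end points\<close>

lemma integrable_indicator_scaleR:
  fixes f :: "real \<Rightarrow> 'b::euclidean_space"
  assumes "integrable lborel f" "A \<in> sets borel"
  shows "integrable lborel (\<lambda>s. indicator A s *\<^sub>R f s)"
  using integrable_mult_indicator[OF _ assms(1), of A] assms(2) by simp

context
  fixes \<sigma> :: real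
  assumes \<sigma>: "\<sigma> > 0"
begin

text \<open>The derivative \<open>w\<close> is approximated in L1 by a continuous \<open>v\<close>,
  and the primitive of \<open>v\<close> is corrected linearly so that it still ends at the second
  well. The resulting C1 curve \<open>V\<close> is uniformly close to \<open>u\<close>, and on a
  compact shell around the origin, where \<open>wt_hom\<close> is bounded and uniformly continuous,
  the weighted lengths are close too.\<close>

lemma c0_le_AC_hom:
  fixes w :: "real \<Rightarrow> real^3"
  assumes ab: "a < b" and w: "integrable lborel w"
  defines "u \<equiv> \<lambda>t. n_minus \<sigma> + (LINT s|lborel. indicator {a..t} s *\<^sub>R w s)"
  assumes ub: "u b = n_plus \<sigma>" and u_ge: "\<And>t. t \<in> {a..b} \<Longrightarrow> norm (u t) \<ge> 1 / 2"
  shows "c0_const \<sigma> \<le> (LINT t|lborel. indicator {a..b} t * (wt_hom \<sigma> (u t) * norm (w t)))"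
proof -
  note [measurable] = borel_wt_hom[OF \<sigma>]
  have [measurable]: "w \<in> borel_measurable borel" using w by auto
  define J where "J = (LINT s|lborel. indicator {a..b} s * norm (w s))"
  have iw: "integrable lborel (\<lambda>s. indicator A s *\<^sub>R w s)" if "A \<in> sets borel" for A
    using w that by (rule integrable_indicator_scaleR)
  have inw: "integrable lborel (\<lambda>s. indicator {a..b} s * norm (w s))"
    using integrable_indicator_scaleR[OF integrable_norm[OF w], of "{a..b}"] by simp
  have um [measurable]: "u \<in> borel_measurable borel"
    unfolding u_def indicator_def atLeastAtMost_iff by measurable
  have J0: "J \<ge> 0" unfolding J_def by (intro Bochner_Integration.integral_nonneg) auto
  have nu: "norm (u t) \<le> 1 + J" if "t \<in> {a..b}" for t
  proof -
    have "norm (LINT s|lborel. indicator {a..t} s *\<^sub>R w s) \<le> (LINT s|lborel. norm (indicator {a..t} s *\<^sub>R w s))"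
      by (rule integral_norm_bound)
    also have "\<dots> \<le> J" unfolding J_def
      using that by (intro integral_mono inw integrable_norm iw) (auto split: split_indicator)
    finally show ?thesis unfolding u_def
      using norm_triangle_ineq[of "n_minus \<sigma>" "LINT s|lborel. indicator {a..t} s *\<^sub>R w s"] norm_n_minus[OF \<sigma>] by simp
  qed
  \<comment> \<open>The curve \<open>u\<close> has norm between 1/2 and \<open>1 + J\<close>; the
    wider radii 1/4 and \<open>2 + J\<close> leave room for the approximating curve
    \<open>V\<close>.\<close>
  define K :: "(real^3) set" where "K = cball 0 (2 + J) - ball 0 (1 / 4)"
  have K: "compact K" unfolding K_def by (intro compact_diff) auto
  have K0: "0 \<notin> K" by (simp add: K_def)
  have uK: "u t \<in> K" if "t \<in> {a..b}" for t using u_ge[OF that] nu[OF that] by (auto simp: K_def)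
  have "bounded (wt_hom \<sigma> ` K)"
    by (intro compact_imp_bounded compact_continuous_image continuous_wt_hom[OF \<sigma> K0] K)
  then obtain B where B: "B > 0" "\<And>p. p \<in> K \<Longrightarrow> wt_hom \<sigma> p \<le> B"
    unfolding bounded_pos by (auto dest: abs_le_D1)
  let ?I = "LINT t|lborel. indicator {a..b} t * (wt_hom \<sigma> (u t) * norm (w t))"
  have iI: "integrable lborel (\<lambda>t. indicator {a..b} t * (wt_hom \<sigma> (u t) * norm (w t)))"
  proof (rule Bochner_Integration.integrable_bound[OF integrable_mult_right[OF inw, of B]])
    show "AE t in lborel. norm (indicator {a..b} t * (wt_hom \<sigma> (u t) * norm (w t))) \<le> norm (B * (indicator {a..b} t * norm (w t)))"
      using B uK wt_hom_nonneg[OF \<sigma>] by (intro AE_I2) (auto simp: abs_mult mult_right_mono split: split_indicator)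
  qed measurable
  have main: "c0_const \<sigma> \<le> ?I + e * (J + 1)" if "e > 0" for e
  proof -
    have "uniformly_continuous_on K (wt_hom \<sigma>)"
      by (rule compact_uniformly_continuous[OF continuous_wt_hom[OF \<sigma> K0] K])
    then obtain d where d: "d > 0" "\<And>p q. p \<in> K \<Longrightarrow> q \<in> K \<Longrightarrow> dist q p < d \<Longrightarrow> dist (wt_hom \<sigma> q) (wt_hom \<sigma> p) < e"
      unfolding uniformly_continuous_on_def using \<open>e > 0\<close> by metis
    \<comment> \<open>The bound d / 3 gives \<open>2 * \<eta> < d\<close>, so that the modulus of
      continuity applies between \<open>V\<close> and \<open>u\<close>; 1/16 keeps \<open>V\<close>
      inside \<open>K\<close>; and \<open>e / (2 * B)\<close> absorbs two error terms
      \<open>B * \<eta>\<close>.\<close>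
    define \<eta> where "\<eta> = min (min (d / 3) (1 / 16)) (e / (2 * B))"
    have \<eta>: "\<eta> > 0" "2 * \<eta> < d" "\<eta> \<le> 1 / 16" "2 * B * \<eta> \<le> e"
    proof -
      have le: "\<eta> \<le> d / 3" "\<eta> \<le> 1 / 16" "\<eta> \<le> e / (2 * B)" by (simp_all add: \<eta>_def)
      show "\<eta> > 0" using d(1) B(1) \<open>e > 0\<close> by (simp add: \<eta>_def)
      show "2 * \<eta> < d" "\<eta> \<le> 1 / 16" using le d(1) by linarith+
      show "2 * B * \<eta> \<le> e" using mult_left_mono[OF le(3), of "2 * B"] B(1) by simp
    qed
    obtain v where v: "continuous_on UNIV v" "integrable lborel v" "(LINT x|lborel. norm (w x - v x)) < \<eta>"
      using integrable_approx_continuous[OF w \<eta>(1)] by auto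
    have [measurable]: "v \<in> borel_measurable borel" using v by auto
    have iv: "integrable lborel (\<lambda>s. indicator A s *\<^sub>R v s)" if "A \<in> sets borel" for A
      using v(2) that by (rule integrable_indicator_scaleR)
    \<comment> \<open>\<open>E\<close> is the displacement of the end point caused by replacing
      \<open>w\<close> by \<open>v\<close>. Spread linearly over [a, b], it restores
      \<open>V b = u b\<close> and changes the derivative by a constant.\<close>
    define E where "E = (LINT s|lborel. indicator {a..b} s *\<^sub>R (w s - v s))"
    have small: "norm (LINT s|lborel. indicator {a..t} s *\<^sub>R (w s - v s)) \<le> \<eta>" for t
    proof -
      have "norm (LINT s|lborel. indicator {a..t} s *\<^sub>R (w s - v s)) \<le> (LINT s|lborel. norm (indicator {a..t} s *\<^sub>R (w s - v s)))"
        by (rule integral_norm_bound)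
      also have "\<dots> \<le> (LINT s|lborel. norm (w s - v s))"
        using w v by (intro integral_mono integrable_norm integrable_indicator_scaleR) (auto split: split_indicator)
      finally show ?thesis using v(3) by simp
    qed
    have nE: "norm E \<le> \<eta>" unfolding E_def by (rule small)
    define V where "V t = n_minus \<sigma> + integral {a..t} v + ((t - a) / (b - a)) *\<^sub>R E" for t
    define V' where "V' t = v t + (1 / (b - a)) *\<^sub>R E" for t
    have iv_eq: "(LINT s|lborel. indicator {a..t} s *\<^sub>R v s) = integral {a..t} v" for t
      using set_borel_integral_eq_integral(2)[of "{a..t}" v] iv[of "{a..t}"]
      by (simp add: set_integrable_def set_lebesgue_integral_def)
    have Vu: "V t - u t = ((t - a) / (b - a)) *\<^sub>R E - (LINT s|lborel. indicator {a..t} s *\<^sub>R (w s - v s))" for t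
      unfolding V_def u_def iv_eq[symmetric] scaleR_diff_right using iv iw by simp
    have close: "norm (V t - u t) \<le> 2 * \<eta>" if "t \<in> {a..b}" for t
    proof -
      have f: "0 \<le> (t - a) / (b - a)" "(t - a) / (b - a) \<le> 1" using that ab by (auto simp: divide_simps)
      then have "norm (((t - a) / (b - a)) *\<^sub>R E) \<le> \<eta>"
        using nE mult_right_mono[OF f(2) norm_ge_zero[of E]] unfolding norm_scaleR real_norm_def abs_of_nonneg[OF f(1)] by simp
      then show ?thesis unfolding Vu using small[of t] norm_triangle_ineq4[of "((t - a) / (b - a)) *\<^sub>R E"] by (smt (verit))
    qed
    have VK: "V t \<in> K" if "t \<in> {a..b}" for t
    proof -
      have "norm (u t) - 2 * \<eta> \<le> norm (V t)" "norm (V t) \<le> norm (u t) + 2 * \<eta>"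
        using close[OF that] norm_triangle_ineq2[of "u t" "V t"] norm_triangle_ineq2[of "V t" "u t"] norm_minus_commute[of "u t" "V t"] by auto
      then show ?thesis using u_ge[OF that] nu[OF that] \<eta>(3) by (auto simp: K_def)
    qed
    have dV: "(V has_vector_derivative V' t) (at t within {a..b})" if "t \<in> {a..b}" for t
    proof -
      have "((\<lambda>t. integral {a..t} v) has_vector_derivative v t) (at t within {a..b})"
        using v(1) that by (intro integral_has_vector_derivative) (auto intro: continuous_on_subset)
      moreover have "((\<lambda>t. ((t - a) / (b - a)) *\<^sub>R E) has_vector_derivative (1 / (b - a)) *\<^sub>R E) (at t within {a..b})"
      proof -
        have "((\<lambda>t. (t - a) / (b - a)) has_real_derivative 1 / (b - a)) (at t within {a..b})"
          using ab by (intro DERIV_cdivide) (auto intro!: derivative_eq_intros)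
        from has_vector_derivative_scaleR[OF this has_vector_derivative_const] show ?thesis by simp
      qed
      ultimately have "((\<lambda>t. (n_minus \<sigma> + integral {a..t} v) + ((t - a) / (b - a)) *\<^sub>R E) has_vector_derivative (0 + v t) + (1 / (b - a)) *\<^sub>R E) (at t within {a..b})"
        by (intro has_vector_derivative_add has_vector_derivative_const)
      then show ?thesis unfolding V_def[abs_def] V'_def by simp
    qed
    have cV': "continuous_on {a..b} V'"
      unfolding V'_def using v(1) by (intro continuous_intros) (auto intro: continuous_on_subset)
    have cV: "continuous_on {a..b} V" using dV by (intro continuous_on_vector_derivative)
    have Veq: "integral {a..b} (\<lambda>t. wt_hom \<sigma> (V t) * norm (V' t)) = (LINT t|lborel. indicator {a..b} t * (wt_hom \<sigma> (V t) * norm (V' t)))"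
    and iV: "integrable lborel (\<lambda>t. indicator {a..b} t * (wt_hom \<sigma> (V t) * norm (V' t)))"
    proof -
      have "continuous_on {a..b} (\<lambda>t. wt_hom \<sigma> (V t) * norm (V' t))"
        using cV cV' VK by (intro continuous_intros continuous_on_compose2[OF continuous_wt_hom[OF \<sigma> K0]]) auto
      from borel_integrable_atLeastAtMost'[OF this]
      show "integral {a..b} (\<lambda>t. wt_hom \<sigma> (V t) * norm (V' t)) = (LINT t|lborel. indicator {a..b} t * (wt_hom \<sigma> (V t) * norm (V' t)))"
        "integrable lborel (\<lambda>t. indicator {a..b} t * (wt_hom \<sigma> (V t) * norm (V' t)))"
        using set_borel_integral_eq_integral(2)[of "{a..b}" "\<lambda>t. wt_hom \<sigma> (V t) * norm (V' t)"]
        by (simp_all add: set_integrable_def set_lebesgue_integral_def)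
    qed
    have iab: "integrable lborel (indicator {a..b} :: real \<Rightarrow> real)"
      using ab by (intro integrable_real_indicator) auto
    have "c0_const \<sigma> \<le> integral {a..b} (\<lambda>t. wt_hom \<sigma> (V t) * norm (V' t))"
    proof (rule c0_le_C1[OF \<sigma> ab dV cV'])
      show "V t \<noteq> 0" if "t \<in> {a..b}" for t using VK[OF that] K0 by auto
      show "V a = n_minus \<sigma>" by (simp add: V_def)
      show "V b = n_plus \<sigma>"
      proof -
        have "V b - u b = 0" unfolding Vu E_def using ab by simp
        then show ?thesis using ub by simp
      qed
    qed
    also note Veq
    \<comment> \<open>Changing the weight from \<open>V\<close> to \<open>u\<close> costs
      \<open>e * norm (w t)\<close>; changing the velocity from \<open>V'\<close> to
      \<open>w\<close> costs \<open>B\<close> times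
      \<open>norm (w t - v t) + norm E / (b - a)\<close>. The integral of the latter is at most
      \<open>2 * B * \<eta>\<close>.\<close>
    also have "(LINT t|lborel. indicator {a..b} t * (wt_hom \<sigma> (V t) * norm (V' t)))
      \<le> (LINT t|lborel. indicator {a..b} t * (wt_hom \<sigma> (u t) * norm (w t)) + e * (indicator {a..b} t * norm (w t))
          + (B * norm (w t - v t) + B * (indicator {a..b} t * (norm E / (b - a)))))"
    proof (rule integral_mono[OF iV])
      show "integrable lborel (\<lambda>t. indicator {a..b} t * (wt_hom \<sigma> (u t) * norm (w t)) + e * (indicator {a..b} t * norm (w t))
          + (B * norm (w t - v t) + B * (indicator {a..b} t * (norm E / (b - a)))))"
        using iI inw w v iab by (intro Bochner_Integration.integrable_add integrable_mult_right integrable_norm Bochner_Integration.integrable_diff integrable_mult_left) auto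
      fix t
      show "indicator {a..b} t * (wt_hom \<sigma> (V t) * norm (V' t))
        \<le> indicator {a..b} t * (wt_hom \<sigma> (u t) * norm (w t)) + e * (indicator {a..b} t * norm (w t))
          + (B * norm (w t - v t) + B * (indicator {a..b} t * (norm E / (b - a))))"
      proof (cases "t \<in> {a..b}")
        case True
        have "norm (V' t) \<le> norm (w t) + (norm (w t - v t) + norm E / (b - a))"
        proof -
          have "V' t = w t - (w t - v t) + (1 / (b - a)) *\<^sub>R E" by (simp add: V'_def)
          then have "norm (V' t) \<le> norm (w t - (w t - v t)) + norm ((1 / (b - a)) *\<^sub>R E)"
            using norm_triangle_ineq by metis
          also have "\<dots> \<le> norm (w t) + norm (w t - v t) + norm E / (b - a)"
            using norm_triangle_ineq4[of "w t" "w t - v t"] ab by simp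
          finally show ?thesis by simp
        qed
        from mult_left_mono[OF this wt_hom_nonneg[OF \<sigma>, of "V t"]]
        have "wt_hom \<sigma> (V t) * norm (V' t) \<le> wt_hom \<sigma> (V t) * norm (w t) + wt_hom \<sigma> (V t) * (norm (w t - v t) + norm E / (b - a))"
          by (simp add: distrib_left)
        also have "\<dots> \<le> (wt_hom \<sigma> (u t) + e) * norm (w t) + B * (norm (w t - v t) + norm E / (b - a))"
        proof (intro add_mono mult_right_mono)
          have "dist (V t) (u t) < d" using close[OF True] \<eta>(2) by (simp add: dist_norm)
          from d(2)[OF uK[OF True] VK[OF True] this] show "wt_hom \<sigma> (V t) \<le> wt_hom \<sigma> (u t) + e"
            by (simp add: dist_real_def)
          show "wt_hom \<sigma> (V t) \<le> B" using B(2) VK[OF True] .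
          show "0 \<le> norm (w t - v t) + norm E / (b - a)" using ab by simp
        qed simp
        finally show ?thesis using True by (simp add: algebra_simps)
      next
        case False
        then show ?thesis using B(1) by simp
      qed
    qed
    also have "\<dots> = ?I + e * J + (B * (LINT t|lborel. norm (w t - v t)) + B * norm E)"
      using iI inw w v ab iab unfolding J_def by (simp add: measure_def)
    also have "\<dots> \<le> ?I + e * J + (B * \<eta> + B * \<eta>)"
      using B(1) v(3) nE by (intro add_mono mult_left_mono order_refl) auto
    also have "\<dots> \<le> ?I + e * (J + 1)" using \<eta>(4) by (simp add: algebra_simps)
    finally show ?thesis .
  qed
  show ?thesis
  proof (rule field_le_epsilon)
    fix e :: real assume "e > 0"
    then have "e / (J + 1) > 0" using J0 by (intro divide_pos_pos) auto
    from main[OF this] show "c0_const \<sigma> \<le> ?I + e" using J0 by simp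
  qed
qed

text \<open>Segments of unit duration join the wells to the two ends of \<open>u\<close>. They leave
  the sphere, but points at distance at most 1/2 from a unit vector have norm at least 1/2, where
  \<open>wt_hom\<close> is at most \<open>2 * M\<close>; each segment therefore costs at most
  \<open>2 * M\<close> times its length.\<close>

lemma c0_le_AC:
  fixes w :: "real \<Rightarrow> real^3" and u0 :: "real^3"
  assumes ab: "a < b" and w: "integrable lborel w"
  defines "u \<equiv> \<lambda>t. u0 + (LINT s|lborel. indicator {a..t} s *\<^sub>R w s)"
  assumes u1: "\<And>t. t \<in> {a..b} \<Longrightarrow> norm (u t) = 1"
    and d0: "norm (u a - n_minus \<sigma>) \<le> 1 / 2" and d1: "norm (u b - n_plus \<sigma>) \<le> 1 / 2"
    and M: "\<And>p. norm p = 1 \<Longrightarrow> wt \<sigma> p \<le> M"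
  shows "c0_const \<sigma> \<le> (LINT t|lborel. indicator {a..b} t * (wt \<sigma> (u t) * norm (w t)))
    + 2 * M * norm (u a - n_minus \<sigma>) + 2 * M * norm (u b - n_plus \<sigma>)"
proof -
  note [measurable] = borel_wt_hom[OF \<sigma>]
  have [measurable]: "w \<in> borel_measurable borel" using w by auto
  define D0 where "D0 = u a - n_minus \<sigma>"
  define D1 where "D1 = n_plus \<sigma> - u b"
  \<comment> \<open>The derivative of the extended curve: constant speed from
    \<open>n_minus \<sigma>\<close> to \<open>u a\<close> on [a - 1, a), then \<open>w\<close>, then
    constant speed from \<open>u b\<close> to \<open>n_plus \<sigma>\<close> on (b, b + 1].\<close>
  define W where "W s = indicator {a-1..<a} s *\<^sub>R D0 + indicator {a..b} s *\<^sub>R w s + indicator {b<..b+1} s *\<^sub>R D1" for s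
  have iw: "integrable lborel (\<lambda>s. indicator A s *\<^sub>R w s)" if "A \<in> sets borel" for A
    using w that by (rule integrable_indicator_scaleR)
  have W: "integrable lborel W" unfolding W_def
    by (intro Bochner_Integration.integrable_add iw integrable_scaleR_left integrable_real_indicator) auto
  define U where "U t = n_minus \<sigma> + (LINT s|lborel. indicator {a-1..t} s *\<^sub>R W s)" for t
  have ua: "u a = u0"
  proof -
    have "(LINT s|lborel. indicator {a..a} s *\<^sub>R w s) = (LINT s|(lborel :: real measure). 0)"
      using AE_lborel_singleton[of a] by (intro integral_cong_AE) (auto elim!: eventually_mono)
    then show ?thesis by (simp add: u_def)
  qed
  have D0_eq: "D0 = u0 - n_minus \<sigma>" by (simp only: D0_def ua)
  have U1: "U t = n_minus \<sigma> + (t - (a - 1)) *\<^sub>R D0" if "t \<in> {a-1..<a}" for t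
  proof -
    have "(LINT s|lborel. indicator {a-1..t} s *\<^sub>R W s) = (LINT s|lborel. indicator {a-1..t} s *\<^sub>R D0)"
      using that ab by (intro Bochner_Integration.integral_cong) (auto simp: W_def split: split_indicator)
    then show ?thesis using that by (simp add: U_def)
  qed
  have U2: "U t = u t" if "t \<in> {a..b}" for t
  proof -
    have "(LINT s|lborel. indicator {a-1..t} s *\<^sub>R W s) = (LINT s|lborel. indicator {a-1..<a} s *\<^sub>R D0 + indicator {a..t} s *\<^sub>R w s)"
      using that by (intro Bochner_Integration.integral_cong) (auto simp: W_def split: split_indicator)
    also have "\<dots> = D0 + (LINT s|lborel. indicator {a..t} s *\<^sub>R w s)"
      by (subst Bochner_Integration.integral_add) (auto intro!: iw integrable_scaleR_left integrable_real_indicator)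
    finally show ?thesis by (simp add: U_def D0_eq u_def)
  qed
  have U3: "U t = u b + (t - b) *\<^sub>R D1" if "t \<in> {b<..b+1}" for t
  proof -
    have "(LINT s|lborel. indicator {a-1..t} s *\<^sub>R W s) = (LINT s|lborel. (indicator {a-1..<a} s *\<^sub>R D0 + indicator {a..b} s *\<^sub>R w s) + indicator {b<..t} s *\<^sub>R D1)"
      using that ab by (intro Bochner_Integration.integral_cong) (auto simp: W_def split: split_indicator)
    also have "\<dots> = D0 + (LINT s|lborel. indicator {a..b} s *\<^sub>R w s) + (t - b) *\<^sub>R D1"
      using that by (subst Bochner_Integration.integral_add, (auto intro!: iw integrable_scaleR_left integrable_real_indicator Bochner_Integration.integrable_add)[2],
        subst Bochner_Integration.integral_add) (auto intro!: iw integrable_scaleR_left integrable_real_indicator)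
    finally show ?thesis by (simp add: U_def D0_eq u_def)
  qed
  have M0: "M \<ge> 0" using M[of "n_minus \<sigma>"] norm_n_minus[OF \<sigma>] wt_nonneg[OF \<sigma>, of "n_minus \<sigma>"] by simp
  have half: "norm (p + r *\<^sub>R q) \<ge> 1 / 2" if "norm p = 1" "norm q \<le> 1 / 2" "0 \<le> r" "r \<le> 1" for p q :: "real^3" and r
  proof -
    have "norm (r *\<^sub>R q) \<le> 1 / 2" using that mult_mono[of "\<bar>r\<bar>" 1 "norm q" "1/2"] by simp
    then show ?thesis using norm_diff_ineq[of p "r *\<^sub>R q"] that(1) by simp
  qed
  have nD: "norm D0 \<le> 1 / 2" "norm D1 \<le> 1 / 2" using d0 d1 by (simp_all add: D0_def D1_def norm_minus_commute)
  have Uge: "norm (U t) \<ge> 1 / 2" if t: "t \<in> {a-1..b+1}" for t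
  proof -
    consider "t \<in> {a-1..<a}" | "t \<in> {a..b}" | "t \<in> {b<..b+1}" using t by force
    then show ?thesis
    proof cases
      case 1 then show ?thesis using half[OF norm_n_minus[OF \<sigma>] nD(1), of "t - (a - 1)"] by (simp add: U1)
    next
      case 2 then show ?thesis using u1[OF 2] by (simp add: U2)
    next
      case 3 then show ?thesis using half[OF u1[of b] nD(2), of "t - b"] ab by (simp add: U3)
    qed
  qed
  have hom: "wt_hom \<sigma> p \<le> 2 * M" if "norm p \<ge> 1 / 2" for p
  proof -
    have "wt \<sigma> (p /\<^sub>R norm p) \<le> M" using that by (intro M) (auto simp: divide_simps)
    then have "wt \<sigma> (p /\<^sub>R norm p) / norm p \<le> M / (1 / 2)" using that M0 by (intro frac_le) auto
    then show ?thesis by (simp add: wt_hom_def)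
  qed
  have [measurable]: "u \<in> borel_measurable borel"
    unfolding u_def indicator_def atLeastAtMost_iff by measurable
  have iM: "integrable lborel (\<lambda>t. indicator {a..b} t * (wt \<sigma> (u t) * norm (w t)))"
  proof (rule Bochner_Integration.integrable_bound[OF integrable_mult_right[OF integrable_norm[OF w], of M]])
    show "AE t in lborel. norm (indicator {a..b} t * (wt \<sigma> (u t) * norm (w t))) \<le> norm (M * norm (w t))"
      using M u1 wt_nonneg[OF \<sigma>] M0 by (intro AE_I2) (auto simp: abs_mult mult_right_mono split: split_indicator)
    note [measurable] = borel_wt[OF \<sigma>]
    show "(\<lambda>t. indicator {a..b} t * (wt \<sigma> (u t) * norm (w t))) \<in> borel_measurable lborel" by measurable
  qed
  have "c0_const \<sigma> \<le> (LINT t|lborel. indicator {a-1..b+1} t * (wt_hom \<sigma> (U t) * norm (W t)))"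
  proof -
    have "U (b + 1) = n_plus \<sigma>" using U3[of "b + 1"] by (simp add: D1_def)
    from c0_le_AC_hom[OF _ W this[unfolded U_def], folded U_def, OF _ Uge] ab show ?thesis by simp
  qed
  also have "\<dots> \<le> (LINT t|lborel. indicator {a-1..<a} t * (2 * M * norm D0) + indicator {a..b} t * (wt \<sigma> (u t) * norm (w t)) + indicator {b<..b+1} t * (2 * M * norm D1))"
  proof (rule integral_mono')
    show "integrable lborel (\<lambda>t. indicator {a-1..<a} t * (2 * M * norm D0) + indicator {a..b} t * (wt \<sigma> (u t) * norm (w t)) + indicator {b<..b+1} t * (2 * M * norm D1))"
      by (intro Bochner_Integration.integrable_add iM integrable_mult_left integrable_real_indicator) auto
    fix t
    show "indicator {a-1..b+1} t * (wt_hom \<sigma> (U t) * norm (W t)) \<le> indicator {a-1..<a} t * (2 * M * norm D0) + indicator {a..b} t * (wt \<sigma> (u t) * norm (w t)) + indicator {b<..b+1} t * (2 * M * norm D1)"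
    proof -
      consider "t \<in> {a-1..<a}" | "t \<in> {a..b}" | "t \<in> {b<..b+1}" | "t \<notin> {a-1..b+1}" by force
      then show ?thesis
      proof cases
        case 1 then show ?thesis using hom[OF Uge, of t] ab by (simp add: W_def mult_right_mono)
      next
        case 2 then show ?thesis using u1[OF 2] wt_hom_sphere[OF \<sigma>, of "u t"] U2[of t] by (simp add: W_def)
      next
        case 3 then show ?thesis using hom[OF Uge, of t] ab by (simp add: W_def mult_right_mono)
      next
        case 4 then have "indicator {a-1..b+1} t = (0::real)" by simp
        then show ?thesis using M0 wt_nonneg[OF \<sigma>, of "u t"] by simp
      qed
    qed
    show "0 \<le> indicator {a-1..<a} t * (2 * M * norm D0) + indicator {a..b} t * (wt \<sigma> (u t) * norm (w t)) + indicator {b<..b+1} t * (2 * M * norm D1)"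
      using M0 wt_nonneg[OF \<sigma>, of "u t"] by simp
  qed
  also have "\<dots> = 2 * M * norm D0 + (LINT t|lborel. indicator {a..b} t * (wt \<sigma> (u t) * norm (w t))) + 2 * M * norm D1"
  proof -
    have i: "integrable lborel (\<lambda>t. indicator {a-1..<a} t * (2 * M * norm D0))" "integrable lborel (\<lambda>t. indicator {b<..b+1} t * (2 * M * norm D1))"
      by (intro integrable_mult_left integrable_real_indicator; simp)+
    show ?thesis
      by (subst Bochner_Integration.integral_add[OF Bochner_Integration.integrable_add[OF i(1) iM] i(2)],
        subst Bochner_Integration.integral_add[OF i(1) iM]) (simp add: measure_def)
  qed
  finally show ?thesis by (simp add: D0_def D1_def norm_minus_commute)
qed

text \<open>The reflection in the plane n_1 = 0. It is an isometry that preserves the potential and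
  exchanges the wells, so estimates for passages from n^- to n^+ also hold in the opposite
  direction.\<close>

definition reflect :: "real^3 \<Rightarrow> real^3" where
  "reflect p = p - (2 * p $ 1) *\<^sub>R axis 1 1"

lemma reflect_nth: "reflect p $ 1 = - p $ 1" "reflect p $ 2 = p $ 2" "reflect p $ 3 = p $ 3"
  by (simp_all add: reflect_def axis_def)

lemma bounded_linear_reflect: "bounded_linear reflect"
  unfolding linear_conv_bounded_linear[symmetric]
  by (rule linearI) (simp_all add: vec_eq_iff forall_3 reflect_nth algebra_simps)

lemma norm_reflect: "norm (reflect p) = norm p"
  by (simp add: norm_vec3[OF \<sigma>] reflect_nth)

lemma wt_reflect: "wt \<sigma> (reflect p) = wt \<sigma> p"
  by (simp add: wt_def W_pot_def reflect_nth)

lemma reflect_n: "reflect (n_minus \<sigma>) = n_plus \<sigma>" "reflect (n_plus \<sigma>) = n_minus \<sigma>"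
  by (simp_all add: vec_eq_iff forall_3 reflect_nth n_minus_def n_plus_def)

lemma reflect_diff: "reflect (p - q) = reflect p - reflect q"
  by (rule linear_diff[OF bounded_linear.linear[OF bounded_linear_reflect]])

lemma c0_le_AC_rev:
  fixes w :: "real \<Rightarrow> real^3" and u0 :: "real^3"
  assumes ab: "a < b" and w: "integrable lborel w"
  defines "u \<equiv> \<lambda>t. u0 + (LINT s|lborel. indicator {a..t} s *\<^sub>R w s)"
  assumes u1: "\<And>t. t \<in> {a..b} \<Longrightarrow> norm (u t) = 1"
    and d0: "norm (u a - n_plus \<sigma>) \<le> 1 / 2" and d1: "norm (u b - n_minus \<sigma>) \<le> 1 / 2"
    and M: "\<And>p. norm p = 1 \<Longrightarrow> wt \<sigma> p \<le> M"
  shows "c0_const \<sigma> \<le> (LINT t|lborel. indicator {a..b} t * (wt \<sigma> (u t) * norm (w t)))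
    + 2 * M * norm (u a - n_plus \<sigma>) + 2 * M * norm (u b - n_minus \<sigma>)"
proof -
  have rw: "integrable lborel (\<lambda>s. reflect (w s))"
    by (rule integrable_bounded_linear[OF bounded_linear_reflect w])
  have ru: "reflect u0 + (LINT s|lborel. indicator {a..t} s *\<^sub>R reflect (w s)) = reflect (u t)" for t
  proof -
    have "(LINT s|lborel. indicator {a..t} s *\<^sub>R reflect (w s)) = (LINT s|lborel. reflect (indicator {a..t} s *\<^sub>R w s))"
      by (simp add: linear_cmul[OF bounded_linear.linear[OF bounded_linear_reflect]])
    also have "\<dots> = reflect (LINT s|lborel. indicator {a..t} s *\<^sub>R w s)"
      by (rule integral_bounded_linear[OF bounded_linear_reflect integrable_indicator_scaleR[OF w]]) simp
    finally show ?thesis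
      by (simp add: u_def linear_add[OF bounded_linear.linear[OF bounded_linear_reflect]])
  qed
  have n: "norm (reflect p - n_minus \<sigma>) = norm (p - n_plus \<sigma>)" "norm (reflect p - n_plus \<sigma>) = norm (p - n_minus \<sigma>)" for p
    using norm_reflect[of "p - n_plus \<sigma>"] norm_reflect[of "p - n_minus \<sigma>"] by (simp_all add: reflect_diff reflect_n)
  from c0_le_AC[OF ab rw, of "reflect u0" M, unfolded ru n norm_reflect wt_reflect, OF u1 d0 d1 M]
  show ?thesis .
qed

text \<open>On the sphere the weight is at least
  \<open>k * \<bar>N\<^sup>2 - (p $ 1)\<^sup>2\<bar>\<close>, a function of the first coordinate
  alone. The weighted length therefore dominates the increment of
  \<open>k * (N\<^sup>2 * x - x ^ 3 / 3)\<close> along that coordinate, which from -N to N equals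
  \<open>k * (4 / 3 * N ^ 3)\<close>.\<close>

lemma c0_pos: "c0_const \<sigma> > 0"
proof -
  obtain M where M: "M > 0" "\<And>p. norm p = 1 \<Longrightarrow> wt \<sigma> p \<le> M" using wt_bounded[OF \<sigma>] by auto
  define A where "A = A_const \<sigma>"
  define N where "N = n1_bar \<sigma>"
  have A: "0 < A" "A < 1" using A_const_bounds[OF \<sigma>] by (auto simp: A_def)
  have N: "N > 0" "N\<^sup>2 = 1 - A\<^sup>2" using n1_bar_pos[OF \<sigma>] n1_bar_sq[OF \<sigma>] by (auto simp: A_def N_def)
  \<comment> \<open>On the sphere N^2 - p_1^2 = p_2^2 + (p_3 - A)(p_3 + A). The first summand is at
    most \<open>M / \<sigma>\<close> times the weight, the second at most twice the weight.\<close>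
  define k where "k = 1 / (M / \<sigma> + 2)"
  have k: "k > 0" using M(1) \<sigma> by (auto simp: k_def intro!: divide_pos_pos add_pos_pos)
  have low: "k * \<bar>N\<^sup>2 - (p $ 1)\<^sup>2\<bar> \<le> wt \<sigma> p" if p: "norm p = 1" for p
  proof -
    have W: "(wt \<sigma> p)\<^sup>2 = \<sigma> * (p $ 2)\<^sup>2 + 1 / A * (p $ 3 - A)\<^sup>2"
      using W_pot_nonneg[OF \<sigma>, of p] by (simp add: wt_def W_pot_def A_def)
    have s: "(p $ 1)\<^sup>2 + (p $ 2)\<^sup>2 + (p $ 3)\<^sup>2 = 1"
      using p unfolding norm_vec3[OF \<sigma>] by simp
    have "\<bar>p $ 3\<bar> \<le> 1" using component_le_norm_cart[of p 3] p by simp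
    then have p3: "\<bar>p $ 3 + A\<bar> \<le> 2" using A by linarith
    have "(p $ 3 - A)\<^sup>2 \<le> 1 / A * (p $ 3 - A)\<^sup>2"
      using mult_right_mono[of 1 "1 / A" "(p $ 3 - A)\<^sup>2"] A by simp
    also have "\<dots> \<le> (wt \<sigma> p)\<^sup>2" unfolding W using \<sigma> by simp
    finally have d: "\<bar>p $ 3 - A\<bar> \<le> wt \<sigma> p"
      using wt_nonneg[OF \<sigma>, of p] by (simp add: abs_le_square_iff[symmetric])
    have "\<sigma> * (p $ 2)\<^sup>2 \<le> (wt \<sigma> p)\<^sup>2" unfolding W using A by simp
    also have "\<dots> \<le> M * wt \<sigma> p"
      unfolding power2_eq_square using M(2)[OF p] wt_nonneg[OF \<sigma>] by (intro mult_right_mono) auto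
    finally have p2: "(p $ 2)\<^sup>2 \<le> M / \<sigma> * wt \<sigma> p" using \<sigma> by (simp add: field_simps)
    have "N\<^sup>2 - (p $ 1)\<^sup>2 = (p $ 2)\<^sup>2 + (p $ 3 - A) * (p $ 3 + A)"
      using s N(2) by (simp add: power2_eq_square algebra_simps)
    also have "\<bar>\<dots>\<bar> \<le> (p $ 2)\<^sup>2 + \<bar>p $ 3 - A\<bar> * \<bar>p $ 3 + A\<bar>"
      using abs_triangle_ineq[of "(p $ 2)\<^sup>2" "(p $ 3 - A) * (p $ 3 + A)"] by (simp add: abs_mult)
    also have "\<dots> \<le> M / \<sigma> * wt \<sigma> p + wt \<sigma> p * 2"
      using p2 d p3 wt_nonneg[OF \<sigma>] by (intro add_mono mult_mono) auto
    finally have "\<bar>N\<^sup>2 - (p $ 1)\<^sup>2\<bar> \<le> (M / \<sigma> + 2) * wt \<sigma> p" by (simp add: algebra_simps)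
    from mult_left_mono[OF this, of k] k have "k * \<bar>N\<^sup>2 - (p $ 1)\<^sup>2\<bar> \<le> (k * (M / \<sigma> + 2)) * wt \<sigma> p"
      by (simp only: mult.assoc less_imp_le)
    moreover have "k * (M / \<sigma> + 2) = 1"
      using M(1) \<sigma> unfolding k_def by (simp add: add_pos_pos less_imp_neq[symmetric])
    ultimately show ?thesis by simp
  qed
  have "k * (4 / 3 * N ^ 3) \<le> c0_const \<sigma>"
    unfolding c0_const_def
  proof (rule cINF_greatest)
    \<comment> \<open>An infimum over real numbers can be bounded below by competitors only if there
      is one: the great circle arc through (0, 0, 1) joins the wells, as
      \<open>sin (arcsin N) = N\<close> and \<open>cos (arcsin N) = A\<close>.\<close>
    define \<theta> where "\<theta> t = (2 * t - 1) * arcsin N" for t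
    define \<gamma> :: "real \<Rightarrow> real^3" where "\<gamma> t = sin (\<theta> t) *\<^sub>R axis 1 1 + cos (\<theta> t) *\<^sub>R axis 3 1" for t
    define \<gamma>' :: "real \<Rightarrow> real^3" where "\<gamma>' t = (2 * arcsin N * cos (\<theta> t)) *\<^sub>R axis 1 1 - (2 * arcsin N * sin (\<theta> t)) *\<^sub>R axis 3 1" for t
    have d: "(\<gamma> has_vector_derivative \<gamma>' t) (at t within {0..1})" for t
    proof -
      have "((\<lambda>t. sin (\<theta> t)) has_real_derivative 2 * arcsin N * cos (\<theta> t)) (at t within {0..1})"
        "((\<lambda>t. cos (\<theta> t)) has_real_derivative - (2 * arcsin N * sin (\<theta> t))) (at t within {0..1})"
        unfolding \<theta>_def by (auto intro!: derivative_eq_intros)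
      from has_vector_derivative_add[OF has_vector_derivative_scaleR[OF this(1) has_vector_derivative_const]
        has_vector_derivative_scaleR[OF this(2) has_vector_derivative_const]]
      show ?thesis unfolding \<gamma>_def[abs_def] \<gamma>'_def by simp
    qed
    have N1: "N \<le> 1"
      using N A by (intro power2_le_imp_le[of N 1]) auto
    have ends: "sin (arcsin N) = N" "cos (arcsin N) = A"
    proof -
      show "sin (arcsin N) = N" using N N1 by simp
      have "1 - N\<^sup>2 = A\<^sup>2" using N by simp
      then show "cos (arcsin N) = A" using N N1 A by (simp add: cos_arcsin)
    qed
    have vd: "vector_derivative \<gamma> (at t within {0..1}) = \<gamma>' t" if "t \<in> {0..1}" for t
      using vector_derivative_within_cbox[of 0 1 t \<gamma> "\<gamma>' t"] d that by auto
    have "C1_curve \<gamma>"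
      unfolding C1_curve_def
    proof
      show "\<gamma> differentiable_on {0..1}"
        unfolding differentiable_on_def differentiable_def using d[unfolded has_vector_derivative_def] by blast
      have "continuous_on {0..1} \<gamma>'" unfolding \<gamma>'_def \<theta>_def by (intro continuous_intros)
      then show "continuous_on {0..1} (\<lambda>t. vector_derivative \<gamma> (at t within {0..1}))"
        by (subst continuous_on_cong[OF refl vd]) auto
    qed
    moreover have "norm (\<gamma> t) = 1" for t
      by (simp add: norm_vec3[OF \<sigma>] \<gamma>_def axis_def)
    moreover have "\<gamma> 0 = n_minus \<sigma>" "\<gamma> 1 = n_plus \<sigma>"
      using ends by (simp_all add: vec_eq_iff forall_3 \<gamma>_def \<theta>_def n_minus_def n_plus_def axis_def N_def A_def)
    ultimately show "{\<gamma>. C1_curve \<gamma> \<and> \<gamma> ` {0..1} \<subseteq> sphere 0 1 \<and> \<gamma> 0 = n_minus \<sigma> \<and> \<gamma> 1 = n_plus \<sigma>} \<noteq> {}"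
      by (auto intro!: exI[of _ \<gamma>])
  next
    fix \<gamma> :: "real \<Rightarrow> real^3"
    assume "\<gamma> \<in> {\<gamma>. C1_curve \<gamma> \<and> \<gamma> ` {0..1} \<subseteq> sphere 0 1 \<and> \<gamma> 0 = n_minus \<sigma> \<and> \<gamma> 1 = n_plus \<sigma>}"
    then have g: "\<gamma> differentiable_on {0..1}" "continuous_on {0..1} (\<lambda>t. vector_derivative \<gamma> (at t within {0..1}))"
      "\<And>t. t \<in> {0..1} \<Longrightarrow> norm (\<gamma> t) = 1" "\<gamma> 0 = n_minus \<sigma>" "\<gamma> 1 = n_plus \<sigma>"
      by (auto simp: C1_curve_def image_subset_iff)
    define \<gamma>' where "\<gamma>' t = vector_derivative \<gamma> (at t within {0..1})" for t
    have d: "(\<gamma> has_vector_derivative \<gamma>' t) (at t within {0..1})" if "t \<in> {0..1}" for t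
      using g(1) that unfolding \<gamma>'_def differentiable_on_def by (simp add: vector_derivative_works[symmetric])
    have c: "continuous_on {0..1} \<gamma>" using d by (intro continuous_on_vector_derivative)
    have c': "continuous_on {0..1} \<gamma>'" using g(2) by (simp add: \<gamma>'_def)
    \<comment> \<open>The integrand is the exact derivative of
      \<open>k * (N\<^sup>2 * x - x ^ 3 / 3)\<close> along \<open>x = \<gamma> t $ 1\<close>, so the
      integral depends on the end points only.\<close>
    have "((\<lambda>t. k * ((N\<^sup>2 - (\<gamma> t $ 1)\<^sup>2) * \<gamma>' t $ 1)) has_integral
        (k * (N\<^sup>2 * \<gamma> 1 $ 1 - (\<gamma> 1 $ 1) ^ 3 / 3) - k * (N\<^sup>2 * \<gamma> 0 $ 1 - (\<gamma> 0 $ 1) ^ 3 / 3))) {0..1}"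
    proof (rule fundamental_theorem_of_calculus)
      fix t :: real assume t: "t \<in> {0..1}"
      have "((\<lambda>t. \<gamma> t $ 1) has_vector_derivative \<gamma>' t $ 1) (at t within {0..1})"
        by (rule bounded_linear.has_vector_derivative[OF bounded_linear_vec_nth d[OF t]])
      then have "((\<lambda>t. \<gamma> t $ 1) has_real_derivative \<gamma>' t $ 1) (at t within {0..1})"
        by (simp add: has_real_derivative_iff_has_vector_derivative)
      then have "((\<lambda>t. k * (N\<^sup>2 * \<gamma> t $ 1 - (\<gamma> t $ 1) ^ 3 / 3)) has_real_derivative k * ((N\<^sup>2 - (\<gamma> t $ 1)\<^sup>2) * \<gamma>' t $ 1)) (at t within {0..1})"
        by (auto intro!: derivative_eq_intros simp: algebra_simps)
      then show "((\<lambda>t. k * (N\<^sup>2 * \<gamma> t $ 1 - (\<gamma> t $ 1) ^ 3 / 3)) has_vector_derivative k * ((N\<^sup>2 - (\<gamma> t $ 1)\<^sup>2) * \<gamma>' t $ 1)) (at t within {0..1})"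
        by (simp add: has_real_derivative_iff_has_vector_derivative)
    qed simp
    moreover have "k * (N\<^sup>2 * \<gamma> 1 $ 1 - (\<gamma> 1 $ 1) ^ 3 / 3) - k * (N\<^sup>2 * \<gamma> 0 $ 1 - (\<gamma> 0 $ 1) ^ 3 / 3) = k * (4 / 3 * N ^ 3)"
      unfolding g(4,5) by (simp add: n_minus_def n_plus_def N_def[symmetric] field_simps power2_eq_square power3_eq_cube)
    ultimately have I: "((\<lambda>t. k * ((N\<^sup>2 - (\<gamma> t $ 1)\<^sup>2) * \<gamma>' t $ 1)) has_integral k * (4 / 3 * N ^ 3)) {0..1}" by simp
    have "(\<lambda>t. wt \<sigma> (\<gamma> t) * norm (\<gamma>' t)) integrable_on {0..1}"
      using c c' by (intro integrable_continuous_real continuous_intros continuous_on_compose2[OF continuous_wt[OF \<sigma>, of UNIV]]) auto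
    then have J: "((\<lambda>t. wt \<sigma> (\<gamma> t) * norm (\<gamma>' t)) has_integral integral {0..1} (\<lambda>t. wt \<sigma> (\<gamma> t) * norm (\<gamma>' t))) {0..1}"
      by (rule integrable_integral)
    have "k * (4 / 3 * N ^ 3) \<le> integral {0..1} (\<lambda>t. wt \<sigma> (\<gamma> t) * norm (\<gamma>' t))"
    proof (rule has_integral_le[OF I J])
      fix t :: real assume t: "t \<in> {0..1}"
      have "k * ((N\<^sup>2 - (\<gamma> t $ 1)\<^sup>2) * \<gamma>' t $ 1) \<le> k * \<bar>N\<^sup>2 - (\<gamma> t $ 1)\<^sup>2\<bar> * \<bar>\<gamma>' t $ 1\<bar>"
        using k abs_ge_self[of "(N\<^sup>2 - (\<gamma> t $ 1)\<^sup>2) * \<gamma>' t $ 1"] by (simp add: abs_mult mult.assoc)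
      also have "\<dots> \<le> wt \<sigma> (\<gamma> t) * norm (\<gamma>' t)"
        using low[OF g(3)[OF t]] component_le_norm_cart[of "\<gamma>' t" 1] wt_nonneg[OF \<sigma>] by (intro mult_mono) auto
      finally show "k * ((N\<^sup>2 - (\<gamma> t $ 1)\<^sup>2) * \<gamma>' t $ 1) \<le> wt \<sigma> (\<gamma> t) * norm (\<gamma>' t)" .
    qed
    then show "k * (4 / 3 * N ^ 3) \<le> integral {0..1} (\<lambda>t. sqrt (W_pot \<sigma> (\<gamma> t)) * norm (vector_derivative \<gamma> (at t within {0..1})))"
      by (simp add: wt_def \<gamma>'_def)
  qed
  moreover have "k * (4 / 3 * N ^ 3) > 0" using k N(1) by simp
  ultimately show ?thesis by linarith
qed

end

section \<open>Shifts on the torus and the slice inequality\<close>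

text \<open>The representative of \<open>x\<close> modulo 2 l in the fundamental interval [-l, l),
  for positive \<open>l\<close>.\<close>

definition wrap :: "real \<Rightarrow> real \<Rightarrow> real" where
  "wrap l x = x - 2 * l * of_int \<lfloor>(x + l) / (2 * l)\<rfloor>"

lemma wrap_borel [measurable]: "wrap l \<in> borel_measurable borel"
  unfolding wrap_def by measurable

context
  fixes l :: real
  assumes l: "l > 0"
begin

lemma wrap_id: "x \<in> {-l..<l} \<Longrightarrow> wrap l x = x"
proof -
  assume "x \<in> {-l..<l}"
  then have "\<lfloor>(x + l) / (2 * l)\<rfloor> = 0" using l by (simp add: floor_eq_iff field_simps)
  then show ?thesis by (simp add: wrap_def)
qed

lemma wrap_add: "wrap l (x + 2 * l) = wrap l x"
proof -
  have "(x + 2 * l + l) / (2 * l) = (x + l) / (2 * l) + 1" using l by (simp add: field_simps)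
  then have "\<lfloor>(x + 2 * l + l) / (2 * l)\<rfloor> = \<lfloor>(x + l) / (2 * l)\<rfloor> + 1" by simp
  then show ?thesis by (simp add: wrap_def algebra_simps)
qed

lemma wrap_eq: "x \<in> {l..<3 * l} \<Longrightarrow> wrap l x = x - 2 * l"
  using wrap_add[of "x - 2 * l"] wrap_id[of "x - 2 * l"] by simp

lemma nn_integral_side:
  assumes "f \<in> borel_measurable borel"
  shows "(\<integral>\<^sup>+x. f x \<partial>side l) = (\<integral>\<^sup>+x. f x * indicator {-l..<l} x \<partial>lborel)"
  using assms unfolding side_def by (subst nn_integral_density) (auto simp: mult.commute)

lemma nn_integral_shift:
  fixes f :: "real \<Rightarrow> ennreal"
  assumes [measurable]: "f \<in> borel_measurable borel"
  shows "(\<integral>\<^sup>+x. f (x + s) \<partial>lborel) = (\<integral>\<^sup>+x. f x \<partial>lborel)"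
  using nn_integral_real_affine[OF assms, of 1 s] by (simp add: add.commute)

text \<open>Rotations of the circle preserve length: the shifted interval is cut at
  \<open>l\<close>, and the part beyond \<open>l\<close> is moved back by one period.\<close>

lemma nn_integral_wrap_shift:
  assumes s: "0 \<le> s" "s < 2 * l" and [measurable]: "f \<in> borel_measurable borel"
  shows "(\<integral>\<^sup>+x. f (wrap l (x + s)) \<partial>side l) = (\<integral>\<^sup>+x. f x \<partial>side l)"
proof -
  let ?F = "\<lambda>x. f (wrap l x)"
  have "(\<integral>\<^sup>+x. f (wrap l (x + s)) \<partial>side l) = (\<integral>\<^sup>+x. ?F (x + s) * indicator {-l+s..<l+s} (x + s) \<partial>lborel)"
    by (subst nn_integral_side) (auto intro!: nn_integral_cong split: split_indicator)
  also have "\<dots> = (\<integral>\<^sup>+x. ?F x * indicator {-l+s..<l+s} x \<partial>lborel)"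
    by (rule nn_integral_shift[where f = "\<lambda>x. ?F x * indicator {-l+s..<l+s} x"]) measurable
  also have "\<dots> = (\<integral>\<^sup>+x. ?F x * indicator {-l+s..<l} x + ?F x * indicator {l..<l+s} x \<partial>lborel)"
    using s by (intro nn_integral_cong) (auto split: split_indicator)
  also have "\<dots> = (\<integral>\<^sup>+x. ?F x * indicator {-l+s..<l} x \<partial>lborel) + (\<integral>\<^sup>+x. ?F x * indicator {l..<l+s} x \<partial>lborel)"
    by (rule nn_integral_add) measurable
  also have "(\<integral>\<^sup>+x. ?F x * indicator {l..<l+s} x \<partial>lborel) = (\<integral>\<^sup>+x. ?F (x + 2 * l) * indicator {l..<l+s} (x + 2 * l) \<partial>lborel)"
    by (rule nn_integral_shift[where f = "\<lambda>x. ?F x * indicator {l..<l+s} x", symmetric]) measurable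
  also have "\<dots> = (\<integral>\<^sup>+x. ?F x * indicator {-l..<-l+s} x \<partial>lborel)"
    by (intro nn_integral_cong) (auto simp: wrap_add split: split_indicator)
  also have "(\<integral>\<^sup>+x. ?F x * indicator {-l+s..<l} x \<partial>lborel) + (\<integral>\<^sup>+x. ?F x * indicator {-l..<-l+s} x \<partial>lborel)
      = (\<integral>\<^sup>+x. ?F x * indicator {-l+s..<l} x + ?F x * indicator {-l..<-l+s} x \<partial>lborel)"
    by (rule nn_integral_add[symmetric]) measurable
  also have "\<dots> = (\<integral>\<^sup>+x. f x * indicator {-l..<l} x \<partial>lborel)"
    using s by (intro nn_integral_cong) (auto simp: wrap_id split: split_indicator)
  finally show ?thesis by (simp add: nn_integral_side)
qed

lemma distr_wrap_shift:
  assumes s: "0 \<le> s" "s < 2 * l"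
  shows "distr (side l) (side l) (\<lambda>x. wrap l (x + s)) = side l"
proof (rule measure_eqI)
  fix A assume "A \<in> sets (distr (side l) (side l) (\<lambda>x. wrap l (x + s)))"
  then have A [measurable]: "A \<in> sets borel" by simp
  have "emeasure (distr (side l) (side l) (\<lambda>x. wrap l (x + s))) A = (\<integral>\<^sup>+x. indicator A x \<partial>distr (side l) (side l) (\<lambda>x. wrap l (x + s)))"
    by simp
  also have "\<dots> = (\<integral>\<^sup>+x. indicator A (wrap l (x + s)) \<partial>side l)"
    by (rule nn_integral_distr) measurable
  also have "\<dots> = (\<integral>\<^sup>+x. indicator A x \<partial>side l)"
    by (rule nn_integral_wrap_shift[OF s]) measurable
  finally show "emeasure (distr (side l) (side l) (\<lambda>x. wrap l (x + s))) A = emeasure (side l) A" by simp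
qed simp

lemma AE_wrap_shift:
  assumes "0 \<le> s" "s < 2 * l" "AE x in side l. P x"
  shows "AE x in side l. P (wrap l (x + s))"
proof (rule AE_distrD[of _ _ "side l"])
  show "AE x in distr (side l) (side l) (\<lambda>x. wrap l (x + s)). P x"
    unfolding distr_wrap_shift[OF assms(1,2)] by (rule assms(3))
qed measurable

lemma AE_side_iff: "(AE x in side l. P x) \<longleftrightarrow> (AE x in lborel. x \<in> {-l..<l} \<longrightarrow> P x)"
  unfolding side_def by (subst AE_density) (auto simp: indicator_def)

lemma AE_lborel_shift:
  assumes "AE x in lborel. P x"
  shows "AE x in lborel. P (x + s :: real)"
proof -
  have "AE x in distr lborel borel ((+) s). P x" unfolding lborel_distr_plus by (rule assms)
  then have "AE x in lborel. P (s + x)" by (rule AE_distrD[rotated]) simp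
  then show ?thesis by (simp only: add.commute)
qed

text \<open>Two periods contain every point x + h with x in the fundamental interval and 0 < h < 2
  l. On the second period the claim is a translate of that on the first.\<close>

lemma AE_wrap:
  assumes "AE x in side l. P x"
  shows "AE t in lborel. t \<in> {-l..<3 * l} \<longrightarrow> P (wrap l t)"
proof -
  have 1: "AE t in lborel. t \<in> {-l..<l} \<longrightarrow> P t" using assms by (simp add: AE_side_iff)
  from AE_lborel_shift[OF this, of "- 2 * l"]
  have "AE t in lborel. t - 2 * l \<in> {-l..<l} \<longrightarrow> P (t - 2 * l)" by simp
  with 1 show ?thesis
  proof eventually_elim
    case (elim t)
    show ?case
    proof
      assume "t \<in> {-l..<3 * l}"
      then consider "t \<in> {-l..<l}" | "t \<in> {l..<3*l}" by force
      then show "P (wrap l t)"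
      proof cases
        case 1 then show ?thesis using elim(1) by (simp add: wrap_id)
      next
        case 2 then show ?thesis using elim(2) wrap_eq[OF 2] by auto
      qed
    qed
  qed
qed

lemma integral_side:
  fixes f :: "real \<Rightarrow> 'b::euclidean_space"
  assumes "f \<in> borel_measurable borel"
  shows "(LINT x|side l. f x) = (LINT x|lborel. indicator {-l..<l} x *\<^sub>R f x)"
    and "integrable (side l) f \<longleftrightarrow> integrable lborel (\<lambda>x. indicator {-l..<l} x *\<^sub>R f x)"
proof -
  have eq: "side l = density lborel (\<lambda>x. ennreal (indicator {-l..<l} x))" by (simp add: side_def ennreal_indicator)
  show "(LINT x|side l. f x) = (LINT x|lborel. indicator {-l..<l} x *\<^sub>R f x)"
    unfolding eq using assms by (intro integral_density) auto
  show "integrable (side l) f \<longleftrightarrow> integrable lborel (\<lambda>x. indicator {-l..<l} x *\<^sub>R f x)"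
    unfolding eq using assms by (intro integrable_density) auto
qed

text \<open>\<open>U (wrap l (x + t))\<close> is the periodic extension of \<open>U\<close>; the two conjuncts cover the two orders
  in which the wells can follow each other.\<close>

lemma c0_le_slice:
  fixes U V :: "real \<Rightarrow> real^3" and c :: "real^3"
  assumes \<sigma>: "\<sigma> > 0" and h: "0 < h" "h < 2 * l"
    and [measurable]: "U \<in> borel_measurable borel" and V: "integrable (side l) V" and V0: "(LINT s|side l. V s) = 0"
    and UV: "AE x in side l. U x = c + (LINT s|side l. indicator {..x} s *\<^sub>R V s)"
    and U1: "AE x in side l. norm (U x) = 1"
    and M: "\<And>p. norm p = 1 \<Longrightarrow> wt \<sigma> p \<le> M"
  shows "AE x in side l.
    (norm (U x - n_minus \<sigma>) \<le> 1 / 2 \<longrightarrow> norm (U (wrap l (x + h)) - n_plus \<sigma>) \<le> 1 / 2 \<longrightarrow>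
      ennreal (c0_const \<sigma>) \<le> (\<integral>\<^sup>+t. indicator {0..h} t * ennreal (wt \<sigma> (U (wrap l (x + t))) * norm (V (wrap l (x + t)))) \<partial>lborel)
       + ennreal (2 * M * norm (U x - n_minus \<sigma>) + 2 * M * norm (U (wrap l (x + h)) - n_plus \<sigma>)))
  \<and> (norm (U x - n_plus \<sigma>) \<le> 1 / 2 \<longrightarrow> norm (U (wrap l (x + h)) - n_minus \<sigma>) \<le> 1 / 2 \<longrightarrow>
      ennreal (c0_const \<sigma>) \<le> (\<integral>\<^sup>+t. indicator {0..h} t * ennreal (wt \<sigma> (U (wrap l (x + t))) * norm (V (wrap l (x + t)))) \<partial>lborel)
       + ennreal (2 * M * norm (U x - n_plus \<sigma>) + 2 * M * norm (U (wrap l (x + h)) - n_minus \<sigma>)))"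
proof -
  note [measurable] = borel_wt[OF \<sigma>]
  have [measurable]: "V \<in> borel_measurable borel" using V by auto
  \<comment> \<open>\<open>V\<close> is continued periodically over two periods, so that the whole
    segment [x, x + h] lies in the domain even if it crosses the point \<open>l\<close>.\<close>
  define w where "w t = indicator {-l..<3*l} t *\<^sub>R V (wrap l t)" for t
  have iVl: "integrable lborel (\<lambda>t. indicator {-l..<l} t *\<^sub>R V t)"
    using V by (simp add: integral_side)
  have iV2: "integrable lborel (\<lambda>t. indicator {l..<3*l} t *\<^sub>R V (t - 2*l))"
  proof -
    have "integrable lborel (\<lambda>t. indicator {-l..<l} (-2 * l + 1 * t) *\<^sub>R V (-2 * l + 1 * t))"
      by (rule lborel_integrable_real_affine[OF iVl]) simp
    also have "(\<lambda>t. indicator {-l..<l} (-2 * l + 1 * t) *\<^sub>R V (-2 * l + 1 * t)) = (\<lambda>t. indicator {l..<3*l} t *\<^sub>R V (t - 2*l))"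
      by (auto simp: fun_eq_iff split: split_indicator)
    finally show ?thesis .
  qed
  have w_split: "w t = indicator {-l..<l} t *\<^sub>R V t + indicator {l..<3*l} t *\<^sub>R V (t - 2*l)" for t
    unfolding w_def using l wrap_id[of t] wrap_eq[of t] by (auto split: split_indicator)
  have iw: "integrable lborel w"
    unfolding w_split using iVl iV2 by (rule Bochner_Integration.integrable_add)
  have iA: "integrable lborel (\<lambda>s. indicator A s *\<^sub>R w s)" if "A \<in> sets borel" for A
    by (rule integrable_indicator_scaleR[OF iw that])
  define \<Phi> where "\<Phi> t = c + (LINT s|lborel. indicator {-l..t} s *\<^sub>R w s)" for t
  have \<Phi>1: "\<Phi> t = c + (LINT s|side l. indicator {..t} s *\<^sub>R V s)" if "t \<in> {-l..<l}" for t
    using that unfolding \<Phi>_def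
    by (subst integral_side) (auto intro!: Bochner_Integration.integral_cong arg_cong2[where f = plus] simp: w_split split: split_indicator)
  \<comment> \<open>The primitive gains nothing over the first period because \<open>V\<close> has
    mean 0; hence it is itself periodic.\<close>
  have \<Phi>_per: "\<Phi> t = \<Phi> (t - 2 * l)" if "t \<in> {l..<3*l}" for t
  proof -
    have "(LINT s|lborel. indicator {-l..t} s *\<^sub>R w s)
      = (LINT s|lborel. indicator {-l..<l} s *\<^sub>R V s + indicator {l..t} s *\<^sub>R V (s - 2*l))"
      using that l by (intro Bochner_Integration.integral_cong) (auto simp: w_split split: split_indicator)
    also have "\<dots> = (LINT s|lborel. indicator {-l..<l} s *\<^sub>R V s) + (LINT s|lborel. indicator {l..t} s *\<^sub>R V (s - 2*l))"
    proof (rule Bochner_Integration.integral_add[OF iVl])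
      have "integrable lborel (\<lambda>s. indicator {l..t} s *\<^sub>R (indicator {l..<3*l} s *\<^sub>R V (s - 2*l)))"
        by (rule integrable_indicator_scaleR[OF iV2]) simp
      also have "(\<lambda>s. indicator {l..t} s *\<^sub>R (indicator {l..<3*l} s *\<^sub>R V (s - 2*l))) = (\<lambda>s. indicator {l..t} s *\<^sub>R V (s - 2*l))"
        using that by (auto simp: fun_eq_iff split: split_indicator)
      finally show "integrable lborel (\<lambda>s. indicator {l..t} s *\<^sub>R V (s - 2*l))" .
    qed
    also have "(LINT s|lborel. indicator {-l..<l} s *\<^sub>R V s) = 0" using V0 by (simp add: integral_side)
    also have "(LINT s|lborel. indicator {l..t} s *\<^sub>R V (s - 2*l)) = (LINT s|lborel. indicator {-l..t - 2*l} s *\<^sub>R w s)"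
      by (subst lborel_integral_real_affine[where c = 1 and t = "2*l"])
        (use that in \<open>auto intro!: Bochner_Integration.integral_cong simp: w_split split: split_indicator\<close>)
    finally show ?thesis by (simp add: \<Phi>_def)
  qed
  have \<Phi>_wrap: "\<Phi> t = \<Phi> (wrap l t)" if "t \<in> {-l..<3*l}" for t
  proof (cases "t < l")
    case True
    then show ?thesis using that by (simp add: wrap_id)
  next
    case False
    then show ?thesis using that \<Phi>_per[of t] wrap_eq[of t] by simp
  qed
  have AE1: "AE x in side l. \<Phi> x = U x \<and> norm (U x) = 1"
    using UV U1 AE_in_side by eventually_elim (simp add: \<Phi>1)
  then have AE2: "AE t in lborel. t \<in> {-l..<3*l} \<longrightarrow> \<Phi> (wrap l t) = U (wrap l t) \<and> norm (U (wrap l t)) = 1"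
    by (rule AE_wrap)
  then have AE3: "AE t in lborel. t \<in> {-l..<3*l} \<longrightarrow> \<Phi> t = U (wrap l t) \<and> norm (\<Phi> t) = 1"
    by eventually_elim (use \<Phi>_wrap in auto)
  have cont\<Phi>: "continuous_on {-l..3*l} \<Phi>"
  proof -
    have wi: "w integrable_on {-l..3*l}"
      using set_borel_integral_eq_integral(1)[of "{-l..3*l}" w] iA[of "{-l..3*l}"] by (simp add: set_integrable_def)
    have "(LINT s|lborel. indicator {-l..t} s *\<^sub>R w s) = integral {-l..t} w" for t
      using set_borel_integral_eq_integral(2)[of "{-l..t}" w] iA[of "{-l..t}"]
      by (simp add: set_integrable_def set_lebesgue_integral_def)
    then show ?thesis unfolding \<Phi>_def
      by (simp only:) (intro continuous_intros indefinite_integral_continuous_1 wi)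
  qed
  \<comment> \<open>The norm is 1 almost everywhere and \<open>\<Phi>\<close> is continuous: the
    exceptional set inside the interval is open and null, hence empty. The end point -l is reached
    through periodicity from \<open>l\<close>.\<close>
  have \<Phi>n: "norm (\<Phi> t) = 1" if "t \<in> {-l..<3*l}" for t
  proof -
    have inner: "norm (\<Phi> t) = 1" if t: "t \<in> {-l<..<3*l}" for t
    proof (rule ccontr)
      assume nt: "norm (\<Phi> t) \<noteq> 1"
      define S where "S = {-l<..<3*l} \<inter> (\<lambda>t. norm (\<Phi> t)) -` (- {1})"
      have "continuous_on {-l<..<3*l} (\<lambda>t. norm (\<Phi> t))"
        using cont\<Phi> by (intro continuous_intros) (auto intro: continuous_on_subset)
      then have S: "open S" unfolding S_def
        by (rule continuous_open_preimage) auto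
      then have "\<not> negligible S" using t nt by (intro open_not_negligible) (auto simp: S_def)
      moreover have "AE t in lborel. t \<notin> S"
        using AE3 by eventually_elim (auto simp: S_def)
      then have "S \<in> null_sets lborel"
        using S by (subst (asm) AE_iff_null_sets[symmetric]) auto
      then have "negligible S" by (simp add: negligible_iff_null_sets null_sets_completionI)
      ultimately show False by simp
    qed
    show ?thesis
    proof (cases "t = - l")
      case True
      then show ?thesis using \<Phi>_per[of l] inner[of l] l by simp
    next
      case False
      then show ?thesis using inner[of t] that by simp
    qed
  qed
  have tail: "\<Phi> x + (LINT s|lborel. indicator {x..t} s *\<^sub>R w s) = \<Phi> t" if "-l \<le> x" "x \<le> t" for x t
  proof -
    have "(LINT s|lborel. indicator {-l..t} s *\<^sub>R w s) = (LINT s|lborel. indicator {-l..x} s *\<^sub>R w s + indicator {x..t} s *\<^sub>R w s)"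
    proof (rule integral_cong_AE)
      have [measurable]: "w \<in> borel_measurable borel" unfolding w_def by measurable
      show "(\<lambda>s. indicator {-l..t} s *\<^sub>R w s) \<in> borel_measurable lborel"
        "(\<lambda>s. indicator {-l..x} s *\<^sub>R w s + indicator {x..t} s *\<^sub>R w s) \<in> borel_measurable lborel"
        by measurable
      show "AE s in lborel. indicator {-l..t} s *\<^sub>R w s = indicator {-l..x} s *\<^sub>R w s + indicator {x..t} s *\<^sub>R w s"
        using AE_lborel_singleton[of x] by eventually_elim (use that in \<open>auto split: split_indicator\<close>)
    qed
    then show ?thesis by (simp add: \<Phi>_def iA)
  qed
  have fin: "AE x in side l. \<Phi> x = U x \<and> \<Phi> (x + h) = U (wrap l (x + h)) \<and> x \<in> {-l..<l}"
  proof -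
    have "AE x in side l. \<Phi> (wrap l (x + h)) = U (wrap l (x + h))"
      using AE1 h by (intro AE_wrap_shift[where P = "\<lambda>x. \<Phi> x = U x"]) (auto elim: eventually_mono)
    with AE1 AE_in_side[of l] show ?thesis
    proof eventually_elim
      case (elim x)
      then show ?case using \<Phi>_wrap[of "x + h"] h by auto
    qed
  qed
  have nn: "ennreal (LINT t|lborel. indicator {x..x+h} t * (wt \<sigma> (\<Phi> t) * norm (w t)))
     = (\<integral>\<^sup>+t. indicator {0..h} t * ennreal (wt \<sigma> (U (wrap l (x + t))) * norm (V (wrap l (x + t)))) \<partial>lborel)"
    if x: "x \<in> {-l..<l}" for x
  proof -
    have "AE t in lborel. t \<in> {x..x+h} \<longrightarrow> \<Phi> t = U (wrap l t) \<and> norm (\<Phi> t) = 1 \<and> w t = V (wrap l t)"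
      using AE3 by eventually_elim (use x h in \<open>auto simp: w_def\<close>)
    have [measurable]: "\<Phi> \<in> borel_measurable borel"
      unfolding \<Phi>_def indicator_def atLeastAtMost_iff w_def by measurable
    have [measurable]: "w \<in> borel_measurable borel" unfolding w_def by measurable
    have "ennreal (LINT t|lborel. indicator {x..x+h} t * (wt \<sigma> (\<Phi> t) * norm (w t)))
      = (\<integral>\<^sup>+t. ennreal (indicator {x..x+h} t * (wt \<sigma> (\<Phi> t) * norm (w t))) \<partial>lborel)"
    proof (rule nn_integral_eq_integral[symmetric])
      have "integrable lborel (\<lambda>t. M * norm (w t))" using iw by auto
      then show "integrable lborel (\<lambda>t. indicator {x..x+h} t * (wt \<sigma> (\<Phi> t) * norm (w t)))"
      proof (rule Bochner_Integration.integrable_bound)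
        show "AE t in lborel. norm (indicator {x..x+h} t * (wt \<sigma> (\<Phi> t) * norm (w t))) \<le> norm (M * norm (w t))"
        proof (rule AE_I2)
          fix t
          show "norm (indicator {x..x+h} t * (wt \<sigma> (\<Phi> t) * norm (w t))) \<le> norm (M * norm (w t))"
          proof (cases "t \<in> {x..x+h}")
            case True
            then have "wt \<sigma> (\<Phi> t) \<le> M" using x h by (intro M \<Phi>n) auto
            then show ?thesis using True wt_nonneg[OF \<sigma>, of "\<Phi> t"] by (simp add: abs_mult mult_right_mono)
          qed simp
        qed
      qed measurable
    qed (use wt_nonneg[OF \<sigma>] in auto)
    also have "\<dots> = (\<integral>\<^sup>+t. indicator {x..x+h} t * ennreal (wt \<sigma> (U (wrap l t)) * norm (V (wrap l t))) \<partial>lborel)"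
      using AE3
      by (intro nn_integral_cong_AE) (auto elim!: eventually_mono simp: w_def split: split_indicator, use x h in auto)
    also have "\<dots> = (\<integral>\<^sup>+t. indicator {x..x+h} (t + x) * ennreal (wt \<sigma> (U (wrap l (t + x))) * norm (V (wrap l (t + x)))) \<partial>lborel)"
      by (rule nn_integral_shift[where f = "\<lambda>t. indicator {x..x+h} t * ennreal (wt \<sigma> (U (wrap l t)) * norm (V (wrap l t)))", symmetric]) measurable
    also have "\<dots> = (\<integral>\<^sup>+t. indicator {0..h} t * ennreal (wt \<sigma> (U (wrap l (x + t))) * norm (V (wrap l (x + t)))) \<partial>lborel)"
      by (intro nn_integral_cong) (auto simp: add.commute split: split_indicator)
    finally show ?thesis .
  qed
  have M0: "M \<ge> 0" using M[OF norm_n_minus[OF \<sigma>]] wt_nonneg[OF \<sigma>, of "n_minus \<sigma>"] by simp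
  show ?thesis using fin
  proof eventually_elim
    case (elim x)
    have \<Phi>x: "\<Phi> x + (LINT s|lborel. indicator {x..t} s *\<^sub>R w s) = \<Phi> t" if "t \<in> {x..x+h}" for t
      using tail[of x t] elim that by auto
    have xx: "x \<in> {x..x+h}" "x + h \<in> {x..x+h}" using h by auto
    have n1: "norm (\<Phi> x + (LINT s|lborel. indicator {x..t} s *\<^sub>R w s)) = 1" if "t \<in> {x..x+h}" for t
      unfolding \<Phi>x[OF that] using that elim h by (intro \<Phi>n) auto
    have i: "(LINT t|lborel. indicator {x..x+h} t * (wt \<sigma> (\<Phi> x + (LINT s|lborel. indicator {x..t} s *\<^sub>R w s)) * norm (w t)))
        = (LINT t|lborel. indicator {x..x+h} t * (wt \<sigma> (\<Phi> t) * norm (w t)))"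
    proof (intro Bochner_Integration.integral_cong refl)
      fix t
      show "indicator {x..x+h} t * (wt \<sigma> (\<Phi> x + (LINT s|lborel. indicator {x..t} s *\<^sub>R w s)) * norm (w t))
        = indicator {x..x+h} t * (wt \<sigma> (\<Phi> t) * norm (w t))"
      proof (cases "t \<in> {x..x+h}")
        case True
        then show ?thesis by (simp only: \<Phi>x)
      next
        case False
        then have "indicator {x..x+h} t = (0::real)" by simp
        then show ?thesis by (simp only: mult_zero_left)
      qed
    qed
    have e: "\<Phi> x = U x" "\<Phi> (x + h) = U (wrap l (x + h))" using elim by auto
    have ee: "ennreal c0 \<le> (\<integral>\<^sup>+t. indicator {0..h} t * ennreal (wt \<sigma> (U (wrap l (x + t))) * norm (V (wrap l (x + t)))) \<partial>lborel) + ennreal (A + B)"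
      if "c0 \<le> (LINT t|lborel. indicator {x..x+h} t * (wt \<sigma> (\<Phi> t) * norm (w t))) + A + B" "A \<ge> 0" "B \<ge> 0" for A B c0
    proof -
      have "ennreal c0 \<le> ennreal ((LINT t|lborel. indicator {x..x+h} t * (wt \<sigma> (\<Phi> t) * norm (w t))) + (A + B))"
        using that by (intro ennreal_leI) simp
      also have "\<dots> = ennreal (LINT t|lborel. indicator {x..x+h} t * (wt \<sigma> (\<Phi> t) * norm (w t))) + ennreal (A + B)"
        using that wt_nonneg[OF \<sigma>] by (intro ennreal_plus Bochner_Integration.integral_nonneg) auto
      finally show ?thesis using nn elim by simp
    qed
    have xh: "x < x + h" using h by simp
    show ?case
    proof (intro conjI impI)
      assume "norm (U x - n_minus \<sigma>) \<le> 1 / 2" "norm (U (wrap l (x + h)) - n_plus \<sigma>) \<le> 1 / 2"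
      then show "ennreal (c0_const \<sigma>) \<le> (\<integral>\<^sup>+t. indicator {0..h} t * ennreal (wt \<sigma> (U (wrap l (x + t))) * norm (V (wrap l (x + t)))) \<partial>lborel)
       + ennreal (2 * M * norm (U x - n_minus \<sigma>) + 2 * M * norm (U (wrap l (x + h)) - n_plus \<sigma>))"
        using c0_le_AC[OF \<sigma> xh iw n1 _ _ M, unfolded i, unfolded \<Phi>x[OF xx(1)] \<Phi>x[OF xx(2)], unfolded e] M0 by (intro ee) auto
    next
      assume "norm (U x - n_plus \<sigma>) \<le> 1 / 2" "norm (U (wrap l (x + h)) - n_minus \<sigma>) \<le> 1 / 2"
      then show "ennreal (c0_const \<sigma>) \<le> (\<integral>\<^sup>+t. indicator {0..h} t * ennreal (wt \<sigma> (U (wrap l (x + t))) * norm (V (wrap l (x + t)))) \<partial>lborel)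
       + ennreal (2 * M * norm (U x - n_plus \<sigma>) + 2 * M * norm (U (wrap l (x + h)) - n_minus \<sigma>))"
        using c0_le_AC_rev[OF \<sigma> xh iw n1 _ _ M, unfolded i, unfolded \<Phi>x[OF xx(1)] \<Phi>x[OF xx(2)], unfolded e] M0 by (intro ee) auto
    qed
  qed
qed

end

section \<open>Translations of the torus in the x direction\<close>

definition shift_x :: "real \<Rightarrow> real \<Rightarrow> real \<times> real \<Rightarrow> real \<times> real" where
  "shift_x l h p = (wrap l (fst p + h), snd p)"

lemma shift_x_measurable [measurable]: "shift_x l h \<in> borel \<Otimes>\<^sub>M borel \<rightarrow>\<^sub>M borel \<Otimes>\<^sub>M borel"
  unfolding shift_x_def by measurable

context
  fixes l h :: real
  assumes l: "l > 0" and h: "0 \<le> h" "h < 2 * l"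
begin

lemma nn_integral_torus_shift:
  assumes [measurable]: "f \<in> borel_measurable (borel \<Otimes>\<^sub>M borel)"
  shows "(\<integral>\<^sup>+p. f (shift_x l h p) \<partial>torus_prod l) = (\<integral>\<^sup>+p. f p \<partial>torus_prod l)"
proof -
  interpret pair_sigma_finite "side l" "side l" by (rule pair_sigma_finite_side)
  have "(\<integral>\<^sup>+p. f (shift_x l h p) \<partial>torus_prod l) = (\<integral>\<^sup>+y. \<integral>\<^sup>+x. f (wrap l (x + h), y) \<partial>side l \<partial>side l)"
    by (subst nn_integral_snd[symmetric]) (simp_all add: shift_x_def)
  also have "\<dots> = (\<integral>\<^sup>+y. \<integral>\<^sup>+x. f (x, y) \<partial>side l \<partial>side l)"
    by (intro nn_integral_cong nn_integral_wrap_shift[OF l h, where f = "\<lambda>x. f (x, _)"]) measurable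
  also have "\<dots> = (\<integral>\<^sup>+p. f p \<partial>torus_prod l)"
    by (subst nn_integral_snd[symmetric]) simp_all
  finally show ?thesis .
qed

lemma distr_torus_shift: "distr (torus_prod l) (torus_prod l) (shift_x l h) = torus_prod l"
proof (rule measure_eqI)
  fix A assume "A \<in> sets (distr (torus_prod l) (torus_prod l) (shift_x l h))"
  then have A [measurable]: "A \<in> sets (borel \<Otimes>\<^sub>M borel)" by simp
  have "emeasure (distr (torus_prod l) (torus_prod l) (shift_x l h)) A = (\<integral>\<^sup>+x. indicator A x \<partial>distr (torus_prod l) (torus_prod l) (shift_x l h))"
    by simp
  also have "\<dots> = (\<integral>\<^sup>+x. indicator A (shift_x l h x) \<partial>torus_prod l)"
    by (rule nn_integral_distr) measurable
  also have "\<dots> = (\<integral>\<^sup>+x. indicator A x \<partial>torus_prod l)"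
    by (rule nn_integral_torus_shift) measurable
  finally show "emeasure (distr (torus_prod l) (torus_prod l) (shift_x l h)) A = emeasure (torus_prod l) A" by simp
qed simp

lemma AE_torus_shift:
  assumes "AE p in torus_prod l. P p"
  shows "AE p in torus_prod l. P (shift_x l h p)"
proof (rule AE_distrD[of _ _ "torus_prod l"])
  show "AE x in distr (torus_prod l) (torus_prod l) (shift_x l h). P x"
    unfolding distr_torus_shift by (rule assms)
qed measurable

lemma integral_torus_shift:
  fixes f :: "real \<times> real \<Rightarrow> 'b::euclidean_space"
  assumes [measurable]: "f \<in> borel_measurable (borel \<Otimes>\<^sub>M borel)"
  shows "(LINT p|torus_prod l. f (shift_x l h p)) = (LINT p|torus_prod l. f p)"
    and "integrable (torus_prod l) f \<Longrightarrow> integrable (torus_prod l) (\<lambda>p. f (shift_x l h p))"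
proof -
  have "(LINT p|torus_prod l. f p) = (LINT p|distr (torus_prod l) (torus_prod l) (shift_x l h). f p)"
    by (simp only: distr_torus_shift)
  also have "\<dots> = (LINT p|torus_prod l. f (shift_x l h p))" by (rule integral_distr) measurable
  finally show "(LINT p|torus_prod l. f (shift_x l h p)) = (LINT p|torus_prod l. f p)" by simp
  assume "integrable (torus_prod l) f"
  then have "integrable (distr (torus_prod l) (torus_prod l) (shift_x l h)) f"
    by (simp only: distr_torus_shift)
  then show "integrable (torus_prod l) (\<lambda>p. f (shift_x l h p))" by (rule integrable_distr[rotated]) measurable
qed

end

section \<open>Slices of weakly differentiable fields and the measure of the jump set\<close>

lemma AE_torus_of_slices:
  assumes "Measurable.pred (borel \<Otimes>\<^sub>M borel) Q" "AE y in side l. AE x in side l. Q (x, y)"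
  shows "AE p in torus_prod l. Q p"
proof -
  interpret pair_sigma_finite "side l" "side l" by (rule pair_sigma_finite_side)
  have m: "{p \<in> space (torus_prod l). Q (fst p, snd p)} \<in> sets (torus_prod l)"
    using assms(1) by (simp add: pred_def space_pair_measure)
  have "AE x in side l. AE y in side l. Q (x, y)"
    using AE_commute[of "\<lambda>x y. Q (x, y)"] m assms(2) by simp
  then show ?thesis
    using AE_pair_iff[of "\<lambda>x y. Q (x, y)"] m by simp
qed

text \<open>Integration by parts against \<open>trig l a b (c + pi / 2)\<close>, whose \<open>x\<close>-derivative is
  \<open>- (a * pi / l) * trig l a b c\<close>.\<close>

definition weak_x :: "real \<Rightarrow> (real \<times> real \<Rightarrow> 'b::euclidean_space) \<Rightarrow> (real \<times> real \<Rightarrow> 'b) \<Rightarrow> bool" where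
  "weak_x l u v \<longleftrightarrow> integrable (torus_prod l) u \<and> integrable (torus_prod l) v \<and>
    (\<forall>a b c. (of_int a * pi / l) *\<^sub>R (LINT p|torus_prod l. trig l a b c p *\<^sub>R u p)
      = (LINT p|torus_prod l. trig l a b (c + pi / 2) p *\<^sub>R v p))"

lemma weak_x_linear:
  fixes f :: "'b::euclidean_space \<Rightarrow> 'c::euclidean_space"
  assumes "bounded_linear f" "weak_x l u v"
  shows "weak_x l (\<lambda>p. f (u p)) (\<lambda>p. f (v p))"
proof -
  interpret bounded_linear f by fact
  have i: "integrable (torus_prod l) (\<lambda>p. trig l a b c p *\<^sub>R w p)" if "integrable (torus_prod l) w" for a b c and w :: "real \<times> real \<Rightarrow> 'b"
    by (rule integrable_bounded_scaleR[OF that trig_measurable trig_bound])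
  have e: "(LINT p|torus_prod l. trig l a b c p *\<^sub>R f (w p)) = f (LINT p|torus_prod l. trig l a b c p *\<^sub>R w p)"
    if "integrable (torus_prod l) w" for a b c w
    using integral_bounded_linear[OF assms(1) i[OF that], of a b c] by (simp add: scale)
  have uv: "integrable (torus_prod l) u" "integrable (torus_prod l) v"
    "\<And>a b c. (of_int a * pi / l) *\<^sub>R (LINT p|torus_prod l. trig l a b c p *\<^sub>R u p)
      = (LINT p|torus_prod l. trig l a b (c + pi / 2) p *\<^sub>R v p)"
    using assms(2) unfolding weak_x_def by blast+
  show ?thesis unfolding weak_x_def
  proof (intro conjI allI)
    show "(of_int a * pi / l) *\<^sub>R (LINT p|torus_prod l. trig l a b c p *\<^sub>R f (u p))
      = (LINT p|torus_prod l. trig l a b (c + pi / 2) p *\<^sub>R f (v p))" for a b c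
      unfolding e[OF uv(1)] e[OF uv(2)] uv(3)[symmetric] by (rule scale[symmetric])
  qed (intro integrable_bounded_linear[OF assms(1)] uv)+
qed

text \<open>The scalar results are applied to each component; as there are only finitely many, one
  null set of lines serves all of them. Vanishing line means are recorded because they make the
  slices periodic.\<close>

lemma weak_x_slices:
  fixes U V :: "real \<times> real \<Rightarrow> real^3"
  assumes l: "l > 0" and w: "weak_x l U V"
  shows "\<exists>c. AE y in side l. integrable (side l) (\<lambda>s. V (s, y)) \<and> (LINT s|side l. V (s, y)) = 0 \<and>
    (AE x in side l. U (x, y) = c y + (LINT s|side l. indicator {..x} s *\<^sub>R V (s, y)))"
proof -
  interpret pair_sigma_finite "side l" "side l" by (rule pair_sigma_finite_side)
  have V: "integrable (torus_prod l) V" using w by (simp add: weak_x_def)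
  have "weak_x l (\<lambda>p. U p $ i) (\<lambda>p. V p $ i)" for i
    by (rule weak_x_linear[OF bounded_linear_vec_nth w])
  then have wi: "integrable (torus_prod l) (\<lambda>p. U p $ i)" "integrable (torus_prod l) (\<lambda>p. V p $ i)"
    "\<And>a b c. (of_int a * pi / l) * (LINT p|torus_prod l. trig l a b c p * (U p $ i))
      = (LINT p|torus_prod l. trig l a b (c + pi / 2) p * (V p $ i))" for i
    unfolding weak_x_def real_scaleR_def by blast+
  have "\<exists>C. AE p in torus_prod l. U p $ i = C (snd p) + (LINT s|side l. indicator {..fst p} s * V (s, snd p) $ i)" for i
    using weak_deriv_x_primitive[OF l wi] by blast
  then have "\<forall>i. \<exists>C. AE p in torus_prod l. U p $ i = C (snd p) + (LINT s|side l. indicator {..fst p} s * V (s, snd p) $ i)"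
    by (rule allI)
  from choice[OF this] obtain C where
    C: "\<forall>i. AE p in torus_prod l. U p $ i = C i (snd p) + (LINT s|side l. indicator {..fst p} s * V (s, snd p) $ i)" ..
  have 0: "AE y in side l. (LINT s|side l. V (s, y) $ i) = 0" for i
    by (rule weak_deriv_x_mean_zero[OF l wi])
  have int: "AE y in side l. integrable (side l) (\<lambda>s. V (s, y))"
    using AE_integrable_snd[of "\<lambda>x y. V (x, y)"] V by (simp only: case_prod_eta)
  have "AE y in side l. \<forall>i. AE x in side l. U (x, y) $ i = C i y + (LINT s|side l. indicator {..x} s * V (s, y) $ i)"
    unfolding AE_all_countable using AE_torus_slices[OF C[THEN spec]] unfolding fst_conv snd_conv by blast
  moreover have "AE y in side l. \<forall>i. (LINT s|side l. V (s, y) $ i) = 0"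
    unfolding AE_all_countable using 0 by blast
  ultimately have "AE y in side l. integrable (side l) (\<lambda>s. V (s, y)) \<and> (LINT s|side l. V (s, y)) = 0 \<and>
    (AE x in side l. U (x, y) = (\<chi> i. C i y) + (LINT s|side l. indicator {..x} s *\<^sub>R V (s, y)))"
    using int
  proof eventually_elim
    case (elim y)
    have nth: "(LINT s|side l. f s) $ i = (LINT s|side l. f s $ i)" if "integrable (side l) f" for f :: "real \<Rightarrow> real^3" and i
      using integral_bounded_linear[OF bounded_linear_vec_nth that, of i] by simp
    have iA: "integrable (side l) (\<lambda>s. indicator {..x} s *\<^sub>R V (s, y))" for x
      using integrable_mult_indicator[OF _ elim(3), of "{..x}"] by simp
    have "AE x in side l. \<forall>i. U (x, y) $ i = C i y + (LINT s|side l. indicator {..x} s * V (s, y) $ i)"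
      unfolding AE_all_countable using elim(1) by blast
    then have "AE x in side l. U (x, y) = (\<chi> i. C i y) + (LINT s|side l. indicator {..x} s *\<^sub>R V (s, y))"
      by eventually_elim (simp add: vec_eq_iff nth iA)
    then show ?case using elim nth[OF elim(3)] by (simp add: vec_eq_iff)
  qed
  then show ?thesis by (rule exI[of _ "\<lambda>y. \<chi> i. C i y"])
qed

text \<open>As soon as \<open>e j < d\<close> the error may be replaced by the constant
  \<open>d\<close> and moved to the left side before the lower limit is taken; \<open>d\<close> is
  arbitrary.\<close>

lemma ennreal_le_liminfI:
  fixes c :: real and G :: "nat \<Rightarrow> ennreal" and e :: "nat \<Rightarrow> real"
  assumes "eventually (\<lambda>j. ennreal c \<le> G j + ennreal (e j)) sequentially" "e \<longlonglongrightarrow> 0"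
  shows "ennreal c \<le> liminf G"
proof (rule ennreal_le_epsilon)
  fix d :: real assume d: "d > 0"
  have "eventually (\<lambda>j. e j < d) sequentially" using assms(2) d by (intro order_tendstoD) auto
  with assms(1) have "eventually (\<lambda>j. ennreal c - ennreal d \<le> G j) sequentially"
  proof eventually_elim
    case (elim j)
    have "G j + ennreal (e j) \<le> G j + ennreal d" using elim(2) by (intro add_left_mono ennreal_leI) simp
    with elim(1) have "ennreal c \<le> G j + ennreal d" by (rule order_trans)
    then show ?case by (simp add: ennreal_minus_le_iff add.commute)
  qed
  then have "ennreal c - ennreal d \<le> liminf G" by (rule Liminf_bounded)
  then show "ennreal c \<le> liminf G + ennreal d" by (simp add: ennreal_minus_le_iff add.commute)
qed

text \<open>Averaging over all starting points turns estimates on single segments into one on the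
  torus. Translation invariance makes the integral of \<open>G j\<close> equal to \<open>h\<close>
  times that of \<open>f j\<close>, while at almost every point of the jump set the lower limit of
  \<open>G j\<close> is at least \<open>c0_const \<sigma>\<close>.\<close>

lemma jump_measure_le:
  fixes U V :: "nat \<Rightarrow> real \<times> real \<Rightarrow> real^3" and N :: "real \<times> real \<Rightarrow> real^3" and B :: ennreal
  assumes \<sigma>: "\<sigma> > 0" and l: "l > 0" and h: "0 < h" "h < 2 * l"
    and w: "\<And>j. weak_x l (U j) (V j)"
    and U1: "\<And>j. AE p in torus_prod l. norm (U j p) = 1"
    and Nm: "N \<in> borel_measurable (torus_prod l)"
    and N: "AE p in torus_prod l. N p \<in> {n_plus \<sigma>, n_minus \<sigma>}"
    and conv: "AE p in torus_prod l. (\<lambda>j. U j p) \<longlonglongrightarrow> N p"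
    and le: "\<And>j. (\<integral>\<^sup>+p. ennreal (wt \<sigma> (U j p) * norm (V j p)) \<partial>torus_prod l) \<le> b j"
    and b: "b \<longlonglongrightarrow> B"
  shows "ennreal (c0_const \<sigma>) * emeasure (torus_prod l) {p. N p \<noteq> N (shift_x l h p)} \<le> ennreal h * B"
proof -
  note [measurable] = borel_wt[OF \<sigma>]
  have Um [measurable]: "U j \<in> borel_measurable (borel \<Otimes>\<^sub>M borel)" for j
    using w[of j] borel_measurable_integrable[of "torus_prod l" "U j"] by (simp add: weak_x_def)
  have Vm [measurable]: "V j \<in> borel_measurable (borel \<Otimes>\<^sub>M borel)" for j
    using w[of j] borel_measurable_integrable[of "torus_prod l" "V j"] by (simp add: weak_x_def)
  have Nm' [measurable]: "N \<in> borel_measurable (borel \<Otimes>\<^sub>M borel)" using Nm by simp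
  obtain M where M: "M > 0" "\<And>p. norm p = 1 \<Longrightarrow> wt \<sigma> p \<le> M" using wt_bounded[OF \<sigma>] by auto
  have hh: "0 \<le> h" using h by simp
  define f where "f j p = ennreal (wt \<sigma> (U j p) * norm (V j p))" for j p
  have fm [measurable]: "f j \<in> borel_measurable (borel \<Otimes>\<^sub>M borel)" for j unfolding f_def by measurable
  \<comment> \<open>The weighted length, measured by the x-derivative, of \<open>U j\<close> over
    the horizontal segment of length \<open>h\<close> starting at \<open>p\<close>.\<close>
  define G where "G j p = (\<integral>\<^sup>+t. indicator {0..h} t * f j (shift_x l t p) \<partial>lborel)" for j p
  have Gm [measurable]: "G j \<in> borel_measurable (borel \<Otimes>\<^sub>M borel)" for j
    unfolding G_def shift_x_def by measurable
  define Q where "Q j p \<longleftrightarrow>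
    (norm (U j p - n_minus \<sigma>) \<le> 1 / 2 \<longrightarrow> norm (U j (shift_x l h p) - n_plus \<sigma>) \<le> 1 / 2 \<longrightarrow>
      ennreal (c0_const \<sigma>) \<le> G j p + ennreal (2 * M * norm (U j p - n_minus \<sigma>) + 2 * M * norm (U j (shift_x l h p) - n_plus \<sigma>))) \<and>
    (norm (U j p - n_plus \<sigma>) \<le> 1 / 2 \<longrightarrow> norm (U j (shift_x l h p) - n_minus \<sigma>) \<le> 1 / 2 \<longrightarrow>
      ennreal (c0_const \<sigma>) \<le> G j p + ennreal (2 * M * norm (U j p - n_plus \<sigma>) + 2 * M * norm (U j (shift_x l h p) - n_minus \<sigma>)))" for j p
  have Q: "AE p in torus_prod l. Q j p" for j
  proof (rule AE_torus_of_slices)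
    show "Measurable.pred (borel \<Otimes>\<^sub>M borel) (Q j)" unfolding Q_def by measurable
    obtain c where c: "AE y in side l. integrable (side l) (\<lambda>s. V j (s, y)) \<and> (LINT s|side l. V j (s, y)) = 0 \<and>
      (AE x in side l. U j (x, y) = c y + (LINT s|side l. indicator {..x} s *\<^sub>R V j (s, y)))"
      using weak_x_slices[OF l w[of j]] by auto
    show "AE y in side l. AE x in side l. Q j (x, y)"
      using c AE_torus_slices[OF U1[of j]]
    proof eventually_elim
      case (elim y)
      have "(\<lambda>x. U j (x, y)) \<in> borel_measurable borel" by measurable
      from c0_le_slice[OF l \<sigma> h this, of "\<lambda>s. V j (s, y)" "c y" M] elim M(2)
      show ?case unfolding Q_def G_def f_def shift_x_def fst_conv snd_conv by blast
    qed
  qed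
  define D where "D = {p. N p \<noteq> N (shift_x l h p)}"
  have D: "D \<in> sets (torus_prod l)"
  proof -
    have "{p \<in> space (borel \<Otimes>\<^sub>M borel). N p \<noteq> N (shift_x l h p)} \<in> sets (borel \<Otimes>\<^sub>M borel)" by measurable
    then show ?thesis by (simp add: D_def space_pair_measure)
  qed
  have "AE p in torus_prod l. \<forall>j. Q j p" using Q by (simp add: AE_all_countable)
  then have low: "AE p in torus_prod l. ennreal (c0_const \<sigma>) * indicator D p \<le> liminf (\<lambda>j. G j p)"
    using conv N AE_torus_shift[OF l hh h(2) conv] AE_torus_shift[OF l hh h(2) N]
  proof eventually_elim
    case (elim p)
    show ?case
    proof (cases "p \<in> D")
      case True
      have tend: "(\<lambda>j. 2 * M * norm (U j p - N p) + 2 * M * norm (U j (shift_x l h p) - N (shift_x l h p))) \<longlonglongrightarrow> 0"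
      proof -
        have "(\<lambda>j. 2 * M * norm (U j p - N p) + 2 * M * norm (U j (shift_x l h p) - N (shift_x l h p))) \<longlonglongrightarrow> 2 * M * norm (N p - N p) + 2 * M * norm (N (shift_x l h p) - N (shift_x l h p))"
          using elim by (intro tendsto_intros)
        then show ?thesis by simp
      qed
      \<comment> \<open>From some index on both end values are within 1/2 of their wells, the range
        in which \<open>Q\<close> yields its inequality.\<close>
      have "eventually (\<lambda>j. norm (U j p - N p) < 1 / 2) sequentially" "eventually (\<lambda>j. norm (U j (shift_x l h p) - N (shift_x l h p)) < 1 / 2) sequentially"
        using tendstoD[OF elim(2), of "1/2"] tendstoD[OF elim(4), of "1/2"] by (auto simp: dist_norm)
      then have "eventually (\<lambda>j. ennreal (c0_const \<sigma>) \<le> G j p + ennreal (2 * M * norm (U j p - N p) + 2 * M * norm (U j (shift_x l h p) - N (shift_x l h p)))) sequentially"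
      proof eventually_elim
        case (elim j)
        have q: "Q j p" using \<open>\<forall>j. Q j p\<close> by simp
        consider "N p = n_minus \<sigma>" "N (shift_x l h p) = n_plus \<sigma>" | "N p = n_plus \<sigma>" "N (shift_x l h p) = n_minus \<sigma>"
          using True \<open>N p \<in> _\<close> \<open>N (shift_x l h p) \<in> _\<close> by (auto simp: D_def)
        then show ?case using elim q by cases (auto simp: Q_def)
      qed
      from ennreal_le_liminfI[OF this tend] show ?thesis using True by simp
    qed simp
  qed
  have int: "(\<integral>\<^sup>+p. G j p \<partial>torus_prod l) \<le> ennreal h * b j" for j
  proof -
    interpret T: finite_measure "torus_prod l" by (rule finite_measure_torus_prod)
    interpret P: pair_sigma_finite lborel "torus_prod l" ..
    have "(\<integral>\<^sup>+p. G j p \<partial>torus_prod l) = (\<integral>\<^sup>+t. \<integral>\<^sup>+p. indicator {0..h} t * f j (shift_x l t p) \<partial>torus_prod l \<partial>lborel)"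
      unfolding G_def
    proof (rule P.Fubini')
      show "(\<lambda>(t, p). indicator {0..h} t * f j (shift_x l t p)) \<in> borel_measurable (lborel \<Otimes>\<^sub>M torus_prod l)"
        unfolding shift_x_def case_prod_beta by measurable
    qed
    also have "\<dots> = (\<integral>\<^sup>+t. indicator {0..h} t * (\<integral>\<^sup>+p. f j p \<partial>torus_prod l) \<partial>lborel)"
    proof (rule nn_integral_cong)
      fix t :: real
      show "(\<integral>\<^sup>+p. indicator {0..h} t * f j (shift_x l t p) \<partial>torus_prod l) = indicator {0..h} t * (\<integral>\<^sup>+p. f j p \<partial>torus_prod l)"
        using h nn_integral_torus_shift[OF l, of t "f j"] by (cases "t \<in> {0..h}") auto
    qed
    also have "\<dots> = ennreal h * (\<integral>\<^sup>+p. f j p \<partial>torus_prod l)"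
      using h by (subst nn_integral_multc) auto
    also have "\<dots> \<le> ennreal h * b j" using le[of j] by (intro mult_left_mono) (auto simp: f_def)
    finally show ?thesis .
  qed
  have "ennreal (c0_const \<sigma>) * emeasure (torus_prod l) D = (\<integral>\<^sup>+p. ennreal (c0_const \<sigma>) * indicator D p \<partial>torus_prod l)"
    using D by (subst nn_integral_cmult_indicator) auto
  also have "\<dots> \<le> (\<integral>\<^sup>+p. liminf (\<lambda>j. G j p) \<partial>torus_prod l)"
    by (rule nn_integral_mono_AE[OF low])
  also have "\<dots> \<le> liminf (\<lambda>j. \<integral>\<^sup>+p. G j p \<partial>torus_prod l)"
    by (rule nn_integral_liminf) simp
  also have "\<dots> \<le> liminf (\<lambda>j. ennreal h * b j)"
    using int by (intro Liminf_mono) auto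
  also have "\<dots> = ennreal h * B"
    using b by (intro lim_imp_Liminf ennreal_tendsto_cmult) auto
  finally show ?thesis by (simp add: D_def)
qed

section \<open>Total variation and weak derivatives\<close>

lemma C_infinityD:
  fixes \<phi> :: "real \<times> real \<Rightarrow> 'b::euclidean_space"
  assumes "C_infinity \<phi>"
  shows "(\<phi> has_derivative frechet_derivative \<phi> (at p)) (at p)"
    and "continuous_on UNIV \<phi>"
    and "continuous_on UNIV (\<lambda>p. frechet_derivative \<phi> (at p) (1, 0))"
    and "continuous_on UNIV (\<lambda>p. frechet_derivative \<phi> (at p) (0, 1))"
proof -
  have *: "\<phi> differentiable_on UNIV" "\<And>b. b \<in> Basis \<Longrightarrow> continuous_on UNIV (\<lambda>p. frechet_derivative \<phi> (at p) b)"
    using assms[unfolded C_infinity_def, rule_format, of "Suc 0"] by auto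
  show "(\<phi> has_derivative frechet_derivative \<phi> (at p)) (at p)" for p
  proof -
    have "\<phi> differentiable (at p)" by (rule bspec[OF *(1)[unfolded differentiable_on_def] UNIV_I])
    then show ?thesis by (rule frechet_derivative_works[THEN iffD1])
  qed
  show "continuous_on UNIV \<phi>" using *(1) by (rule differentiable_imp_continuous_on)
  show "continuous_on UNIV (\<lambda>p. frechet_derivative \<phi> (at p) (1, 0))" "continuous_on UNIV (\<lambda>p. frechet_derivative \<phi> (at p) (0, 1))"
    by (rule *(2); simp add: Basis_prod_def)+
qed

lemma C_infinity_partial:
  fixes \<phi> :: "real \<times> real \<Rightarrow> 'b::euclidean_space"
  assumes "C_infinity \<phi>"
  shows "((\<lambda>x. \<phi> (x, y)) has_vector_derivative frechet_derivative \<phi> (at (x, y)) (1, 0)) (at x within S)"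
    and "((\<lambda>y. \<phi> (x, y)) has_vector_derivative frechet_derivative \<phi> (at (x, y)) (0, 1)) (at y within S)"
proof -
  note d = C_infinityD(1)[OF assms, of "(x, y)"]
  have lin: "frechet_derivative \<phi> (at (x, y)) (h *\<^sub>R b) = h *\<^sub>R frechet_derivative \<phi> (at (x, y)) b" for h b
    using linear_cmul[OF has_derivative_linear[OF d]] .
  have "((\<lambda>x. (x, y)) has_derivative (\<lambda>h. h *\<^sub>R (1, 0))) (at x within S)"
    by (auto intro!: derivative_eq_intros)
  from diff_chain_within[OF this has_derivative_at_withinI[OF d]]
  show "((\<lambda>x. \<phi> (x, y)) has_vector_derivative frechet_derivative \<phi> (at (x, y)) (1, 0)) (at x within S)"
    by (simp only: has_vector_derivative_def o_def lin)
  have "((\<lambda>y. (x, y)) has_derivative (\<lambda>h. h *\<^sub>R (0, 1))) (at y within S)"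
    by (auto intro!: derivative_eq_intros)
  from diff_chain_within[OF this has_derivative_at_withinI[OF d]]
  show "((\<lambda>y. \<phi> (x, y)) has_vector_derivative frechet_derivative \<phi> (at (x, y)) (0, 1)) (at y within S)"
    by (simp only: has_vector_derivative_def o_def lin)
qed

lemma integrable_torus_inner:
  fixes u h :: "real \<times> real \<Rightarrow> 'b::euclidean_space"
  assumes u: "integrable (torus_prod l) u" and h: "continuous_on UNIV h"
  shows "integrable (torus_prod l) (\<lambda>p. u p \<bullet> h p)"
proof -
  have "bounded (h ` cbox (-l, -l) (l, l))"
    by (intro compact_imp_bounded compact_continuous_image compact_cbox continuous_on_subset[OF h] subset_UNIV)
  then obtain C where C: "\<And>p. p \<in> cbox (-l, -l) (l, l) \<Longrightarrow> norm (h p) \<le> C"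
    unfolding bounded_iff by auto
  have [measurable]: "h \<in> borel_measurable (borel \<Otimes>\<^sub>M borel)"
    using h unfolding borel_prod by (rule borel_measurable_continuous_onI)
  have [measurable]: "u \<in> borel_measurable (borel \<Otimes>\<^sub>M borel)" using borel_measurable_integrable[OF u] by simp
  show ?thesis
  proof (rule Bochner_Integration.integrable_bound[OF integrable_mult_right[OF integrable_norm[OF u], of C]])
    show "(\<lambda>p. u p \<bullet> h p) \<in> borel_measurable (torus_prod l)" by measurable
    show "AE p in torus_prod l. norm (u p \<bullet> h p) \<le> norm (C * norm (u p))"
      using AE_in_torus
    proof eventually_elim
      case (elim p)
      then have "norm (h p) \<le> C" by (intro C) (auto simp: torus_def cbox_Pair_eq)
      then have "\<bar>u p \<bullet> h p\<bar> \<le> norm (u p) * C"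
        by (intro order_trans[OF Cauchy_Schwarz_ineq2] mult_left_mono) auto
      also have "\<dots> \<le> norm (C * norm (u p))" unfolding mult.commute[of _ C] real_norm_def by (rule abs_ge_self)
      finally show ?case by simp
    qed
  qed
qed

text \<open>On almost every vertical line \<open>u\<close> is constant, and the integral of the
  derivative of \<open>\<psi>\<close> over a full period is 0.\<close>

lemma integral_torus_dy_zero:
  fixes \<psi> :: "real \<times> real \<Rightarrow> 'b::euclidean_space" and k :: "real \<Rightarrow> 'b"
  assumes l: "l > 0" and u: "integrable (torus_prod l) u" and k: "AE p in torus_prod l. u p = k (fst p)"
    and \<psi>: "test_fun l \<psi>"
  shows "(LINT p|torus_prod l. u p \<bullet> frechet_derivative \<psi> (at p) (0, 1)) = 0"
proof -
  interpret pair_sigma_finite "side l" "side l" by (rule pair_sigma_finite_side)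
  have C: "C_infinity \<psi>" and per: "\<And>x y. \<psi> (x, y + 2 * l) = \<psi> (x, y)"
    using \<psi> by (auto simp: test_fun_def periodic_def)
  have int: "integrable (torus_prod l) (\<lambda>p. u p \<bullet> frechet_derivative \<psi> (at p) (0, 1))"
    by (rule integrable_torus_inner[OF u C_infinityD(4)[OF C]])
  have [measurable]: "(\<lambda>p. frechet_derivative \<psi> (at p) (0, 1)) \<in> borel_measurable (borel \<Otimes>\<^sub>M borel)"
    using C_infinityD(4)[OF C] unfolding borel_prod by (rule borel_measurable_continuous_onI)
  have [measurable]: "u \<in> borel_measurable (borel \<Otimes>\<^sub>M borel)" using borel_measurable_integrable[OF u] by simp
  have "(LINT p|torus_prod l. u p \<bullet> frechet_derivative \<psi> (at p) (0, 1))
      = (LINT x|side l. LINT y|side l. u (x, y) \<bullet> frechet_derivative \<psi> (at (x, y)) (0, 1))"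
    using int by (subst integral_fst'[symmetric]) simp_all
  also have "\<dots> = (LINT x|side l. 0)"
  proof (rule integral_cong_AE)
    show "AE x in side l. (LINT y|side l. u (x, y) \<bullet> frechet_derivative \<psi> (at (x, y)) (0, 1)) = 0"
      using AE_pair[OF k]
    proof eventually_elim
      case (elim x)
      have cont: "continuous_on UNIV (\<lambda>y. k x \<bullet> frechet_derivative \<psi> (at (x, y)) (0, 1))"
        by (intro continuous_intros continuous_on_compose2[OF C_infinityD(4)[OF C]]) auto
      have "(LINT y|side l. u (x, y) \<bullet> frechet_derivative \<psi> (at (x, y)) (0, 1))
         = (LINT y|side l. indicator {-l..} y * (k x \<bullet> frechet_derivative \<psi> (at (x, y)) (0, 1)))"
      proof (rule integral_cong_AE)
        have [measurable]: "(\<lambda>y. k x \<bullet> frechet_derivative \<psi> (at (x, y)) (0, 1)) \<in> borel_measurable borel"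
          using cont by (rule borel_measurable_continuous_onI)
        show "(\<lambda>y. indicator {-l..} y * (k x \<bullet> frechet_derivative \<psi> (at (x, y)) (0, 1))) \<in> borel_measurable (side l)"
          by measurable
        show "(\<lambda>y. u (x, y) \<bullet> frechet_derivative \<psi> (at (x, y)) (0, 1)) \<in> borel_measurable (side l)"
          by measurable
        show "AE y in side l. u (x, y) \<bullet> frechet_derivative \<psi> (at (x, y)) (0, 1) = indicator {-l..} y * (k x \<bullet> frechet_derivative \<psi> (at (x, y)) (0, 1))"
          using elim AE_in_side by eventually_elim auto
      qed
      also have "\<dots> = k x \<bullet> \<psi> (x, l) - k x \<bullet> \<psi> (x, -l)"
      proof (rule integral_side_FTC[OF _ cont])
        show "((\<lambda>y. k x \<bullet> \<psi> (x, y)) has_real_derivative k x \<bullet> frechet_derivative \<psi> (at (x, y)) (0, 1)) (at y)" for y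
          unfolding has_real_derivative_iff_has_vector_derivative
          by (rule bounded_linear.has_vector_derivative[OF bounded_linear_inner_right C_infinity_partial(2)[OF C]])
      qed (use l in auto)
      also have "\<dots> = 0" using per[of x "-l"] by simp
      finally show ?case .
    qed
  qed simp_all
  finally show ?thesis by simp
qed

text \<open>A discrete integration by parts: the difference quotient of \<open>\<phi>\<close> to the
  left becomes, by invariance under shifts, a difference quotient of \<open>u\<close> to the right
  with opposite sign. The L1 bound on the latter is uniform in h, and the former converges to the
  partial derivative.\<close>

lemma integral_torus_dx_le:
  fixes \<phi> :: "real \<times> real \<Rightarrow> 'b::euclidean_space"
  assumes l: "l > 0" and u: "integrable (torus_prod l) u"
    and K: "\<And>h. 0 < h \<Longrightarrow> h < 2 * l \<Longrightarrow> (LINT p|torus_prod l. norm (u (shift_x l h p) - u p)) \<le> K * h"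
    and \<phi>: "test_fun l \<phi>" and \<phi>1: "\<And>p. norm (\<phi> p) \<le> 1"
  shows "(LINT p|torus_prod l. u p \<bullet> frechet_derivative \<phi> (at p) (1, 0)) \<le> K"
proof -
  have C: "C_infinity \<phi>" and per: "\<And>x y. \<phi> (x + 2 * l, y) = \<phi> (x, y)"
    using \<phi> by (auto simp: test_fun_def periodic_def)
  have um [measurable]: "u \<in> borel_measurable (borel \<Otimes>\<^sub>M borel)" using borel_measurable_integrable[OF u] by simp
  have [measurable]: "\<phi> \<in> borel_measurable (borel \<Otimes>\<^sub>M borel)"
    using C_infinityD(2)[OF C] unfolding borel_prod by (rule borel_measurable_continuous_onI)
  have [measurable]: "(\<lambda>p. frechet_derivative \<phi> (at p) (1, 0)) \<in> borel_measurable (borel \<Otimes>\<^sub>M borel)"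
    using C_infinityD(3)[OF C] unfolding borel_prod by (rule borel_measurable_continuous_onI)
  \<comment> \<open>The box extends to the left of the square so that it also contains the shifted
    points \<open>x - h n\<close>; a bound on the derivative there dominates the difference
    quotients.\<close>
  have "bounded ((\<lambda>p. frechet_derivative \<phi> (at p) (1, 0)) ` cbox (-3*l, -l) (l, l))"
    by (intro compact_imp_bounded compact_continuous_image compact_cbox continuous_on_subset[OF C_infinityD(3)[OF C]] subset_UNIV)
  then obtain B where B: "\<And>p. p \<in> cbox (-3*l, -l) (l, l) \<Longrightarrow> norm (frechet_derivative \<phi> (at p) (1, 0)) \<le> B"
    unfolding bounded_iff by auto
  define h where "h n = l / real (Suc n)" for n
  have h: "0 < h n" "h n < 2 * l" "h n \<le> l" for n
  proof -
    show "0 < h n" using l by (simp add: h_def)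
    have "l / real (Suc n) \<le> l / 1" using l by (intro divide_left_mono) auto
    then show "h n \<le> l" by (simp add: h_def)
    then show "h n < 2 * l" using l by simp
  qed
  have h0: "h \<longlonglongrightarrow> 0" unfolding h_def
    using tendsto_mult[OF tendsto_const[of l] LIMSEQ_inverse_real_of_nat] by (simp add: divide_inverse)
  define d where "d n p = (1 / h n) *\<^sub>R (\<phi> p - \<phi> (fst p - h n, snd p))" for n p
  have dm [measurable]: "d n \<in> borel_measurable (borel \<Otimes>\<^sub>M borel)" for n unfolding d_def by measurable
  have "(\<lambda>n. LINT p|torus_prod l. u p \<bullet> d n p) \<longlonglongrightarrow> (LINT p|torus_prod l. u p \<bullet> frechet_derivative \<phi> (at p) (1, 0))"
  proof (rule integral_dominated_convergence[where w = "\<lambda>p. norm (u p) * \<bar>B\<bar>"])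
    show "AE p in torus_prod l. (\<lambda>n. u p \<bullet> d n p) \<longlonglongrightarrow> u p \<bullet> frechet_derivative \<phi> (at p) (1, 0)"
    proof (rule AE_I2, rule tendsto_inner[OF tendsto_const])
      fix p :: "real \<times> real"
      obtain x y where p: "p = (x, y)" by force
      have "((\<lambda>x. \<phi> (x, y)) has_vector_derivative frechet_derivative \<phi> (at p) (1, 0)) (at x)"
        unfolding p by (rule C_infinity_partial(1)[OF C])
      then have "((\<lambda>t. (1 / norm (t - x)) *\<^sub>R (\<phi> (t, y) - (\<phi> (x, y) + (t - x) *\<^sub>R frechet_derivative \<phi> (at p) (1, 0)))) \<longlongrightarrow> 0) (at x)"
        by (simp only: has_vector_derivative_def has_derivative_within)
      moreover have "filterlim (\<lambda>n. x - h n) (at x) sequentially"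
        using tendsto_diff[OF tendsto_const[of x] h0] h(1) by (auto simp: filterlim_at less_imp_neq[symmetric] intro!: always_eventually)
      ultimately have "(\<lambda>n. (1 / norm (x - h n - x)) *\<^sub>R (\<phi> (x - h n, y) - (\<phi> (x, y) + (x - h n - x) *\<^sub>R frechet_derivative \<phi> (at p) (1, 0)))) \<longlonglongrightarrow> 0"
        by (rule filterlim_compose)
      from tendsto_diff[OF tendsto_const this]
      have "(\<lambda>n. frechet_derivative \<phi> (at p) (1, 0) - (1 / norm (x - h n - x)) *\<^sub>R (\<phi> (x - h n, y) - (\<phi> (x, y) + (x - h n - x) *\<^sub>R frechet_derivative \<phi> (at p) (1, 0)))) \<longlonglongrightarrow> frechet_derivative \<phi> (at p) (1, 0)"
        by simp
      moreover have "frechet_derivative \<phi> (at p) (1, 0) - (1 / norm (x - h n - x)) *\<^sub>R (\<phi> (x - h n, y) - (\<phi> (x, y) + (x - h n - x) *\<^sub>R frechet_derivative \<phi> (at p) (1, 0))) = d n p" for n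
        unfolding d_def p using h(1)[of n] by (simp add: algebra_simps)
      ultimately show "(\<lambda>n. d n p) \<longlonglongrightarrow> frechet_derivative \<phi> (at p) (1, 0)" by simp
    qed
    show "AE p in torus_prod l. norm (u p \<bullet> d n p) \<le> norm (u p) * \<bar>B\<bar>" for n
      using AE_in_torus
    proof eventually_elim
      case (elim p)
      obtain x y where p: "p = (x, y)" by force
      have "norm (\<phi> (x, y) - \<phi> (x - h n, y)) \<le> B * norm (x - (x - h n))"
      proof (rule differentiable_bound[of "{-3*l..l}" "\<lambda>x. \<phi> (x, y)" "\<lambda>x h. h *\<^sub>R frechet_derivative \<phi> (at (x, y)) (1, 0)"])
        show "((\<lambda>x. \<phi> (x, y)) has_derivative (\<lambda>h. h *\<^sub>R frechet_derivative \<phi> (at (t, y)) (1, 0))) (at t within {-3*l..l})" for t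
          using C_infinity_partial(1)[OF C, of y t "{-3*l..l}"] by (simp add: has_vector_derivative_def)
        show "onorm (\<lambda>h. h *\<^sub>R frechet_derivative \<phi> (at (t, y)) (1, 0)) \<le> B" if "t \<in> {-3*l..l}" for t
        proof (rule onorm_le)
          have "norm (frechet_derivative \<phi> (at (t, y)) (1, 0)) \<le> B"
            using elim that unfolding p torus_def by (intro B) (auto simp: cbox_Pair_eq)
          then show "norm (s *\<^sub>R frechet_derivative \<phi> (at (t, y)) (1, 0)) \<le> B * norm s" for s :: real
            by (simp add: mult.commute[of B] mult_left_mono)
        qed
      qed (use elim h[of n] l in \<open>auto simp: p torus_def\<close>)
      then have "norm (\<phi> (x, y) - \<phi> (x - h n, y)) / h n \<le> B" using h(1)[of n] by (simp add: field_simps)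
      then have "norm (d n p) \<le> B" using h(1)[of n] unfolding d_def p norm_scaleR by simp
      then have "norm (u p) * norm (d n p) \<le> norm (u p) * \<bar>B\<bar>" by (intro mult_left_mono) auto
      then show ?case using Cauchy_Schwarz_ineq2[of "u p" "d n p"] by simp
    qed
    show "integrable (torus_prod l) (\<lambda>p. norm (u p) * \<bar>B\<bar>)" using u by auto
  qed measurable
  moreover have "(LINT p|torus_prod l. u p \<bullet> d n p) \<le> K" for n
  proof -
    have hh: "0 \<le> h n" "h n < 2 * l" using h[of n] by auto
    have cs: "continuous_on UNIV (\<lambda>p. \<phi> (fst p - h n, snd p))"
      by (intro continuous_on_compose2[OF C_infinityD(2)[OF C]] continuous_intros) auto
    have i1: "integrable (torus_prod l) (\<lambda>p. u p \<bullet> \<phi> p)"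
      by (rule integrable_torus_inner[OF u C_infinityD(2)[OF C]])
    have i2: "integrable (torus_prod l) (\<lambda>p. u p \<bullet> \<phi> (fst p - h n, snd p))"
      by (rule integrable_torus_inner[OF u cs])
    have us: "integrable (torus_prod l) (\<lambda>p. u (shift_x l (h n) p))"
      by (rule integral_torus_shift(2)[OF l hh um u])
    have i3: "integrable (torus_prod l) (\<lambda>p. u (shift_x l (h n) p) \<bullet> \<phi> p)"
      by (rule integrable_torus_inner[OF us C_infinityD(2)[OF C]])
    have "(LINT p|torus_prod l. u p \<bullet> \<phi> (fst p - h n, snd p))
       = (LINT p|torus_prod l. u (shift_x l (h n) p) \<bullet> \<phi> (fst (shift_x l (h n) p) - h n, snd (shift_x l (h n) p)))"
      by (rule integral_torus_shift(1)[OF l hh, symmetric]) measurable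
    also have "\<dots> = (LINT p|torus_prod l. u (shift_x l (h n) p) \<bullet> \<phi> p)"
    proof (rule integral_cong_AE)
      show "AE p in torus_prod l. u (shift_x l (h n) p) \<bullet> \<phi> (fst (shift_x l (h n) p) - h n, snd (shift_x l (h n) p)) = u (shift_x l (h n) p) \<bullet> \<phi> p"
        using AE_in_torus
      proof eventually_elim
        case (elim p)
        obtain x y where p: "p = (x, y)" by force
        \<comment> \<open>Shifting forward and back returns to x, possibly up to one period, which
          \<open>\<phi>\<close> does not see.\<close>
        have "\<phi> (wrap l (x + h n) - h n, y) = \<phi> (x, y)"
        proof (cases "x + h n < l")
          case True
          then have "wrap l (x + h n) = x + h n" using elim hh by (intro wrap_id[OF l]) (auto simp: p torus_def)
          then show ?thesis by simp
        next
          case False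
          then have "wrap l (x + h n) = x + h n - 2 * l" using elim hh by (intro wrap_eq[OF l]) (auto simp: p torus_def)
          then show ?thesis using per[of "x - 2 * l" y] by simp
        qed
        then show ?case by (simp add: shift_x_def p)
      qed
    qed measurable
    finally have eq: "(LINT p|torus_prod l. u p \<bullet> \<phi> (fst p - h n, snd p)) = (LINT p|torus_prod l. u (shift_x l (h n) p) \<bullet> \<phi> p)" .
    have "h n * (LINT p|torus_prod l. u p \<bullet> d n p) = (LINT p|torus_prod l. u p \<bullet> \<phi> p - u p \<bullet> \<phi> (fst p - h n, snd p))"
      using h(1)[of n] by (subst integral_mult_right_zero[symmetric]) (simp add: d_def inner_diff_right)
    also have "\<dots> = (LINT p|torus_prod l. u p \<bullet> \<phi> p - u (shift_x l (h n) p) \<bullet> \<phi> p)"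
      using i1 i2 i3 eq by simp
    also have "\<dots> \<le> (LINT p|torus_prod l. norm (u (shift_x l (h n) p) - u p))"
    proof (rule integral_mono)
      fix p
      have "u p \<bullet> \<phi> p - u (shift_x l (h n) p) \<bullet> \<phi> p = (u p - u (shift_x l (h n) p)) \<bullet> \<phi> p" by (simp add: inner_diff_left)
      also have "\<dots> \<le> norm (u p - u (shift_x l (h n) p)) * norm (\<phi> p)" by (rule norm_cauchy_schwarz)
      also have "\<dots> \<le> norm (u p - u (shift_x l (h n) p)) * 1" using \<phi>1 by (intro mult_left_mono) auto
      finally show "u p \<bullet> \<phi> p - u (shift_x l (h n) p) \<bullet> \<phi> p \<le> norm (u (shift_x l (h n) p) - u p)"
        by (simp add: norm_minus_commute)
    qed (use i1 i3 us u in auto)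
    also have "\<dots> \<le> h n * K" using K[OF h(1,2), of n] by (simp add: mult.commute)
    finally show ?thesis using h(1)[of n] by simp
  qed
  ultimately show ?thesis by (intro LIMSEQ_le_const2) auto
qed

text \<open>The Frobenius bound implies |\<phi>| <= 1. The x part of the test field is then
  controlled by the increments of \<open>U\<close>, and the y part contributes 0.\<close>

lemma total_variation_le:
  fixes u U :: "real \<times> real \<Rightarrow> 'b::euclidean_space" and k :: "real \<Rightarrow> 'b"
  assumes l: "l > 0" and U: "integrable (torus_prod l) U" and uU: "AE p in torus_prod l. u p = U p"
    and k: "AE p in torus_prod l. U p = k (fst p)"
    and K: "\<And>h. 0 < h \<Longrightarrow> h < 2 * l \<Longrightarrow> (LINT p|torus_prod l. norm (U (shift_x l h p) - U p)) \<le> K * h"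
  shows "total_variation l u \<le> ennreal K"
  unfolding total_variation_def
proof (rule SUP_least, clarify)
  fix \<phi> \<psi> :: "real \<times> real \<Rightarrow> 'b"
  assume t: "test_fun l \<phi>" "test_fun l \<psi>" and le: "\<forall>p. (norm (\<phi> p))\<^sup>2 + (norm (\<psi> p))\<^sup>2 \<le> 1"
  have C: "C_infinity \<phi>" "C_infinity \<psi>" using t by (auto simp: test_fun_def)
  have \<phi>1: "norm (\<phi> p) \<le> 1" for p
  proof -
    have "(norm (\<phi> p))\<^sup>2 \<le> 1\<^sup>2"
      using le[rule_format, of p] zero_le_power2[of "norm (\<psi> p)"] unfolding one_power2 by linarith
    then show ?thesis by (rule power2_le_imp_le) simp
  qed
  have i: "integrable (torus_prod l) (\<lambda>p. U p \<bullet> frechet_derivative \<phi> (at p) (1, 0))"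
    "integrable (torus_prod l) (\<lambda>p. U p \<bullet> frechet_derivative \<psi> (at p) (0, 1))"
    by (intro integrable_torus_inner[OF U] C_infinityD(3,4) C)+
  have "(LINT p|torus_measure l. u p \<bullet> (frechet_derivative \<phi> (at p) (1, 0) + frechet_derivative \<psi> (at p) (0, 1)))
    = (LINT p|torus_prod l. U p \<bullet> frechet_derivative \<phi> (at p) (1, 0) + U p \<bullet> frechet_derivative \<psi> (at p) (0, 1))"
  proof (rule integral_torus)
    show "(\<lambda>p. U p \<bullet> frechet_derivative \<phi> (at p) (1, 0) + U p \<bullet> frechet_derivative \<psi> (at p) (0, 1)) \<in> borel_measurable (torus_prod l)"
      using i by (intro borel_measurable_add borel_measurable_integrable)
    show "AE p in torus_prod l. u p \<bullet> (frechet_derivative \<phi> (at p) (1, 0) + frechet_derivative \<psi> (at p) (0, 1))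
        = U p \<bullet> frechet_derivative \<phi> (at p) (1, 0) + U p \<bullet> frechet_derivative \<psi> (at p) (0, 1)"
      using uU by eventually_elim (simp add: inner_add_right)
  qed
  also have "\<dots> \<le> K"
    using i integral_torus_dx_le[OF l U K t(1) \<phi>1] integral_torus_dy_zero[OF l U k t(2)] by simp
  finally show "ennreal (LINT p|torus_measure l. u p \<bullet> (frechet_derivative \<phi> (at p) (1, 0) + frechet_derivative \<psi> (at p) (0, 1))) \<le> ennreal K"
    by (rule ennreal_leI)
qed

text \<open>After exchange of the variables the hypothesis says that the weak derivative is 0. Its
  primitive along lines vanishes, so only the constant of integration of each line is left.\<close>

lemma depends_on_x_of_trig:
  fixes U :: "real \<times> real \<Rightarrow> real"
  assumes l: "l > 0" and U: "integrable (torus_prod l) U"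
    and 0: "\<And>a b c. of_int b * (LINT p|torus_prod l. trig l a b c p * U p) = 0"
  shows "\<exists>k. AE p in torus_prod l. U p = k (fst p)"
proof -
  interpret pair_sigma_finite "side l" "side l" by (rule pair_sigma_finite_side)
  have [measurable]: "U \<in> borel_measurable (borel \<Otimes>\<^sub>M borel)" using borel_measurable_integrable[OF U] by simp
  define U' where "U' p = U (snd p, fst p)" for p
  have U': "integrable (torus_prod l) U'"
    using integrable_product_swap[OF U] by (simp add: U'_def[abs_def] case_prod_unfold)
  have "(LINT p|torus_prod l. trig l a b c p * U' p) = (LINT p|torus_prod l. trig l b a c p * U p)" for a b c
  proof -
    have "(LINT p|torus_prod l. trig l a b c p * U' p) = (LINT (x, y)|torus_prod l. trig l b a c (y, x) * U (y, x))"
      by (intro Bochner_Integration.integral_cong refl) (simp add: U'_def trig_swap[of l b a c] case_prod_unfold)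
    also have "\<dots> = (LINT p|torus_prod l. trig l b a c p * U p)"
      by (rule integral_product_swap) measurable
    finally show ?thesis .
  qed
  then have "(of_int a * pi / l) * (LINT p|torus_prod l. trig l a b c p * U' p) = (LINT p|torus_prod l. trig l a b (c + pi / 2) p * 0)" for a b c
    using 0[of a b c] by simp
  from weak_deriv_x_primitive[OF l U' _ this]
  obtain k where "AE p in torus_prod l. U' p = k (snd p)" by auto
  from AE_torus_swap[OF this] show ?thesis by (auto simp: U'_def)
qed

text \<open>The test function has phase \<open>c + pi / 2\<close>, so that its derivative is a
  negative multiple of the cosine with phase \<open>c\<close>. Allowing any direction
  \<open>e\<close> treats both partial derivatives at once.\<close>

lemma has_weak_deriv_trig:
  fixes u v :: "real \<times> real \<Rightarrow> 'b::euclidean_space"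
  assumes l: "l > 0" and w: "has_weak_deriv l e u v"
    and U: "U \<in> borel_measurable (torus_prod l)" "AE p in torus_prod l. u p = U p"
    and V: "V \<in> borel_measurable (torus_prod l)" "AE p in torus_prod l. v p = V p"
  shows "integrable (torus_prod l) U" "integrable (torus_prod l) V"
    "(of_int a * pi / l * fst e + of_int b * pi / l * snd e) *\<^sub>R (LINT p|torus_prod l. trig l a b c p *\<^sub>R U p)
      = (LINT p|torus_prod l. trig l a b (c + pi / 2) p *\<^sub>R V p)"
proof -
  show iU: "integrable (torus_prod l) U" and iV: "integrable (torus_prod l) V"
    using w integrable_torus[OF U] integrable_torus[OF V] by (auto simp: has_weak_deriv_def)
  let ?r = "of_int a * pi / l * fst e + of_int b * pi / l * snd e"
  have "(LINT p|torus_measure l. frechet_derivative (trig l a b (c + pi / 2)) (at p) e *\<^sub>R u p) =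
        - (LINT p|torus_measure l. trig l a b (c + pi / 2) p *\<^sub>R v p)"
    using w test_fun_trig[OF l] unfolding has_weak_deriv_def by blast
  also have "(LINT p|torus_measure l. frechet_derivative (trig l a b (c + pi / 2)) (at p) e *\<^sub>R u p)
      = (LINT p|torus_prod l. (- ?r) *\<^sub>R (trig l a b c p *\<^sub>R U p))"
  proof (rule integral_torus)
    show "(\<lambda>p. (- ?r) *\<^sub>R (trig l a b c p *\<^sub>R U p)) \<in> borel_measurable (torus_prod l)"
      by (intro borel_measurable_scaleR borel_measurable_const trig_measurable U)
  qed (use U(2) in \<open>auto elim!: eventually_mono simp: frechet_trig\<close>)
  also have "\<dots> = (- ?r) *\<^sub>R (LINT p|torus_prod l. trig l a b c p *\<^sub>R U p)"
    by (rule integral_scaleR_right)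
  also have "(LINT p|torus_measure l. trig l a b (c + pi / 2) p *\<^sub>R v p) = (LINT p|torus_prod l. trig l a b (c + pi / 2) p *\<^sub>R V p)"
  proof (rule integral_torus)
    show "(\<lambda>p. trig l a b (c + pi / 2) p *\<^sub>R V p) \<in> borel_measurable (torus_prod l)"
      by (intro borel_measurable_scaleR trig_measurable V)
  qed (use V(2) in \<open>auto elim!: eventually_mono\<close>)
  finally show "?r *\<^sub>R (LINT p|torus_prod l. trig l a b c p *\<^sub>R U p) = (LINT p|torus_prod l. trig l a b (c + pi / 2) p *\<^sub>R V p)"
    by (simp only: scaleR_minus_left neg_equal_iff_equal)
qed

text \<open>Both candidates have the same coefficients, so completeness of the cosines applies to
  their difference. Since \<open>weak_deriv\<close> is an arbitrary choice, this is what links it to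
  an explicitly known weak derivative.\<close>

lemma has_weak_deriv_unique:
  fixes u v w :: "real \<times> real \<Rightarrow> real"
  assumes l: "l > 0" and v: "has_weak_deriv l e u v" and w: "has_weak_deriv l e u w"
  shows "AE p in torus_prod l. v p = w p"
proof -
  have "u \<in> borel_measurable (torus_measure l)" "v \<in> borel_measurable (torus_measure l)" "w \<in> borel_measurable (torus_measure l)"
    using v w by (auto simp: has_weak_deriv_def)
  note reps = this[THEN borel_rep_torus]
  obtain U where U: "U \<in> borel_measurable (torus_prod l)" "AE p in torus_prod l. u p = U p"
    using reps(1) by (rule bexE)
  obtain V where V: "V \<in> borel_measurable (torus_prod l)" "AE p in torus_prod l. v p = V p"
    using reps(2) by (rule bexE)
  obtain W where W: "W \<in> borel_measurable (torus_prod l)" "AE p in torus_prod l. w p = W p"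
    using reps(3) by (rule bexE)
  note 1 = has_weak_deriv_trig[OF l v U V] and 2 = has_weak_deriv_trig[OF l w U W]
  have "AE p in torus_prod l. V p - W p = 0"
  proof (rule trig_complete[OF l])
    show "integrable (torus_prod l) (\<lambda>p. V p - W p)" using 1 2 by auto
    fix a b c
    have "integrable (torus_prod l) (\<lambda>p. trig l a b c p * V p)" "integrable (torus_prod l) (\<lambda>p. trig l a b c p * W p)"
      by (intro integrable_bounded_mult[OF _ trig_measurable trig_bound] 1 2)+
    then show "(LINT p|torus_prod l. trig l a b c p * (V p - W p)) = 0"
      using 1(3)[of a b "c - pi / 2"] 2(3)[of a b "c - pi / 2"] by (simp add: right_diff_distrib)
  qed
  with V(2) W(2) show ?thesis by eventually_elim simp
qed

section \<open>Compactness and the lower bound\<close>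

lemma W12_torus_weak_deriv:
  assumes "W12_torus l u"
  shows "has_weak_deriv l (1, 0) u (weak_dx l u)" "has_weak_deriv l (0, 1) u (weak_dy l u)"
  using assms someI_ex[of "has_weak_deriv l (1, 0) u"] someI_ex[of "has_weak_deriv l (0, 1) u"]
  unfolding W12_torus_def weak_deriv_def by blast+

lemma finite_measure_torus_measure: "finite_measure (torus_measure l)"
proof -
  interpret T: finite_measure "torus_prod l" by (rule finite_measure_torus_prod)
  have "emeasure (torus_measure l) (space (torus_measure l)) = (\<integral>\<^sup>+p. 1 \<partial>torus_measure l)" by simp
  also have "\<dots> = (\<integral>\<^sup>+p. 1 \<partial>torus_prod l)" by (rule nn_integral_torus) auto
  finally show ?thesis by (intro finite_measureI) (simp add: T.emeasure_finite)
qed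

lemma space_torus_measure: "space (torus_measure l) = torus l"
  by (simp add: torus_measure_def)

lemma continuous_borel_torus_measure:
  fixes f :: "real \<times> real \<Rightarrow> 'b::euclidean_space"
  assumes "continuous_on UNIV f"
  shows "f \<in> borel_measurable (torus_measure l)"
  using borel_measurable_continuous_onI[OF assms]
  by (intro measurable_torus_measureI[of f]) (simp_all add: borel_measurable_torus_prod)

lemma continuous_bounded_torus:
  fixes f :: "real \<times> real \<Rightarrow> 'b::euclidean_space"
  assumes "continuous_on UNIV f"
  obtains B where "\<And>p. p \<in> torus l \<Longrightarrow> norm (f p) \<le> B"
proof -
  have "bounded (f ` cbox (-l, -l) (l, l))"
    by (intro compact_imp_bounded compact_continuous_image compact_cbox continuous_on_subset[OF assms] subset_UNIV)
  then obtain B where "\<And>p. p \<in> cbox (-l, -l) (l, l) \<Longrightarrow> norm (f p) \<le> B" unfolding bounded_iff by auto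
  then show thesis by (intro that[of B]) (auto simp: torus_def cbox_Pair_eq)
qed

lemma tendsto_integral_mult_L1:
  fixes q :: "nat \<Rightarrow> real \<times> real \<Rightarrow> real"
  assumes q: "\<And>j. integrable (torus_measure l) (q j)" and q0: "integrable (torus_measure l) q0"
    and lim: "(\<lambda>j. LINT p|torus_measure l. \<bar>q j p - q0 p\<bar>) \<longlonglongrightarrow> 0"
    and f: "continuous_on UNIV f"
  shows "(\<lambda>j. LINT p|torus_measure l. f p * q j p) \<longlonglongrightarrow> (LINT p|torus_measure l. f p * q0 p)"
proof -
  obtain B where B: "\<And>p. p \<in> torus l \<Longrightarrow> norm (f p) \<le> B" using continuous_bounded_torus[OF f] by blast
  have fi: "integrable (torus_measure l) (\<lambda>p. f p * w p)" if "integrable (torus_measure l) w" for w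
    by (rule integrable_bounded_mult[OF that continuous_borel_torus_measure[OF f], of B])
      (use B in \<open>simp add: space_torus_measure\<close>)
  have "(\<lambda>j. (LINT p|torus_measure l. f p * q j p) - (LINT p|torus_measure l. f p * q0 p)) \<longlonglongrightarrow> 0"
  proof (rule tendsto_0_le[OF lim, of _ B], rule always_eventually, rule allI)
    fix j
    have "norm ((LINT p|torus_measure l. f p * q j p) - (LINT p|torus_measure l. f p * q0 p))
       = norm (LINT p|torus_measure l. f p * (q j p - q0 p))"
      using fi[OF q] fi[OF q0] by (simp add: right_diff_distrib)
    also have "\<dots> \<le> (LINT p|torus_measure l. norm (f p * (q j p - q0 p)))"
      by (rule integral_norm_bound)
    also have "\<dots> \<le> (LINT p|torus_measure l. B * \<bar>q j p - q0 p\<bar>)"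
    proof (rule integral_mono)
      show "integrable (torus_measure l) (\<lambda>p. norm (f p * (q j p - q0 p)))"
        by (intro integrable_norm fi Bochner_Integration.integrable_diff q q0)
      show "integrable (torus_measure l) (\<lambda>p. B * \<bar>q j p - q0 p\<bar>)"
        by (intro integrable_mult_right integrable_abs Bochner_Integration.integrable_diff q q0)
      show "norm (f p * (q j p - q0 p)) \<le> B * \<bar>q j p - q0 p\<bar>" if "p \<in> space (torus_measure l)" for p
        using B[of p] that unfolding space_torus_measure real_norm_def abs_mult by (intro mult_right_mono) auto
    qed
    also have "\<dots> \<le> norm (LINT p|torus_measure l. \<bar>q j p - q0 p\<bar>) * B" by simp
    finally show "norm ((LINT p|torus_measure l. f p * q j p) - (LINT p|torus_measure l. f p * q0 p))
      \<le> norm (LINT p|torus_measure l. \<bar>q j p - q0 p\<bar>) * B" .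
  qed
  then show ?thesis by (rule LIM_zero_cancel)
qed

text \<open>Test functions and their derivatives are bounded on the square, so both sides of the
  defining identity are continuous for L1 convergence.\<close>

lemma has_weak_deriv_limit:
  fixes u v :: "nat \<Rightarrow> real \<times> real \<Rightarrow> real"
  assumes w: "\<And>j. has_weak_deriv l e (u j) (v j)" and e: "e \<in> {(1, 0), (0, 1)}"
    and u0: "integrable (torus_measure l) u0" and v0: "integrable (torus_measure l) v0"
    and limu: "(\<lambda>j. LINT p|torus_measure l. \<bar>u j p - u0 p\<bar>) \<longlonglongrightarrow> 0"
    and limv: "(\<lambda>j. LINT p|torus_measure l. \<bar>v j p - v0 p\<bar>) \<longlonglongrightarrow> 0"
  shows "has_weak_deriv l e u0 v0"
  unfolding has_weak_deriv_def real_scaleR_def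
proof (intro conjI u0 v0 allI impI)
  fix \<phi> :: "real \<times> real \<Rightarrow> real" assume \<phi>: "test_fun l \<phi>"
  then have C: "C_infinity \<phi>" by (simp add: test_fun_def)
  have i: "integrable (torus_measure l) (u j)" "integrable (torus_measure l) (v j)" for j
    using w[of j] by (auto simp: has_weak_deriv_def)
  have c: "continuous_on UNIV (\<lambda>p. frechet_derivative \<phi> (at p) e)"
    using C_infinityD(3,4)[OF C] e by auto
  have "(\<lambda>j. LINT p|torus_measure l. frechet_derivative \<phi> (at p) e * u j p) \<longlonglongrightarrow> (LINT p|torus_measure l. frechet_derivative \<phi> (at p) e * u0 p)"
    by (rule tendsto_integral_mult_L1[OF i(1) u0 limu c])
  moreover have "(LINT p|torus_measure l. frechet_derivative \<phi> (at p) e * u j p) = - (LINT p|torus_measure l. \<phi> p * v j p)" for j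
    using w[of j] \<phi> unfolding has_weak_deriv_def real_scaleR_def by blast
  moreover have "(\<lambda>j. - (LINT p|torus_measure l. \<phi> p * v j p)) \<longlonglongrightarrow> - (LINT p|torus_measure l. \<phi> p * v0 p)"
    by (intro tendsto_minus tendsto_integral_mult_L1[OF i(2) v0 limv C_infinityD(2)[OF C]])
  ultimately show "(LINT p|torus_measure l. frechet_derivative \<phi> (at p) e * u0 p) = - (LINT p|torus_measure l. \<phi> p * v0 p)"
    by (auto intro: LIMSEQ_unique)
qed

text \<open>For every d > 0 one has |q| <= q^2 / d + d pointwise. On a space of finite measure the
  last term integrates to at most r / 2 when d is small, and the first tends to 0.\<close>

lemma (in finite_measure) L2_tendsto_imp_L1_tendsto:
  fixes q :: "nat \<Rightarrow> 'a \<Rightarrow> real"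
  assumes q: "\<And>j. integrable M (q j)" and q2: "\<And>j. integrable M (\<lambda>x. (q j x)\<^sup>2)"
    and lim: "(\<lambda>j. LINT x|M. (q j x)\<^sup>2) \<longlonglongrightarrow> 0"
  shows "(\<lambda>j. LINT x|M. \<bar>q j x\<bar>) \<longlonglongrightarrow> 0"
proof (rule LIMSEQ_I)
  fix r :: real assume r: "r > 0"
  define m where "m = measure M (space M)"
  define d where "d = r / (2 * (m + 1))"
  have m: "m \<ge> 0" by (simp add: m_def)
  have d: "d > 0" using r m by (simp add: d_def)
  have dm: "d * m < r / 2"
  proof -
    have "d * m < d * (m + 1)" using d by simp
    also have "\<dots> = r / 2"
    proof -
      have "r / (2 * c) * c = r / 2" if "c > 0" for c :: real using that by simp
      from this[of "m + 1"] m show ?thesis by (simp add: d_def)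
    qed
    finally show ?thesis .
  qed
  have le: "(LINT x|M. \<bar>q j x\<bar>) \<le> (1 / d) * (LINT x|M. (q j x)\<^sup>2) + d * m" for j
  proof -
    have "(LINT x|M. \<bar>q j x\<bar>) \<le> (LINT x|M. (1 / d) * (q j x)\<^sup>2 + d)"
    proof (rule integral_mono)
      fix x
      show "\<bar>q j x\<bar> \<le> (1 / d) * (q j x)\<^sup>2 + d"
      proof (cases "\<bar>q j x\<bar> \<le> d")
        case True then show ?thesis using d by (intro order_trans[OF True]) simp
      next
        case False
        then have "\<bar>q j x\<bar> * d \<le> \<bar>q j x\<bar> * \<bar>q j x\<bar>" by (intro mult_left_mono) auto
        then have "\<bar>q j x\<bar> \<le> (1 / d) * (q j x)\<^sup>2" using d by (simp add: pos_le_divide_eq power2_eq_square)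
        then show ?thesis using d by simp
      qed
    qed (use q q2 in auto)
    also have "\<dots> = (1 / d) * (LINT x|M. (q j x)\<^sup>2) + d * m" using q2[of j] by (simp add: m_def mult.commute)
    finally show ?thesis .
  qed
  have "(\<lambda>j. (1 / d) * (LINT x|M. (q j x)\<^sup>2) + d * m) \<longlonglongrightarrow> (1 / d) * 0 + d * m"
    by (intro tendsto_intros lim)
  then have "eventually (\<lambda>j. (1 / d) * (LINT x|M. (q j x)\<^sup>2) + d * m < r) sequentially"
    by (rule order_tendstoD(2)) (use dm r in simp)
  then obtain N where N: "\<And>j. j \<ge> N \<Longrightarrow> (1 / d) * (LINT x|M. (q j x)\<^sup>2) + d * m < r" by (auto simp: eventually_sequentially)
  show "\<exists>N. \<forall>j\<ge>N. norm ((LINT x|M. \<bar>q j x\<bar>) - 0) < r"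
  proof (intro exI[of _ N] allI impI)
    fix j assume "j \<ge> N"
    from le_less_trans[OF le N[OF this]] have "(LINT x|M. \<bar>q j x\<bar>) < r" .
    moreover have "(LINT x|M. \<bar>q j x\<bar>) \<ge> 0" by simp
    ultimately show "norm ((LINT x|M. \<bar>q j x\<bar>) - 0) < r" by simp
  qed
qed

lemma W_pot_zero_sphere:
  assumes \<sigma>: "\<sigma> > 0" and p: "norm p = 1" "W_pot \<sigma> p = 0"
  shows "p \<in> {n_plus \<sigma>, n_minus \<sigma>}"
proof -
  have "\<sigma> * (p $ 2)\<^sup>2 \<ge> 0" "1 / A_const \<sigma> * (p $ 3 - A_const \<sigma>)\<^sup>2 \<ge> 0"
    using \<sigma> A_const_bounds[OF \<sigma>] by auto
  then have "\<sigma> * (p $ 2)\<^sup>2 = 0" "1 / A_const \<sigma> * (p $ 3 - A_const \<sigma>)\<^sup>2 = 0"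
    using p(2) unfolding W_pot_def by linarith+
  then have 23: "p $ 2 = 0" "p $ 3 = A_const \<sigma>" using \<sigma> A_const_bounds[OF \<sigma>] by auto
  have "(p $ 1)\<^sup>2 + (p $ 2)\<^sup>2 + (p $ 3)\<^sup>2 = 1" using p(1) unfolding norm_vec3[OF \<sigma>] by simp
  then have "(p $ 1)\<^sup>2 = (n1_bar \<sigma>)\<^sup>2" using 23 by (simp add: n1_bar_sq[OF \<sigma>])
  then have "p $ 1 = n1_bar \<sigma> \<or> p $ 1 = - n1_bar \<sigma>" by (simp add: power2_eq_iff)
  then show ?thesis using 23 by (auto simp: vec_eq_iff forall_3 n_plus_def n_minus_def)
qed

lemma n_plus_neq_n_minus: "\<sigma> > 0 \<Longrightarrow> n_plus \<sigma> \<noteq> n_minus \<sigma>"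
  using n1_bar_pos[of \<sigma>] by (simp add: vec_eq_iff forall_3 n_plus_def n_minus_def)

section \<open>The limit along a subsequence with finite convergent energies and pointwise
  convergence\<close>

context
  fixes \<sigma> l :: real
    and \<epsilon> :: "nat \<Rightarrow> real"
    and n :: "real \<times> real \<Rightarrow> real^3" and g :: "real \<times> real \<Rightarrow> real"
    and nj :: "nat \<Rightarrow> real \<times> real \<Rightarrow> real^3" and gj :: "nat \<Rightarrow> real \<times> real \<Rightarrow> real"
    and Fr :: "nat \<Rightarrow> real" and L :: real
  assumes \<sigma>: "\<sigma> > 0" and l: "l > 0"
    and \<epsilon>: "\<And>j. \<epsilon> j > 0" and \<epsilon>0: "\<epsilon> \<longlonglongrightarrow> 0"
    and n: "L1_sphere l n" and g: "L2_torus l g"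
    and Y: "\<And>j. (nj j, gj j) \<in> Y_space l"
    and nconv: "(\<lambda>j. LINT p|torus_measure l. norm (nj j p - n p)) \<longlonglongrightarrow> 0"
    and gconv: "(\<lambda>j. LINT p|torus_measure l. (gj j p - g p)\<^sup>2) \<longlonglongrightarrow> 0"
    and AEconv: "AE p in torus_measure l. (\<lambda>j. nj j p) \<longlonglongrightarrow> n p"
    and F: "\<And>j. F_energy \<sigma> l (\<epsilon> j) (nj j) (gj j) = ennreal (Fr j)" "\<And>j. Fr j \<ge> 0" "Fr \<longlonglongrightarrow> L"
begin

interpretation M: finite_measure "torus_measure l" by (rule finite_measure_torus_measure)

abbreviation "nx j \<equiv> weak_dx l (nj j)"
abbreviation "ny j \<equiv> weak_dy l (nj j)"
abbreviation "gx j \<equiv> weak_dx l (gj j)"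
abbreviation "gy j \<equiv> weak_dy l (gj j)"

lemma weak_derivs:
  "has_weak_deriv l (1, 0) (nj j) (nx j)" "has_weak_deriv l (0, 1) (nj j) (ny j)"
  "has_weak_deriv l (1, 0) (gj j) (gx j)" "has_weak_deriv l (0, 1) (gj j) (gy j)"
  using Y[of j] W12_torus_weak_deriv unfolding Y_space_def by blast+

lemma integrables:
  "integrable (torus_measure l) (nj j)" "integrable (torus_measure l) (nx j)" "integrable (torus_measure l) (ny j)"
  "integrable (torus_measure l) (gj j)" "integrable (torus_measure l) (gx j)" "integrable (torus_measure l) (gy j)"
  using weak_derivs[of j] unfolding has_weak_deriv_def by blast+

lemma n_integrable: "integrable (torus_measure l) n"
  using n by (simp add: L1_sphere_def)

lemma n_sphere: "AE p in torus_measure l. norm (n p) = 1"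
  using n by (simp add: L1_sphere_def)

lemma nj_sphere: "AE p in torus_measure l. norm (nj j p) = 1"
  using Y[of j] by (simp add: Y_space_def)

lemma integrable_nth: "integrable (torus_measure l) u \<Longrightarrow> integrable (torus_measure l) (\<lambda>p. u p $ i)"
  for u :: "real \<times> real \<Rightarrow> real^3"
  by (rule integrable_bounded_linear[OF bounded_linear_vec_nth])

definition dens :: "nat \<Rightarrow> real \<times> real \<Rightarrow> real" where
  "dens j p = \<epsilon> j * ((norm (nx j p))\<^sup>2 + (norm (ny j p))\<^sup>2)
     + 1 / \<epsilon> j * W_pot \<sigma> (nj j p) + 1 / \<epsilon> j * (gx j p + nj j p $ 1)\<^sup>2 + 1 / \<epsilon> j * (gy j p + nj j p $ 2)\<^sup>2"

lemma dens_measurable: "dens j \<in> borel_measurable (torus_measure l)"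
proof -
  note [measurable] = integrables[THEN borel_measurable_integrable] integrables(1)[THEN integrable_nth, THEN borel_measurable_integrable]
    borel_measurable_continuous_onI[OF continuous_W_pot[OF \<sigma>]]
  show ?thesis unfolding dens_def by measurable
qed

lemma le_energy:
  assumes "c \<ge> 0" "\<And>p. X p \<le> c * dens j p"
  shows "(\<integral>\<^sup>+p. ennreal (X p) \<partial>torus_measure l) \<le> ennreal (c * Fr j)"
proof -
  have "(\<integral>\<^sup>+p. ennreal (X p) \<partial>torus_measure l) \<le> (\<integral>\<^sup>+p. ennreal c * ennreal (dens j p) \<partial>torus_measure l)"
    using assms by (intro nn_integral_mono) (simp add: ennreal_mult'[symmetric] ennreal_leI)
  also have "\<dots> = ennreal c * (\<integral>\<^sup>+p. ennreal (dens j p) \<partial>torus_measure l)"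
    using dens_measurable by (intro nn_integral_cmult) simp
  also have "(\<integral>\<^sup>+p. ennreal (dens j p) \<partial>torus_measure l) = ennreal (Fr j)"
    unfolding F(1)[symmetric] F_energy_def dens_def ..
  finally show ?thesis using assms(1) by (simp add: ennreal_mult')
qed

text \<open>The first three bounds keep a single term of the density and multiply by
  \<open>\<epsilon> j\<close>. The last is the inequality of Modica and Mortola: a square weighted
  by the square root of \<open>\<epsilon> j\<close> is expanded, and its factor 1/2 becomes the
  factor 2 in front of \<open>c0_const\<close>.\<close>

lemma dens_bounds:
  "W_pot \<sigma> (nj j p) \<le> \<epsilon> j * dens j p"
  "(gx j p + nj j p $ 1)\<^sup>2 \<le> \<epsilon> j * dens j p"
  "(gy j p + nj j p $ 2)\<^sup>2 \<le> \<epsilon> j * dens j p"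
  "wt \<sigma> (nj j p) * norm (nx j p) \<le> 1 / 2 * dens j p"
proof -
  let ?e = "\<epsilon> j"
  have e: "?e > 0" by (rule \<epsilon>)
  have pos: "0 \<le> ?e * ((norm (nx j p))\<^sup>2 + (norm (ny j p))\<^sup>2)" "0 \<le> 1 / ?e * W_pot \<sigma> (nj j p)"
    "0 \<le> 1 / ?e * (gx j p + nj j p $ 1)\<^sup>2" "0 \<le> 1 / ?e * (gy j p + nj j p $ 2)\<^sup>2"
    using e W_pot_nonneg[OF \<sigma>] by auto
  have 1: "x \<le> ?e * dens j p" if "1 / ?e * x \<le> dens j p" for x
    using mult_left_mono[OF that, of ?e] e by simp
  show "W_pot \<sigma> (nj j p) \<le> ?e * dens j p" "(gx j p + nj j p $ 1)\<^sup>2 \<le> ?e * dens j p" "(gy j p + nj j p $ 2)\<^sup>2 \<le> ?e * dens j p"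
    by (rule 1, use pos in \<open>simp add: dens_def\<close>)+
  define s where "s = sqrt ?e"
  have s: "s > 0" "s * s = ?e" using e by (auto simp: s_def)
  have "0 \<le> (s * norm (nx j p) - wt \<sigma> (nj j p) / s)\<^sup>2" by simp
  also have "\<dots> = ?e * (norm (nx j p))\<^sup>2 + (wt \<sigma> (nj j p))\<^sup>2 / ?e - 2 * (wt \<sigma> (nj j p) * norm (nx j p))"
    using s by (simp add: power2_diff power_mult_distrib power_divide) (simp add: power2_eq_square)
  finally have "2 * (wt \<sigma> (nj j p) * norm (nx j p)) \<le> ?e * (norm (nx j p))\<^sup>2 + 1 / ?e * W_pot \<sigma> (nj j p)"
    using W_pot_nonneg[OF \<sigma>, of "nj j p"] by (simp add: wt_def)
  also have "\<dots> \<le> dens j p"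
    using pos e by (simp add: dens_def distrib_left)
  finally show "wt \<sigma> (nj j p) * norm (nx j p) \<le> 1 / 2 * dens j p" by simp
qed

lemma \<epsilon>Fr: "(\<lambda>j. \<epsilon> j * Fr j) \<longlonglongrightarrow> 0"
  using tendsto_mult[OF \<epsilon>0 F(3)] by simp

text \<open>By Fatou the integral of W(n) is at most the lower limit of
  \<open>\<epsilon> j * Fr j\<close>, which is 0 as the energies converge.\<close>

lemma n_wells: "AE p in torus_measure l. n p \<in> {n_plus \<sigma>, n_minus \<sigma>}"
proof -
  have Wc: "continuous_on UNIV (W_pot \<sigma>)" by (rule continuous_W_pot[OF \<sigma>])
  note [measurable] = integrables(1)[THEN borel_measurable_integrable] n_integrable[THEN borel_measurable_integrable]
    borel_measurable_continuous_onI[OF Wc]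
  have "(\<integral>\<^sup>+p. ennreal (W_pot \<sigma> (n p)) \<partial>torus_measure l) = (\<integral>\<^sup>+p. liminf (\<lambda>j. ennreal (W_pot \<sigma> (nj j p))) \<partial>torus_measure l)"
  proof (rule nn_integral_cong_AE)
    show "AE p in torus_measure l. ennreal (W_pot \<sigma> (n p)) = liminf (\<lambda>j. ennreal (W_pot \<sigma> (nj j p)))"
      using AEconv
    proof eventually_elim
      case (elim p)
      have "(\<lambda>j. W_pot \<sigma> (nj j p)) \<longlonglongrightarrow> W_pot \<sigma> (n p)"
        by (rule continuous_on_tendsto_compose[OF Wc elim]) auto
      then have "(\<lambda>j. ennreal (W_pot \<sigma> (nj j p))) \<longlonglongrightarrow> ennreal (W_pot \<sigma> (n p))" by (rule tendsto_ennrealI)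
      then show ?case by (intro lim_imp_Liminf[symmetric]) auto
    qed
  qed
  also have "\<dots> \<le> liminf (\<lambda>j. \<integral>\<^sup>+p. ennreal (W_pot \<sigma> (nj j p)) \<partial>torus_measure l)"
    by (rule nn_integral_liminf) measurable
  also have "\<dots> \<le> liminf (\<lambda>j. ennreal (\<epsilon> j * Fr j))"
    using le_energy[OF less_imp_le[OF \<epsilon>] dens_bounds(1)] by (intro Liminf_mono) auto
  also have "\<dots> = 0"
    using tendsto_ennrealI[OF \<epsilon>Fr] by (intro lim_imp_Liminf) auto
  finally have "(\<integral>\<^sup>+p. ennreal (W_pot \<sigma> (n p)) \<partial>torus_measure l) = 0" by simp
  then have "AE p in torus_measure l. ennreal (W_pot \<sigma> (n p)) = 0"
    by (subst (asm) nn_integral_0_iff_AE) auto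
  with n_sphere show ?thesis
  proof eventually_elim
    case (elim p)
    then show ?case using W_pot_nonneg[OF \<sigma>, of "n p"] by (intro W_pot_zero_sphere[OF \<sigma>]) auto
  qed
qed

lemma g_integrable: "integrable (torus_measure l) g" and gj_g_L1: "(\<lambda>j. LINT p|torus_measure l. \<bar>gj j p - g p\<bar>) \<longlonglongrightarrow> 0"
proof -
  have gm: "g \<in> borel_measurable (torus_measure l)" and g2: "integrable (torus_measure l) (\<lambda>p. (g p)\<^sup>2)"
    using g by (auto simp: L2_torus_def)
  show gi: "integrable (torus_measure l) g"
    by (rule M.square_integrable_imp_integrable[OF gm g2])
  show "(\<lambda>j. LINT p|torus_measure l. \<bar>gj j p - g p\<bar>) \<longlonglongrightarrow> 0"
  proof (rule M.L2_tendsto_imp_L1_tendsto[OF _ _ gconv])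
    fix j
    have gj2: "integrable (torus_measure l) (\<lambda>p. (gj j p)\<^sup>2)"
      using Y[of j] by (auto simp: Y_space_def W12_torus_def L2_torus_def)
    show "integrable (torus_measure l) (\<lambda>p. gj j p - g p)" using gi integrables(4) by auto
    show "integrable (torus_measure l) (\<lambda>p. (gj j p - g p)\<^sup>2)"
    proof (rule Bochner_Integration.integrable_bound)
      show "integrable (torus_measure l) (\<lambda>p. 2 * (gj j p)\<^sup>2 + 2 * (g p)\<^sup>2)" using gj2 g2 by auto
      show "(\<lambda>p. (gj j p - g p)\<^sup>2) \<in> borel_measurable (torus_measure l)"
        using gm integrables(4)[THEN borel_measurable_integrable, of j] by measurable
      show "AE p in torus_measure l. norm ((gj j p - g p)\<^sup>2) \<le> norm (2 * (gj j p)\<^sup>2 + 2 * (g p)\<^sup>2)"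
      proof (rule AE_I2)
        fix p
        have "(gj j p - g p)\<^sup>2 \<le> 2 * (gj j p)\<^sup>2 + 2 * (g p)\<^sup>2"
          using zero_le_power2[of "gj j p + g p"] by (simp add: power2_sum power2_diff)
        then show "norm ((gj j p - g p)\<^sup>2) \<le> norm (2 * (gj j p)\<^sup>2 + 2 * (g p)\<^sup>2)" by simp
      qed
    qed
  qed
qed

text \<open>The energy controls the square of \<open>v j p + nj j p $ i\<close> with the vanishing
  factor \<open>\<epsilon> j\<close>, so this sum tends to 0 in L2 and hence in L1. Thus
  \<open>v j\<close> converges in L1 to minus the component of \<open>n\<close>, and weak
  derivatives pass to the limit.\<close>

lemma weak_limit:
  assumes e: "e \<in> {(1, 0), (0, 1)}" and w: "\<And>j. has_weak_deriv l e (gj j) (v j)"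
    and le: "\<And>j p. (v j p + nj j p $ i)\<^sup>2 \<le> \<epsilon> j * dens j p"
  shows "has_weak_deriv l e g (\<lambda>p. - (n p $ i))"
proof (rule has_weak_deriv_limit[OF w e g_integrable _ gj_g_L1])
  have vi: "integrable (torus_measure l) (v j)" for j using w[of j] by (simp add: has_weak_deriv_def)
  have ni: "integrable (torus_measure l) (\<lambda>p. n p $ i)" by (rule integrable_nth[OF n_integrable])
  have nji: "integrable (torus_measure l) (\<lambda>p. nj j p $ i)" for j by (rule integrable_nth[OF integrables(1)])
  show "integrable (torus_measure l) (\<lambda>p. - (n p $ i))" using ni by simp
  define q where "q j p = v j p + nj j p $ i" for j p
  have qi: "integrable (torus_measure l) (q j)" for j
    unfolding q_def using vi nji by (intro Bochner_Integration.integrable_add)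
  have nn: "(\<integral>\<^sup>+p. ennreal ((q j p)\<^sup>2) \<partial>torus_measure l) \<le> ennreal (\<epsilon> j * Fr j)" for j
    unfolding q_def by (rule le_energy[OF less_imp_le[OF \<epsilon>] le])
  have q2: "integrable (torus_measure l) (\<lambda>p. (q j p)\<^sup>2)" for j
    using borel_measurable_integrable[OF qi[of j]] le_less_trans[OF nn[of j] ennreal_less_top]
    by (intro integrableI_nonneg) auto
  have "(\<lambda>j. LINT p|torus_measure l. (q j p)\<^sup>2) \<longlonglongrightarrow> 0"
  proof (rule tendsto_sandwich[OF _ _ tendsto_const \<epsilon>Fr])
    show "eventually (\<lambda>j. (LINT p|torus_measure l. (q j p)\<^sup>2) \<le> \<epsilon> j * Fr j) sequentially"
      using nn \<epsilon> F(2) by (intro always_eventually allI integral_real_bounded) (auto simp: less_imp_le)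
  qed simp
  from M.L2_tendsto_imp_L1_tendsto[OF qi q2 this]
  have q: "(\<lambda>j. LINT p|torus_measure l. \<bar>q j p\<bar>) \<longlonglongrightarrow> 0" .
  have lim: "(\<lambda>j. (LINT p|torus_measure l. \<bar>q j p\<bar>) + (LINT p|torus_measure l. norm (nj j p - n p))) \<longlonglongrightarrow> 0"
    using tendsto_add[OF q nconv] by simp
  show "(\<lambda>j. LINT p|torus_measure l. \<bar>v j p - - (n p $ i)\<bar>) \<longlonglongrightarrow> 0"
  proof (rule tendsto_sandwich[OF _ _ tendsto_const lim])
    show "eventually (\<lambda>j. (LINT p|torus_measure l. \<bar>v j p - - (n p $ i)\<bar>) \<le> (LINT p|torus_measure l. \<bar>q j p\<bar>) + (LINT p|torus_measure l. norm (nj j p - n p))) sequentially"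
    proof (rule always_eventually, rule allI)
      fix j
      have nd: "integrable (torus_measure l) (\<lambda>p. norm (nj j p - n p))"
        using integrables(1) n_integrable by (intro integrable_norm Bochner_Integration.integrable_diff)
      have "(LINT p|torus_measure l. \<bar>v j p - - (n p $ i)\<bar>) \<le> (LINT p|torus_measure l. \<bar>q j p\<bar> + norm (nj j p - n p))"
      proof (rule integral_mono)
        show "integrable (torus_measure l) (\<lambda>p. \<bar>v j p - - (n p $ i)\<bar>)"
          using vi ni by (intro integrable_abs Bochner_Integration.integrable_diff Bochner_Integration.integrable_minus)
        show "integrable (torus_measure l) (\<lambda>p. \<bar>q j p\<bar> + norm (nj j p - n p))"
          using qi nd by (intro Bochner_Integration.integrable_add integrable_abs)
        show "\<bar>v j p - - (n p $ i)\<bar> \<le> \<bar>q j p\<bar> + norm (nj j p - n p)" for p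
          using component_le_norm_cart[of "nj j p - n p" i] by (simp add: q_def)
      qed
      also have "\<dots> = (LINT p|torus_measure l. \<bar>q j p\<bar>) + (LINT p|torus_measure l. norm (nj j p - n p))"
        using qi nd by (intro Bochner_Integration.integral_add integrable_abs)
      finally show "(LINT p|torus_measure l. \<bar>v j p - - (n p $ i)\<bar>) \<le> (LINT p|torus_measure l. \<bar>q j p\<bar>) + (LINT p|torus_measure l. norm (nj j p - n p))" .
    qed
  qed simp
qed

lemma g_weak_x: "has_weak_deriv l (1, 0) g (\<lambda>p. - (n p $ 1))"
  by (rule weak_limit[OF _ weak_derivs(3) dens_bounds(2)]) simp

lemma g_weak_y: "has_weak_deriv l (0, 1) g (\<lambda>p. - (n p $ 2))"
  by (rule weak_limit[OF _ weak_derivs(4) dens_bounds(3)]) simp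

lemma n2_zero: "AE p in torus_measure l. n p $ 2 = 0"
  using n_wells by eventually_elim (auto simp: n_plus_def n_minus_def)

lemma weak_dx_g: "AE p in torus_measure l. weak_dx l g p = - (n p $ 1)"
proof -
  have "has_weak_deriv l (1, 0) g (weak_dx l g)"
    unfolding weak_deriv_def by (rule someI[of "has_weak_deriv l (1, 0) g", OF g_weak_x])
  from has_weak_deriv_unique[OF l this g_weak_x] show ?thesis by (simp add: AE_torus)
qed

text \<open>Mixed derivatives commute, here at the level of coefficients: those of n_1 = -g_x are
  multiples of those of g, and the latter vanish for b nonzero because g_y = -n_2 = 0. The mean of
  n_1 is the coefficient of a derivative at frequency 0.\<close>

lemma limit_reps:
  obtains N k kg where "N \<in> borel_measurable (torus_prod l)" "AE p in torus_prod l. n p = N p"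
    "AE p in torus_prod l. N p = k (fst p)" "AE p in torus_prod l. g p = kg (fst p)"
    "(LINT p|torus_measure l. n p $ 1) = 0"
proof -
  obtain N where N: "N \<in> borel_measurable (torus_prod l)" "AE p in torus_prod l. n p = N p"
    using borel_rep_torus[OF borel_measurable_integrable[OF n_integrable]] by (rule bexE)
  obtain H where H: "H \<in> borel_measurable (torus_prod l)" "AE p in torus_prod l. g p = H p"
    using borel_rep_torus[OF borel_measurable_integrable[OF g_integrable]] by (rule bexE)
  have N1: "(\<lambda>p. - (N p $ 1)) \<in> borel_measurable (torus_prod l)" using N(1) by (intro borel_measurable_uminus measurable_compose[OF _ borel_measurable_nth])
  have N1': "AE p in torus_prod l. - (n p $ 1) = - (N p $ 1)" using N(2) by eventually_elim simp
  have n2: "AE p in torus_prod l. - (n p $ 2) = 0" using n2_zero unfolding AE_torus by eventually_elim simp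
  note x = has_weak_deriv_trig[OF l g_weak_x H N1 N1', unfolded fst_conv snd_conv mult_1_right mult_zero_right add_0_right real_scaleR_def]
  note y = has_weak_deriv_trig[OF l g_weak_y H borel_measurable_const n2, unfolded fst_conv snd_conv mult_1_right mult_zero_right add_0_left real_scaleR_def]
  have neg: "(LINT p|torus_prod l. trig l a b c p * - (N p $ 1)) = - (LINT p|torus_prod l. trig l a b c p * (N p $ 1))" for a b c
    by simp
  have y0: "of_int b * (LINT p|torus_prod l. trig l a b c p * H p) = 0" for a b c
    using y(3)[of b a c] l by auto
  obtain kg where kg: "AE p in torus_prod l. H p = kg (fst p)"
    using depends_on_x_of_trig[OF l x(1) y0] by blast
  have iN1: "integrable (torus_prod l) (\<lambda>p. N p $ 1)"
    using Bochner_Integration.integrable_minus[OF x(2)] by simp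
  have "of_int b * (LINT p|torus_prod l. trig l a b c p * (N p $ 1)) = 0" for a b c
  proof -
    have "- (LINT p|torus_prod l. trig l a b c p * (N p $ 1)) = of_int a * pi / l * (LINT p|torus_prod l. trig l a b (c - pi / 2) p * H p)"
      using x(3)[of a b "c - pi / 2"] neg[of a b c] by simp
    moreover have "r * x = - s * (r * y)" if "- x = s * y" for r s x y :: real
    proof -
      have "x = - (s * y)" using that by linarith
      then show ?thesis by simp
    qed
    ultimately have "of_int b * (LINT p|torus_prod l. trig l a b c p * (N p $ 1))
        = - (of_int a * pi / l) * (of_int b * (LINT p|torus_prod l. trig l a b (c - pi / 2) p * H p))"
      by blast
    then show ?thesis by (simp only: y0 mult_zero_right)
  qed
  from depends_on_x_of_trig[OF l iN1 this]
  obtain k1 where k1: "AE p in torus_prod l. N p $ 1 = k1 (fst p)" by blast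
  \<comment> \<open>On the wells the sign of the first component determines the whole
    vector.\<close>
  define k where "k t = (if k1 t > 0 then n_plus \<sigma> else n_minus \<sigma>)" for t
  have "AE p in torus_prod l. N p = k (fst p)"
    using k1 N(2) n_wells[unfolded AE_torus]
  proof eventually_elim
    case (elim p)
    then show ?case using n1_bar_pos[OF \<sigma>] by (auto simp: k_def n_plus_def n_minus_def)
  qed
  moreover have "AE p in torus_prod l. g p = kg (fst p)" using kg H(2) by eventually_elim simp
  moreover have "(LINT p|torus_measure l. n p $ 1) = 0"
  proof -
    have "(LINT p|torus_measure l. n p $ 1) = (LINT p|torus_prod l. N p $ 1)"
      by (rule integral_torus[OF borel_measurable_integrable[OF iN1]]) (use N(2) in \<open>auto elim: eventually_mono\<close>)
    also have "\<dots> = (LINT p|torus_prod l. trig l 0 0 0 p * (N p $ 1))" by (simp add: trig_def)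
    \<comment> \<open>The frequency factor is 0, and the phase is chosen so that the test function
      is cos 0 = 1.\<close>
    also have "\<dots> = 0" using x(3)[of 0 0 "- pi / 2"] neg[of 0 0 0] by simp
    finally show ?thesis .
  qed
  ultimately show thesis using N that by blast
qed

text \<open>The weighted speed integrates to at most half the energy, so the jump estimate holds
  with L / 2 in place of the full limit energy.\<close>

lemma jump_bound:
  assumes N: "N \<in> borel_measurable (torus_prod l)" "AE p in torus_prod l. n p = N p" and h: "0 < h" "h < 2 * l"
  shows "c0_const \<sigma> * measure (torus_prod l) {p. N p \<noteq> N (shift_x l h p)} \<le> h * (L / 2)"
proof -
  interpret T: finite_measure "torus_prod l" by (rule finite_measure_torus_prod)
  have "\<forall>j. \<exists>U. U \<in> borel_measurable (torus_prod l) \<and> (AE p in torus_prod l. nj j p = U p)"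
    using borel_rep_torus[OF borel_measurable_integrable[OF integrables(1)]] unfolding Bex_def by blast
  from choice[OF this] obtain U where U: "\<And>j. U j \<in> borel_measurable (torus_prod l)" "\<And>j. AE p in torus_prod l. nj j p = U j p"
    by blast
  have "\<forall>j. \<exists>V. V \<in> borel_measurable (torus_prod l) \<and> (AE p in torus_prod l. nx j p = V p)"
    using borel_rep_torus[OF borel_measurable_integrable[OF integrables(2)]] unfolding Bex_def by blast
  from choice[OF this] obtain V where V: "\<And>j. V j \<in> borel_measurable (torus_prod l)" "\<And>j. AE p in torus_prod l. nx j p = V j p"
    by blast
  have wx: "weak_x l (U j) (V j)" for j
    using has_weak_deriv_trig[OF l weak_derivs(1)[of j] U(1)[of j] U(2)[of j] V(1)[of j] V(2)[of j]]
    by (simp add: weak_x_def)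
  have L0: "L \<ge> 0" using F(2,3) by (intro LIMSEQ_le_const) auto
  have "ennreal (c0_const \<sigma>) * emeasure (torus_prod l) {p. N p \<noteq> N (shift_x l h p)} \<le> ennreal h * ennreal (L / 2)"
  proof (rule jump_measure_le[where b = "\<lambda>j. ennreal (1 / 2 * Fr j)", OF \<sigma> l h wx])
    show "AE p in torus_prod l. norm (U j p) = 1" for j
      using nj_sphere[of j, unfolded AE_torus] U(2)[of j] by eventually_elim simp
    show "AE p in torus_prod l. N p \<in> {n_plus \<sigma>, n_minus \<sigma>}"
      using n_wells[unfolded AE_torus] N(2) by eventually_elim simp
    have "AE p in torus_prod l. \<forall>j. nj j p = U j p" unfolding AE_all_countable using U(2) by blast
    with AEconv[unfolded AE_torus] N(2) show "AE p in torus_prod l. (\<lambda>j. U j p) \<longlonglongrightarrow> N p"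
      by eventually_elim simp
    show "(\<integral>\<^sup>+p. ennreal (wt \<sigma> (U j p) * norm (V j p)) \<partial>torus_prod l) \<le> ennreal (1 / 2 * Fr j)" for j
    proof -
      note [measurable] = borel_wt[OF \<sigma>]
      have "(\<integral>\<^sup>+p. ennreal (wt \<sigma> (U j p) * norm (V j p)) \<partial>torus_prod l) = (\<integral>\<^sup>+p. ennreal (wt \<sigma> (nj j p) * norm (nx j p)) \<partial>torus_measure l)"
      proof (rule nn_integral_torus[symmetric])
        show "(\<lambda>p. ennreal (wt \<sigma> (U j p) * norm (V j p))) \<in> borel_measurable (torus_prod l)"
          using U(1)[of j] V(1)[of j] by measurable
        show "AE p in torus_prod l. ennreal (wt \<sigma> (nj j p) * norm (nx j p)) = ennreal (wt \<sigma> (U j p) * norm (V j p))"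
          using U(2)[of j] V(2)[of j] by eventually_elim simp
      qed
      also have "\<dots> \<le> ennreal (1 / 2 * Fr j)"
        by (rule le_energy[OF _ dens_bounds(4)]) simp
      finally show ?thesis .
    qed
    show "(\<lambda>j. ennreal (1 / 2 * Fr j)) \<longlonglongrightarrow> ennreal (L / 2)"
      using tendsto_mult[OF tendsto_const[of "1/2"] F(3)] by (intro tendsto_ennrealI) simp
  qed (rule N(1))
  then have "ennreal (c0_const \<sigma> * measure (torus_prod l) {p. N p \<noteq> N (shift_x l h p)}) \<le> ennreal (h * (L / 2))"
    using c0_pos[OF \<sigma>] h L0
    by (simp only: T.emeasure_eq_measure ennreal_mult' less_imp_le)
  then show ?thesis using h L0 by (subst (asm) ennreal_le_iff) auto
qed

text \<open>A function of \<open>n\<close> takes two values, so its increments have size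
  \<open>norm (f (n_plus \<sigma>) - f (n_minus \<sigma>))\<close> on the jump set and are 0
  elsewhere. One estimate thus covers \<open>n\<close>, g_x = -n_1 and the indicator of the set
  where n = n^-.\<close>

lemma total_variation_comp_le:
  fixes u :: "real \<times> real \<Rightarrow> 'b::euclidean_space" and f :: "real^3 \<Rightarrow> 'b"
  assumes u: "AE p in torus_measure l. u p = f (n p)"
  shows "integrable (torus_measure l) u"
    and "total_variation l u \<le> ennreal (norm (f (n_plus \<sigma>) - f (n_minus \<sigma>)) * (L / (2 * c0_const \<sigma>)))"
proof -
  interpret T: finite_measure "torus_prod l" by (rule finite_measure_torus_prod)
  obtain N k kg where N: "N \<in> borel_measurable (torus_prod l)" "AE p in torus_prod l. n p = N p" and k: "AE p in torus_prod l. N p = k (fst p)"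
    by (rule limit_reps)
  have Nm [measurable]: "N \<in> borel_measurable (borel \<Otimes>\<^sub>M borel)" using N(1) by simp
  \<comment> \<open>\<open>f\<close> is replaced by a two-valued map that agrees with it on the
    wells; composed with \<open>N\<close> it is Borel for arbitrary \<open>f\<close>.\<close>
  define f' where "f' q = (if q = n_plus \<sigma> then f (n_plus \<sigma>) else f (n_minus \<sigma>))" for q
  define U where "U p = f' (N p)" for p
  have Um [measurable]: "U \<in> borel_measurable (borel \<Otimes>\<^sub>M borel)" unfolding U_def f'_def by measurable
  have uU: "AE p in torus_prod l. u p = U p"
    using u[unfolded AE_torus] n_wells[unfolded AE_torus] N(2) by eventually_elim (auto simp: U_def f'_def)
  have iU: "integrable (torus_prod l) U"
    by (rule T.integrable_const_bound[of _ "max (norm (f (n_plus \<sigma>))) (norm (f (n_minus \<sigma>)))"]) (auto simp: U_def f'_def)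
  show "integrable (torus_measure l) u"
    using integrable_torus[OF _ uU] iU borel_measurable_integrable[OF iU] by blast
  let ?C = "norm (f (n_plus \<sigma>) - f (n_minus \<sigma>))"
  have Uk: "AE p in torus_prod l. U p = f' (k (fst p))" using k by eventually_elim (simp add: U_def)
  show "total_variation l u \<le> ennreal (?C * (L / (2 * c0_const \<sigma>)))"
  proof (rule total_variation_le[OF l iU uU Uk])
    fix h :: real assume h: "0 < h" "h < 2 * l"
    define D where "D = {p. N p \<noteq> N (shift_x l h p)}"
    have D: "D \<in> sets (torus_prod l)"
    proof -
      have "{p \<in> space (borel \<Otimes>\<^sub>M borel). N p \<noteq> N (shift_x l h p)} \<in> sets (borel \<Otimes>\<^sub>M borel)" by measurable
      then show ?thesis by (simp add: D_def space_pair_measure)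
    qed
    have "(LINT p|torus_prod l. norm (U (shift_x l h p) - U p)) \<le> (LINT p|torus_prod l. ?C * indicator D p)"
    proof (rule integral_mono)
      show "integrable (torus_prod l) (\<lambda>p. norm (U (shift_x l h p) - U p))"
        using iU integral_torus_shift(2)[OF l _ h(2) Um iU] h by auto
      show "integrable (torus_prod l) (\<lambda>p. ?C * indicator D p)"
        using D by (intro integrable_mult_right integrable_real_indicator) (auto simp: T.emeasure_eq_measure)
      show "norm (U (shift_x l h p) - U p) \<le> ?C * indicator D p" for p
        by (cases "p \<in> D") (auto simp: U_def f'_def D_def norm_minus_commute)
    qed
    also have "\<dots> = ?C * measure (torus_prod l) D" using D by simp
    also have "\<dots> \<le> ?C * (h * (L / (2 * c0_const \<sigma>)))"
    proof (rule mult_left_mono)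
      show "measure (torus_prod l) D \<le> h * (L / (2 * c0_const \<sigma>))"
        using jump_bound[OF N h] c0_pos[OF \<sigma>] by (simp add: D_def field_simps)
    qed simp
    finally show "(LINT p|torus_prod l. norm (U (shift_x l h p) - U p)) \<le> ?C * (L / (2 * c0_const \<sigma>)) * h"
      by (simp add: mult.commute mult.left_commute)
  qed
qed

text \<open>The weak derivatives of \<open>g\<close> are the negatives of components of a unit
  vector, hence bounded and square integrable on the torus; this puts \<open>g\<close> into the
  Sobolev space.\<close>

lemma limit_in_A_space: "(n, g) \<in> A_space \<sigma> l"
proof -
  obtain N k kg where N: "N \<in> borel_measurable (torus_prod l)" "AE p in torus_prod l. n p = N p" and k: "AE p in torus_prod l. N p = k (fst p)"
    and kg: "AE p in torus_prod l. g p = kg (fst p)" and mean: "(LINT p|torus_measure l. n p $ 1) = 0"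
    by (rule limit_reps)
  have bvn: "BV_torus l n"
    unfolding BV_torus_def using total_variation_comp_le[of n "\<lambda>x. x"]
    by (auto intro: le_less_trans[OF _ ennreal_less_top])
  have bvg: "BV_torus l (weak_dx l g)"
    unfolding BV_torus_def using total_variation_comp_le[of "weak_dx l g" "\<lambda>x. - (x $ 1)", OF weak_dx_g]
    by (auto intro: le_less_trans[OF _ ennreal_less_top])
  have "AE p in torus_prod l. n p = k (fst p)" using N(2) k by eventually_elim simp
  then have dn: "depends_on_x_only l n" unfolding depends_on_x_only_def AE_torus by (rule exI[of _ k])
  have dg: "depends_on_x_only l g"
    unfolding depends_on_x_only_def AE_torus using kg by (rule exI[of _ kg])
  have L2: "L2_torus l (\<lambda>p. - (n p $ i))" for i
    unfolding L2_torus_def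
  proof
    have m: "(\<lambda>p. n p $ i) \<in> borel_measurable (torus_measure l)"
      using integrable_nth[OF n_integrable] by (rule borel_measurable_integrable)
    then show "(\<lambda>p. - (n p $ i)) \<in> borel_measurable (torus_measure l)" by (rule borel_measurable_uminus)
    show "integrable (torus_measure l) (\<lambda>p. (norm (- (n p $ i)))\<^sup>2)"
    proof (rule M.integrable_const_bound[of _ 1])
      show "AE p in torus_measure l. norm ((norm (- (n p $ i)))\<^sup>2) \<le> 1"
        using n_sphere
      proof eventually_elim
        case (elim p)
        then have "\<bar>n p $ i\<bar> \<le> 1" using component_le_norm_cart[of "n p" i] by simp
        then show ?case by (simp add: abs_square_le_1)
      qed
      show "(\<lambda>p. (norm (- (n p $ i)))\<^sup>2) \<in> borel_measurable (torus_measure l)" using m by simp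
    qed
  qed
  have W12: "W12_torus l g"
    unfolding W12_torus_def using g g_weak_x g_weak_y L2 by auto
  have "AE p in torus_measure l. weak_dx l g p \<in> {n1_bar \<sigma>, - n1_bar \<sigma>}"
    using weak_dx_g n_wells by eventually_elim (auto simp: n_plus_def n_minus_def)
  moreover have "AE p in torus_measure l. weak_dx l g p + n p $ 1 = 0"
    using weak_dx_g by eventually_elim simp
  ultimately show ?thesis
    unfolding A_space_def using bvn bvg dn dg W12 n_wells n2_zero mean by blast
qed

text \<open>The indicator of the well n^- jumps by exactly 1, so the variation bound is L / (2 c0)
  and the constant cancels.\<close>

lemma perimeter_le: "ennreal (2 * c0_const \<sigma>) * perimeter_torus l {p \<in> torus l. n p = n_minus \<sigma>} \<le> ennreal L"
proof -
  have "AE p in torus_measure l. p \<in> torus l" unfolding AE_torus by (rule AE_in_torus)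
  then have "AE p in torus_measure l. indicator {p \<in> torus l. n p = n_minus \<sigma>} p = (if n p = n_minus \<sigma> then 1 else 0 :: real)"
    by eventually_elim (auto simp: indicator_def)
  from total_variation_comp_le(2)[of "indicator {p \<in> torus l. n p = n_minus \<sigma>}" "\<lambda>q. if q = n_minus \<sigma> then 1 else 0 :: real", OF this]
  have "perimeter_torus l {p \<in> torus l. n p = n_minus \<sigma>} \<le> ennreal (L / (2 * c0_const \<sigma>))"
    using n_plus_neq_n_minus[OF \<sigma>] by (simp add: perimeter_torus_def)
  then have "ennreal (2 * c0_const \<sigma>) * perimeter_torus l {p \<in> torus l. n p = n_minus \<sigma>} \<le> ennreal (2 * c0_const \<sigma>) * ennreal (L / (2 * c0_const \<sigma>))"
    by (rule mult_left_mono) simp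
  also have "\<dots> = ennreal L" using c0_pos[OF \<sigma>] by (simp add: ennreal_mult'[symmetric])
  finally show ?thesis .
qed

end

text \<open>If the lower limit is infinite, the inequality is trivial. Membership in
  \<open>A_space\<close> is asserted for finite lower limits: a constant sequence converges to its
  value, whichever element of \<open>Y_space\<close> that is.\<close>

theorem lemma2p1:
  fixes \<sigma> l :: real
    and \<epsilon> :: "nat \<Rightarrow> real"
    and n :: "real \<times> real \<Rightarrow> real^3" and g :: "real \<times> real \<Rightarrow> real"
    and nj :: "nat \<Rightarrow> real \<times> real \<Rightarrow> real^3" and gj :: "nat \<Rightarrow> real \<times> real \<Rightarrow> real"
  assumes "\<sigma> > 0" and "l > 0"
    and "\<And>j. \<epsilon> j > 0" and "\<epsilon> \<longlonglongrightarrow> 0"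
    and "L1_sphere l n" and "L2_torus l g"
    and "\<And>j. (nj j, gj j) \<in> Y_space l"
    and "(\<lambda>j. LINT p|torus_measure l. norm (nj j p - n p)) \<longlonglongrightarrow> 0"
    and "(\<lambda>j. LINT p|torus_measure l. (gj j p - g p)\<^sup>2) \<longlonglongrightarrow> 0"
  shows "liminf (\<lambda>j. G_energy \<sigma> l (\<epsilon> j) (nj j) (gj j)) \<ge> G_limit \<sigma> l n g \<and>
    (liminf (\<lambda>j. G_energy \<sigma> l (\<epsilon> j) (nj j) (gj j)) < \<infinity> \<longrightarrow> (n, g) \<in> A_space \<sigma> l)"
proof -
  define E where "E j = F_energy \<sigma> l (\<epsilon> j) (nj j) (gj j)" for j
  have GE: "G_energy \<sigma> l (\<epsilon> j) (nj j) (gj j) = E j" for j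
    using assms(7)[of j] by (simp add: G_energy_def E_def)
  have "(n, g) \<in> A_space \<sigma> l \<and> ennreal (2 * c0_const \<sigma>) * perimeter_torus l {p \<in> torus l. n p = n_minus \<sigma>} \<le> liminf E"
    if fin: "liminf E < \<infinity>"
  proof -
    \<comment> \<open>Three extractions follow: a subsequence that realises the lower limit of the
      energies, a further one along which \<open>nj\<close> converges almost everywhere, and the
      removal of finitely many terms, after which all energies are finite real numbers.\<close>
    obtain r where r: "strict_mono r" "(E \<circ> r) \<longlonglongrightarrow> liminf E" using liminf_subseq_lim by blast
    have ni: "integrable (torus_measure l) (nj j)" for j
      using W12_torus_weak_deriv(1)[of l "nj j"] assms(7)[of j] by (auto simp: Y_space_def has_weak_deriv_def)
    have "integrable (torus_measure l) n" using assms(5) by (simp add: L1_sphere_def)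
    then have "integrable (torus_measure l) (\<lambda>p. nj (r k) p - n p)" for k using ni by simp
    moreover have "(\<lambda>k. LINT p|torus_measure l. norm (nj (r k) p - n p)) \<longlonglongrightarrow> 0"
      using LIMSEQ_subseq_LIMSEQ[OF assms(8) r(1)] by (simp add: o_def)
    ultimately obtain s where s: "strict_mono s" "AE p in torus_measure l. (\<lambda>k. nj (r (s k)) p - n p) \<longlonglongrightarrow> 0"
      using tendsto_L1_AE_subseq[of "torus_measure l" "\<lambda>k p. nj (r k) p - n p"] by blast
    have rs: "(\<lambda>k. E (r (s k))) \<longlonglongrightarrow> liminf E"
      using LIMSEQ_subseq_LIMSEQ[OF r(2) s(1)] by (simp add: o_def)
    then have "eventually (\<lambda>k. E (r (s k)) < \<infinity>) sequentially" using fin by (rule order_tendstoD)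
    then obtain m where m: "\<And>k. k \<ge> m \<Longrightarrow> E (r (s k)) < \<infinity>" by (auto simp: eventually_sequentially)
    define t where "t k = r (s (k + m))" for k
    have t: "strict_mono t"
      using r(1) s(1) by (auto simp: t_def strict_mono_def)
    have Et: "(\<lambda>k. E (t k)) \<longlonglongrightarrow> liminf E"
      unfolding t_def using rs by (rule LIMSEQ_ignore_initial_segment)
    define Fr where "Fr k = enn2real (E (t k))" for k
    have Fr: "E (t k) = ennreal (Fr k)" for k using m[of "k + m"] by (simp add: Fr_def t_def)
    have FrL: "Fr \<longlonglongrightarrow> enn2real (liminf E)"
      unfolding Fr_def using Et fin by (intro tendsto_enn2real) auto
    have 1: "(\<lambda>k. \<epsilon> (t k)) \<longlonglongrightarrow> 0" "(\<lambda>k. LINT p|torus_measure l. norm (nj (t k) p - n p)) \<longlonglongrightarrow> 0"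
      "(\<lambda>k. LINT p|torus_measure l. (gj (t k) p - g p)\<^sup>2) \<longlonglongrightarrow> 0"
      using LIMSEQ_subseq_LIMSEQ[OF assms(4) t] LIMSEQ_subseq_LIMSEQ[OF assms(8) t] LIMSEQ_subseq_LIMSEQ[OF assms(9) t]
      by (simp_all add: o_def)
    have 2: "AE p in torus_measure l. (\<lambda>k. nj (t k) p) \<longlonglongrightarrow> n p"
      using s(2)
    proof eventually_elim
      case (elim p)
      then have "(\<lambda>k. nj (r (s k)) p) \<longlonglongrightarrow> n p" by (rule LIM_zero_cancel)
      then show ?case unfolding t_def by (rule LIMSEQ_ignore_initial_segment)
    qed
    have 3: "F_energy \<sigma> l (\<epsilon> (t k)) (nj (t k)) (gj (t k)) = ennreal (Fr k)" "Fr k \<ge> 0" for k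
      using Fr[of k] by (auto simp: E_def Fr_def)
    have "ennreal (enn2real (liminf E)) = liminf E" using fin by simp
    then show ?thesis
      using limit_in_A_space[where \<epsilon> = "\<lambda>k. \<epsilon> (t k)" and nj = "\<lambda>k. nj (t k)" and gj = "\<lambda>k. gj (t k)",
          OF assms(1,2,3) 1(1) assms(5,6,7) 1(2,3) 2 3 FrL]
        perimeter_le[where \<epsilon> = "\<lambda>k. \<epsilon> (t k)" and nj = "\<lambda>k. nj (t k)" and gj = "\<lambda>k. gj (t k)",
          OF assms(1,2,3) 1(1) assms(5,6,7) 1(2,3) 2 3 FrL] by simp
  qed
  then show ?thesis
    unfolding GE G_limit_def by (cases "liminf E < \<infinity>") (auto simp: less_top[symmetric])
qed

end
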